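(* Let $(F_j)_{j\in\mathbb Z}$ be an admissible family. For $L\in\mathbb R$ and $p\in(0,+\infty)$ let $\overline F(L,p)$ denote the effective Hamiltonian at $p$ associated with the family $(L+F_j)_{j\in\mathbb Z}$, that is, the unique real number $\lambda$ for which there exists a hull function associated with $(L+F_j)_j$, $p$ and $\lambda$. Then $(L,p)\mapsto\overline F(L,p)$ is continuous on $\mathbb R\times(0,+\infty)$ and: (i) (Bound) for every $p>0$ there is a constant $C_p$, independent of $L$, such that $|\overline F(L,p)-L|\le C_p$ for all $L\in\mathbb R$; (ii) (Monotonicity in $L$) for every $p>0$, $L\mapsto\overline F(L,p)$ is non-decreasing.
   Context: Fix integers $n\ge1$, $m\in\mathbb N$ and a real $\alpha_0>0$. For a family $v=(v_j)_{j\in\mathbb Z}$ of functions, $[v]_{j,m}(z)=(v_{j-m}(z),\dots,v_{j+m}(z))$. A family of functions $F_j:\mathbb R\times\mathbb R^{2m+1}\to\mathbb R$, $(\tau,V)\mapsto F_j(\tau,V)$, $V=(V_{-m},\dots,V_m)$, $j\in\mathbb Z$, is called admissible if: (A1) $F_j$ is continuous, and Lipschitz continuous in $V$ uniformly in $\tau$ and $j$; (A2) $F_j(\tau,V)$ is non-decreasing in $V_i$ for each $i\ne0$; (A3) $\alpha_0+2\,\partial F_j/\partial V_0\ge0$ for all $j$, i.e. $V_0\mapsto 2F_j(\tau,V)+\alpha_0V_0$ is non-decreasing; (A4) $F_j(\tau,V_{-m}+1,\dots,V_m+1)=F_j(\tau,V_{-m},\dots,V_m)$ and $F_j(\tau+1,V)=F_j(\tau,V)$;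 (A5) $F_{j+n}=F_j$ for all $j\in\mathbb Z$; (A6) for all $(V_{-m},\dots,V_m,V_{m+1})\in\mathbb R^{2m+2}$ with $V_{i+1}\ge V_i$ for all $|i|\le m$, $2F_{j+1}(\tau,V_{-m+1},\dots,V_{m+1})+\alpha_0V_1\ge 2F_j(\tau,V_{-m},\dots,V_m)+\alpha_0V_0$. Hull function. Given an admissible family $(F_j)_j$, $p>0$ and $\lambda\in\mathbb R$, a family $((h_j)_{j\in\mathbb Z},(g_j)_{j\in\mathbb Z})$ of locally bounded (possibly discontinuous) functions of $(\tau,z)\in\mathbb R^2$ is a hull function if for all $(\tau,z)\in\mathbb R^2$, $j\in\mathbb Z$, $$(h_j)_\tau+\lambda(h_j)_z=\alpha_0(g_j-h_j),\qquad (g_j)_\tau+\lambda(g_j)_z=2F_j(\tau,[h(\tau,\cdot)]_{j,m}(z))+\alpha_0(h_j-g_j)$$ in the viscosity sense, and for $f=h$ and for $f=g$: $f_j(\tau+1,z)=f_j(\tau,z)$; $f_j(\tau,z+1)=f_j(\tau,z)+1$; $f_{j+n}(\tau,z)=f_j(\tau,z+p)$; $f_{j+1}(\tau,z)\ge f_j(\tau,z)$; $f_j$ is non-decreasing in $z$; and for each $j$ there is a constant $C$ with $|f_j(\tau,z)-z|\le C$ for all $(\tau,z)$. If the $F_j$ do not depend on $\tau$, it is also required that $h_j,g_j$ do not depend on $\tau$. For every admissible family and every $p>0$ there is exactly one $\lambda$ for which a hull function exists; the family $(L+F_j)_j$ is again admissible. The equations in the viscosity sense mean that $u_j(\tau,y)=h_j(\tau,\lambda\tau+py)$,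 $\xi_j(\tau,y)=g_j(\tau,\lambda\tau+py)$ form a viscosity solution on $\mathbb R^2$ of $(u_j)_\tau=\alpha_0(\xi_j-u_j)$, $(\xi_j)_\tau=2F_j(\tau,[u(\tau,\cdot)]_{j,m}(y))+\alpha_0(u_j-\xi_j)$, $u_{j+n}(\tau,y)=u_j(\tau,y+1)$, $\xi_{j+n}(\tau,y)=\xi_j(\tau,y+1)$. Here a sub-solution (resp. super-solution) is a family of locally bounded upper (resp. lower) semi-continuous functions satisfying the last two relations and such that, for each $C^1$ test function $\phi$: if $u_j-\phi$ has a local maximum (resp. minimum) at $(\tau,y)$ then $\phi_\tau\le$ (resp. $\ge$) $\alpha_0(\xi_j-u_j)$ at that point; if $\xi_j-\phi$ has a local maximum (resp. minimum) at $(\tau,y)$ then $\phi_\tau\le$ (resp. $\ge$) $2F_j(\tau,[u(\tau,\cdot)]_{j,m}(y))+\alpha_0(u_j-\xi_j)$ at that point. A viscosity solution is a family whose upper semi-continuous envelopes form a sub-solution and whose lower semi-continuous envelopes form a super-solution. *)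

theory Defs
  imports "HOL-Analysis.Analysis"
begin

text \<open>
  A function of \<open>V = (V\<^sub>-\<^sub>m, \<dots>, V\<^sub>m)\<close> is encoded as a function of \<open>V :: int \<Rightarrow> real\<close>
  that depends only on the coordinates with index in \<open>{-m..m}\<close>.
\<close>

definition depends_on_window :: "nat \<Rightarrow> ((int \<Rightarrow> real) \<Rightarrow> real) \<Rightarrow> bool" where
  "depends_on_window m G \<longleftrightarrow>
     (\<forall>V W. (\<forall>i\<in>{- int m..int m}. V i = W i) \<longrightarrow> G V = G W)"

text \<open>
  Continuity refers to the product topology on \<open>int \<Rightarrow> real\<close>; for a function that depends only on
  the window this is continuity on the finite-dimensional space of windows.  The Lipschitz
  condition uses the Euclidean norm of the window.  In the last condition, only the coordinates
  \<open>-m, \<dots>, m + 1\<close> of \<open>V\<close> matter.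
\<close>

definition admissible ::
  "nat \<Rightarrow> nat \<Rightarrow> real \<Rightarrow> (int \<Rightarrow> real \<Rightarrow> (int \<Rightarrow> real) \<Rightarrow> real) \<Rightarrow> bool" where
  "admissible n m \<alpha>\<^sub>0 F \<longleftrightarrow>
     (\<forall>j \<tau>. depends_on_window m (F j \<tau>)) \<and>
     (\<forall>j. continuous_on UNIV (\<lambda>(\<tau>, V). F j \<tau> V)) \<and>
     (\<exists>K. \<forall>j \<tau> V W.
        \<bar>F j \<tau> V - F j \<tau> W\<bar> \<le> K * L2_set (\<lambda>i. V i - W i) {- int m..int m}) \<and>
     (\<forall>j \<tau> V. \<forall>i\<in>{- int m..int m}. i \<noteq> 0 \<longrightarrow> mono (\<lambda>x. F j \<tau> (V(i := x)))) \<and>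
     (\<forall>j \<tau> V. mono (\<lambda>x. 2 * F j \<tau> (V(0 := x)) + \<alpha>\<^sub>0 * x)) \<and>
     (\<forall>j \<tau> V. F j \<tau> (\<lambda>i. V i + 1) = F j \<tau> V) \<and>
     (\<forall>j \<tau> V. F j (\<tau> + 1) V = F j \<tau> V) \<and>
     (\<forall>j. F (j + int n) = F j) \<and>
     (\<forall>j \<tau> V. (\<forall>i\<in>{- int m..int m}. V (i + 1) \<ge> V i) \<longrightarrow>
        2 * F (j + 1) \<tau> (\<lambda>i. V (i + 1)) + \<alpha>\<^sub>0 * V 1 \<ge> 2 * F j \<tau> V + \<alpha>\<^sub>0 * V 0)"

text \<open>\<open>window v j x\<close> is \<open>[v]\<^sub>j\<^sub>,\<^sub>m\<close> at \<open>x\<close>, for every \<open>m\<close> (see \<open>depends_on_window\<close>).\<close>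

definition window :: "(int \<Rightarrow> 'a \<Rightarrow> real) \<Rightarrow> int \<Rightarrow> 'a \<Rightarrow> int \<Rightarrow> real" where
  "window v j x = (\<lambda>i. v (j + i) x)"

definition locally_bounded :: "('a::topological_space \<Rightarrow> real) \<Rightarrow> bool" where
  "locally_bounded f \<longleftrightarrow> (\<forall>x. \<exists>U. open U \<and> x \<in> U \<and> bounded (f ` U))"

definition upper_semicontinuous :: "('a::topological_space \<Rightarrow> real) \<Rightarrow> bool" where
  "upper_semicontinuous f \<longleftrightarrow> (\<forall>x. \<forall>c > f x. \<forall>\<^sub>F y in nhds x. f y < c)"

definition lower_semicontinuous :: "('a::topological_space \<Rightarrow> real) \<Rightarrow> bool" where
  "lower_semicontinuous f \<longleftrightarrow> (\<forall>x. \<forall>c < f x. \<forall>\<^sub>F y in nhds x. c < f y)"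

text \<open>
  The semicontinuous envelopes are used for locally bounded functions only, for which the limits
  below are finite.  The filter \<open>nhds x\<close> does not exclude the point \<open>x\<close> itself.
\<close>

definition usc_envelope :: "('a::topological_space \<Rightarrow> real) \<Rightarrow> 'a \<Rightarrow> real" where
  "usc_envelope f x = real_of_ereal (Limsup (nhds x) (\<lambda>y. ereal (f y)))"

definition lsc_envelope :: "('a::topological_space \<Rightarrow> real) \<Rightarrow> 'a \<Rightarrow> real" where
  "lsc_envelope f x = real_of_ereal (Liminf (nhds x) (\<lambda>y. ereal (f y)))"

definition local_max_at :: "('a::topological_space \<Rightarrow> real) \<Rightarrow> 'a \<Rightarrow> bool" where
  "local_max_at f x \<longleftrightarrow> (\<forall>\<^sub>F y in nhds x. f y \<le> f x)"

definition local_min_at :: "('a::topological_space \<Rightarrow> real) \<Rightarrow> 'a \<Rightarrow> bool" where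
  "local_min_at f x \<longleftrightarrow> (\<forall>\<^sub>F y in nhds x. f x \<le> f y)"

text \<open>\<open>\<phi>\<close> is continuously differentiable on the plane with derivative \<open>D\<close>; its partial derivative
  in the first variable \<open>\<tau>\<close> at \<open>x\<close> is \<open>D x (1, 0)\<close>.\<close>

definition C1_with_derivative ::
  "(real \<times> real \<Rightarrow> real) \<Rightarrow> (real \<times> real \<Rightarrow> (real \<times> real) \<Rightarrow>\<^sub>L real) \<Rightarrow> bool" where
  "C1_with_derivative \<phi> D \<longleftrightarrow>
     (\<forall>x. (\<phi> has_derivative blinfun_apply (D x)) (at x)) \<and> continuous_on UNIV D"

text \<open>Points of the plane are pairs \<open>(\<tau>, y)\<close>.\<close>

definition viscosity_subsolution ::
  "nat \<Rightarrow> real \<Rightarrow> (int \<Rightarrow> real \<Rightarrow> (int \<Rightarrow> real) \<Rightarrow> real) \<Rightarrow>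
   (int \<Rightarrow> real \<times> real \<Rightarrow> real) \<Rightarrow> (int \<Rightarrow> real \<times> real \<Rightarrow> real) \<Rightarrow> bool" where
  "viscosity_subsolution n \<alpha>\<^sub>0 F u \<xi> \<longleftrightarrow>
     (\<forall>j. locally_bounded (u j) \<and> upper_semicontinuous (u j)) \<and>
     (\<forall>j. locally_bounded (\<xi> j) \<and> upper_semicontinuous (\<xi> j)) \<and>
     (\<forall>j \<tau> y. u (j + int n) (\<tau>, y) = u j (\<tau>, y + 1)) \<and>
     (\<forall>j \<tau> y. \<xi> (j + int n) (\<tau>, y) = \<xi> j (\<tau>, y + 1)) \<and>
     (\<forall>\<phi> D j \<tau> y. C1_with_derivative \<phi> D \<longrightarrow> local_max_at (\<lambda>x. u j x - \<phi> x) (\<tau>, y) \<longrightarrow>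
        blinfun_apply (D (\<tau>, y)) (1, 0) \<le> \<alpha>\<^sub>0 * (\<xi> j (\<tau>, y) - u j (\<tau>, y))) \<and>
     (\<forall>\<phi> D j \<tau> y. C1_with_derivative \<phi> D \<longrightarrow> local_max_at (\<lambda>x. \<xi> j x - \<phi> x) (\<tau>, y) \<longrightarrow>
        blinfun_apply (D (\<tau>, y)) (1, 0)
          \<le> 2 * F j \<tau> (window u j (\<tau>, y)) + \<alpha>\<^sub>0 * (u j (\<tau>, y) - \<xi> j (\<tau>, y)))"

definition viscosity_supersolution ::
  "nat \<Rightarrow> real \<Rightarrow> (int \<Rightarrow> real \<Rightarrow> (int \<Rightarrow> real) \<Rightarrow> real) \<Rightarrow>
   (int \<Rightarrow> real \<times> real \<Rightarrow> real) \<Rightarrow> (int \<Rightarrow> real \<times> real \<Rightarrow> real) \<Rightarrow> bool" where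
  "viscosity_supersolution n \<alpha>\<^sub>0 F u \<xi> \<longleftrightarrow>
     (\<forall>j. locally_bounded (u j) \<and> lower_semicontinuous (u j)) \<and>
     (\<forall>j. locally_bounded (\<xi> j) \<and> lower_semicontinuous (\<xi> j)) \<and>
     (\<forall>j \<tau> y. u (j + int n) (\<tau>, y) = u j (\<tau>, y + 1)) \<and>
     (\<forall>j \<tau> y. \<xi> (j + int n) (\<tau>, y) = \<xi> j (\<tau>, y + 1)) \<and>
     (\<forall>\<phi> D j \<tau> y. C1_with_derivative \<phi> D \<longrightarrow> local_min_at (\<lambda>x. u j x - \<phi> x) (\<tau>, y) \<longrightarrow>
        blinfun_apply (D (\<tau>, y)) (1, 0) \<ge> \<alpha>\<^sub>0 * (\<xi> j (\<tau>, y) - u j (\<tau>, y))) \<and>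
     (\<forall>\<phi> D j \<tau> y. C1_with_derivative \<phi> D \<longrightarrow> local_min_at (\<lambda>x. \<xi> j x - \<phi> x) (\<tau>, y) \<longrightarrow>
        blinfun_apply (D (\<tau>, y)) (1, 0)
          \<ge> 2 * F j \<tau> (window u j (\<tau>, y)) + \<alpha>\<^sub>0 * (u j (\<tau>, y) - \<xi> j (\<tau>, y)))"

definition viscosity_solution ::
  "nat \<Rightarrow> real \<Rightarrow> (int \<Rightarrow> real \<Rightarrow> (int \<Rightarrow> real) \<Rightarrow> real) \<Rightarrow>
   (int \<Rightarrow> real \<times> real \<Rightarrow> real) \<Rightarrow> (int \<Rightarrow> real \<times> real \<Rightarrow> real) \<Rightarrow> bool" where
  "viscosity_solution n \<alpha>\<^sub>0 F u \<xi> \<longleftrightarrow>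
     (\<forall>j. locally_bounded (u j) \<and> locally_bounded (\<xi> j)) \<and>
     viscosity_subsolution n \<alpha>\<^sub>0 F (\<lambda>j. usc_envelope (u j)) (\<lambda>j. usc_envelope (\<xi> j)) \<and>
     viscosity_supersolution n \<alpha>\<^sub>0 F (\<lambda>j. lsc_envelope (u j)) (\<lambda>j. lsc_envelope (\<xi> j))"

definition hull_profile :: "nat \<Rightarrow> real \<Rightarrow> (int \<Rightarrow> real \<times> real \<Rightarrow> real) \<Rightarrow> bool" where
  "hull_profile n p f \<longleftrightarrow>
     (\<forall>j. locally_bounded (f j)) \<and>
     (\<forall>j \<tau> z. f j (\<tau> + 1, z) = f j (\<tau>, z)) \<and>
     (\<forall>j \<tau> z. f j (\<tau>, z + 1) = f j (\<tau>, z) + 1) \<and>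
     (\<forall>j \<tau> z. f (j + int n) (\<tau>, z) = f j (\<tau>, z + p)) \<and>
     (\<forall>j \<tau> z. f (j + 1) (\<tau>, z) \<ge> f j (\<tau>, z)) \<and>
     (\<forall>j \<tau>. mono (\<lambda>z. f j (\<tau>, z))) \<and>
     (\<forall>j. \<exists>C. \<forall>\<tau> z. \<bar>f j (\<tau>, z) - z\<bar> \<le> C)"

definition hull_function ::
  "nat \<Rightarrow> real \<Rightarrow> (int \<Rightarrow> real \<Rightarrow> (int \<Rightarrow> real) \<Rightarrow> real) \<Rightarrow> real \<Rightarrow> real \<Rightarrow>
   (int \<Rightarrow> real \<times> real \<Rightarrow> real) \<Rightarrow> (int \<Rightarrow> real \<times> real \<Rightarrow> real) \<Rightarrow> bool" where
  "hull_function n \<alpha>\<^sub>0 F p lam h g \<longleftrightarrow>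
     viscosity_solution n \<alpha>\<^sub>0 F
       (\<lambda>j. \<lambda>(\<tau>, y). h j (\<tau>, lam * \<tau> + p * y)) (\<lambda>j. \<lambda>(\<tau>, y). g j (\<tau>, lam * \<tau> + p * y)) \<and>
     hull_profile n p h \<and> hull_profile n p g \<and>
     ((\<forall>j \<tau> \<tau>'. F j \<tau> = F j \<tau>') \<longrightarrow>
        (\<forall>j \<tau> \<tau>' z. h j (\<tau>, z) = h j (\<tau>', z) \<and> g j (\<tau>, z) = g j (\<tau>', z)))"

definition effective_hamiltonian ::
  "nat \<Rightarrow> real \<Rightarrow> (int \<Rightarrow> real \<Rightarrow> (int \<Rightarrow> real) \<Rightarrow> real) \<Rightarrow> real \<Rightarrow> real" where
  "effective_hamiltonian n \<alpha>\<^sub>0 F p = (THE lam. \<exists>h g. hull_function n \<alpha>\<^sub>0 F p lam h g)"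

definition Fbar ::
  "nat \<Rightarrow> real \<Rightarrow> (int \<Rightarrow> real \<Rightarrow> (int \<Rightarrow> real) \<Rightarrow> real) \<Rightarrow> real \<Rightarrow> real \<Rightarrow> real" where
  "Fbar n \<alpha>\<^sub>0 F L p = effective_hamiltonian n \<alpha>\<^sub>0 (\<lambda>j \<tau> V. L + F j \<tau> V) p"

end

theory Submission
  imports Defs "HOL-Probability.Distributions"
begin

text \<open>
  With \<open>G\<^sub>j(\<tau>, V) = V\<^sub>0 + 2 F\<^sub>j(\<tau>, V) / \<alpha>\<^sub>0\<close> and \<open>E\<close> the average along the characteristics
  \<open>(\<tau> - s, z - \<lambda> s)\<close> against the exponential law of rate \<open>\<alpha>\<^sub>0\<close>, the equations of a hull function
  become \<open>h = E g\<close> and \<open>g = E (G h)\<close>, so a hull function is a fixed point of the monotone operator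
  \<open>h \<mapsto> E (E (G h))\<close>.  Conditions (A2), (A3) make the operator monotone, (A4) makes it commute with
  integer shifts, and (A5), (A6) make it preserve the profile conditions.

  Sub-fixed-points at speed \<open>\<lambda>\<close> and super-fixed-points at speed \<open>\<lambda>'\<close> force \<open>\<lambda> \<le> \<lambda>'\<close> by a Gronwall
  argument.  The set of speeds with a sub-fixed-point is closed, even under variation of \<open>(L, p)\<close>: a
  Harnack inequality normalizes the sub-fixed-points, and their relaxed upper limit is again one.
  At each speed there is a sub- or a super-fixed-point, so the supremum of the speeds of the former
  has both, and monotone iteration between them gives a hull function.  Since viscosity sub- and
  supersolutions satisfy the integral inequalities along each vertical line, the speed is unique,
  and closedness is exactly the upper and, by the reflection \<open>z \<mapsto> -z\<close>, lower semicontinuity of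
  \<open>\<lambda>\<close> in \<open>(L, p)\<close>.
\<close>

subsection \<open>Exponential averages\<close>

text \<open>Profiles may jump in \<open>z\<close> and in time, so compactness cannot come from
  equicontinuity. Order replaces it: at a fixed time, monotonicity in \<open>z\<close> and the unit
  shift determine a profile up to an error that does not involve its bound \<open>C\<close>. Only
  the time profile at \<open>z = 0\<close> stays free, and relaxing a periodic function twice
  controls that one. The system is invariant under integer shifts only, so profiles are normalized
  by integers, which explains the stray constants 1 in the bounds.

  Sub- and super-fixed-points are preferred to fixed points in the limits because an upper limit
  passes through monotone averages only as an inequality.

  The equations contain no derivative in \<open>y\<close>. They are ordinary differential equations
  on the lines of constant \<open>y\<close>, coupled through the index alone, and this is what makes
  integral inequalities on single lines an adequate substitute for viscosity inequalities. The
  delicate passage is from test functions on the plane to one such line: the right-hand side is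
  merely semicontinuous, so its relaxation is not an admissible test function and does not dominate
  nearby lines. A sup-convolution repairs both defects.\<close>

definition expo :: "real \<Rightarrow> real measure" where
  "expo \<alpha> = density lborel (\<lambda>s. ennreal (exponential_density \<alpha> s))"

lemma sets_expo [simp, measurable_cong]: "sets (expo \<alpha>) = sets borel"
  by (simp add: expo_def)

lemma space_expo [simp]: "space (expo \<alpha>) = UNIV"
  by (simp add: expo_def)

lemma prob_space_expo: "\<alpha> > 0 \<Longrightarrow> prob_space (expo \<alpha>)"
  unfolding expo_def by (rule prob_space_exponential_density)

lemma AE_expo_nonneg: "AE s in expo \<alpha>. s \<ge> 0"
  unfolding expo_def by (subst AE_density) (auto simp: exponential_density_def)

lemma distributed_expo: "\<alpha> > 0 \<Longrightarrow> distributed (expo \<alpha>) lborel (\<lambda>x. x) (exponential_density \<alpha>)"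
  unfolding distributed_def expo_def by (auto intro: distr_id2)

lemma integrable_expo_id: "\<alpha> > 0 \<Longrightarrow> integrable (expo \<alpha>) (\<lambda>s. s)"
  using prob_space.erlang_ith_moment_integrable[OF prob_space_expo _ distributed_expo, of \<alpha> 1] by simp

lemma integral_expo_id: "\<alpha> > 0 \<Longrightarrow> (\<integral>s. s \<partial>expo \<alpha>) = 1 / \<alpha>"
  using prob_space.exponential_distributed_expectation[OF prob_space_expo _ distributed_expo] by simp

lemma integrable_expo_const [simp]: "\<alpha> > 0 \<Longrightarrow> integrable (expo \<alpha>) (\<lambda>s. c :: real)"
  using prob_space_expo[of \<alpha>] by (simp add: prob_space_def finite_measure.integrable_const)

lemma measure_expo_UNIV [simp]: "\<alpha> > 0 \<Longrightarrow> measure (expo \<alpha>) UNIV = 1"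
  using prob_space.prob_space[OF prob_space_expo[of \<alpha>]] by simp

lemma integral_expo_const [simp]: "\<alpha> > 0 \<Longrightarrow> (\<integral>s. c \<partial>expo \<alpha>) = (c :: real)"
  using prob_space.prob_space[OF prob_space_expo[of \<alpha>]] by simp

lemma integrable_expo_affine: "\<alpha> > 0 \<Longrightarrow> integrable (expo \<alpha>) (\<lambda>s. a + b * s)"
  by (intro Bochner_Integration.integrable_add integrable_expo_const integrable_mult_right integrable_expo_id)

lemma integral_expo_affine: "\<alpha> > 0 \<Longrightarrow> (\<integral>s. a + b * s \<partial>expo \<alpha>) = a + b / \<alpha>"
  by (subst Bochner_Integration.integral_add) (auto simp: integral_expo_id integrable_expo_id)

lemma integrable_expo:
  fixes f :: "real \<Rightarrow> real"
  assumes "\<alpha> > 0" and [measurable]: "f \<in> borel_measurable borel" 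
    and "\<And>s. s \<ge> 0 \<Longrightarrow> \<bar>f s\<bar> \<le> a + b * s"
  shows "integrable (expo \<alpha>) f"
proof (rule Bochner_Integration.integrable_bound[OF integrable_expo_affine[OF assms(1), of a b]])
  show "AE s in expo \<alpha>. norm (f s) \<le> norm (a + b * s)"
    using AE_expo_nonneg by eventually_elim (use assms(3) in fastforce)
qed measurable

lemma integral_expo_mono:
  fixes f g :: "real \<Rightarrow> real"
  assumes "integrable (expo \<alpha>) f" "integrable (expo \<alpha>) g" "\<And>s. s \<ge> 0 \<Longrightarrow> f s \<le> g s"
  shows "(\<integral>s. f s \<partial>expo \<alpha>) \<le> (\<integral>s. g s \<partial>expo \<alpha>)"
  using assms(1,2)
proof (rule integral_mono_AE)
  show "AE s in expo \<alpha>. f s \<le> g s"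
    using AE_expo_nonneg by eventually_elim (use assms(3) in auto)
qed

lemma integral_expo_eq_lborel:
  fixes f :: "real \<Rightarrow> real"
  assumes "\<alpha> > 0" and [measurable]: "f \<in> borel_measurable borel"
  shows "(\<integral>s. f s \<partial>expo \<alpha>) = (\<integral>s. exponential_density \<alpha> s * f s \<partial>lborel)"
  unfolding expo_def using assms
  by (subst integral_density) (auto simp: exponential_density_nonneg)

text \<open>The density of rate \<open>\<alpha>\<close> tilted by \<open>exp (- c * s)\<close> is
  \<open>\<alpha> / (\<alpha> + c)\<close> times the density of rate \<open>\<alpha> + c\<close>,
  which has mass one. This factor is the contraction behind \<open>speed_comparison\<close>.\<close>

lemma integral_expo_exp:
  assumes "\<alpha> > 0" "c \<ge> 0"
  shows "(\<integral>s. exp (- c * s) \<partial>expo \<alpha>) = \<alpha> / (\<alpha> + c)"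
proof -
  have "(\<integral>s. exp (- c * s) \<partial>expo \<alpha>) = (\<integral>s. exponential_density \<alpha> s * exp (- c * s) \<partial>lborel)"
    by (rule integral_expo_eq_lborel) (use assms in auto)
  also have "\<dots> = (\<integral>s. exponential_density (\<alpha> + c) s * (\<alpha> / (\<alpha> + c)) \<partial>lborel)"
    by (intro Bochner_Integration.integral_cong refl)
       (use assms in \<open>auto simp: exponential_density_def field_simps mult_exp_exp\<close>)
  also have "\<dots> = (\<integral>s. \<alpha> / (\<alpha> + c) \<partial>expo (\<alpha> + c))"
    by (rule integral_expo_eq_lborel[symmetric]) (use assms in auto)
  finally show ?thesis using assms by simp
qed

text \<open>The solution of \<open>u' = \<alpha> (f - u)\<close> on the real line that has linear growth at \<open>-\<infinity>\<close>.\<close>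

definition relax :: "real \<Rightarrow> (real \<Rightarrow> real) \<Rightarrow> real \<Rightarrow> real" where
  "relax \<alpha> f \<tau> = (\<integral>s. f (\<tau> - s) \<partial>expo \<alpha>)"

text \<open>Profiles stay at bounded distance from \<open>z\<close>, so they grow linearly along
  characteristics. The exponential law has a finite first moment, and the class is closed under
  \<open>relax\<close>.\<close>

definition linear_growth :: "(real \<Rightarrow> real) \<Rightarrow> bool" where
  "linear_growth f \<longleftrightarrow> f \<in> borel_measurable borel \<and> (\<exists>a b. \<forall>t. \<bar>f t\<bar> \<le> a + b * \<bar>t\<bar>)"

lemma linear_growthI:
  "f \<in> borel_measurable borel \<Longrightarrow> (\<And>t. \<bar>f t\<bar> \<le> a + b * \<bar>t\<bar>) \<Longrightarrow> linear_growth f"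
  unfolding linear_growth_def by blast

lemma linear_growthE:
  assumes "linear_growth f"
  obtains a b where "a \<ge> 0" "b \<ge> 0" "\<And>t. \<bar>f t\<bar> \<le> a + b * \<bar>t\<bar>"
proof -
  from assms obtain a b where ab: "\<And>t. \<bar>f t\<bar> \<le> a + b * \<bar>t\<bar>"
    by (auto simp: linear_growth_def)
  have "\<bar>f t\<bar> \<le> \<bar>a\<bar> + \<bar>b\<bar> * \<bar>t\<bar>" for t
  proof -
    have "b * \<bar>t\<bar> \<le> \<bar>b\<bar> * \<bar>t\<bar>" by (intro mult_right_mono) auto
    then show ?thesis using ab[of t] by linarith
  qed
  then show ?thesis using that[of "\<bar>a\<bar>" "\<bar>b\<bar>"] by simp
qed

lemma linear_growth_measurable [measurable_dest]: "linear_growth f \<Longrightarrow> f \<in> borel_measurable borel"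
  by (simp add: linear_growth_def)

lemma linear_growth_integrable:
  assumes "\<alpha> > 0" "linear_growth f"
  shows "integrable (expo \<alpha>) (\<lambda>s. f (\<tau> - s))"
proof -
  from linear_growthE[OF assms(2)] obtain a b where ab: "a \<ge> 0" "b \<ge> 0" "\<And>t. \<bar>f t\<bar> \<le> a + b * \<bar>t\<bar>"
    by metis
  have [measurable]: "f \<in> borel_measurable borel" using assms(2) by (rule linear_growth_measurable)
  show ?thesis
  proof (rule integrable_expo[OF assms(1), where a="a + b * \<bar>\<tau>\<bar>" and b=b])
    fix s :: real assume "s \<ge> 0"
    then have "b * \<bar>\<tau> - s\<bar> \<le> b * (\<bar>\<tau>\<bar> + s)" using ab(2) by (intro mult_left_mono) auto
    then show "\<bar>f (\<tau> - s)\<bar> \<le> a + b * \<bar>\<tau>\<bar> + b * s"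
      using ab(3)[of "\<tau> - s"] by (simp add: algebra_simps)
  qed measurable
qed

lemma relax_mono:
  assumes "\<alpha> > 0" "linear_growth f" "linear_growth g" "\<And>t. t \<le> \<tau> \<Longrightarrow> f t \<le> g t"
  shows "relax \<alpha> f \<tau> \<le> relax \<alpha> g \<tau>"
  unfolding relax_def
  by (intro integral_expo_mono linear_growth_integrable) (use assms in auto)

lemma relax_measurable:
  assumes "\<alpha> > 0" "linear_growth f"
  shows "relax \<alpha> f \<in> borel_measurable borel"
proof -
  interpret prob_space "expo \<alpha>" by (rule prob_space_expo) fact
  have [measurable]: "f \<in> borel_measurable borel" using assms(2) by (rule linear_growth_measurable)
  show ?thesis unfolding relax_def by measurable
qed

lemma linear_growth_relax:
  assumes "\<alpha> > 0" "linear_growth f"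
  shows "linear_growth (relax \<alpha> f)"
proof -
  from linear_growthE[OF assms(2)] obtain a b where ab: "a \<ge> 0" "b \<ge> 0" "\<And>t. \<bar>f t\<bar> \<le> a + b * \<bar>t\<bar>"
    by metis
  show ?thesis
  proof (rule linear_growthI[OF relax_measurable[OF assms], where a="a + b / \<alpha>" and b=b])
    fix t
    have "\<bar>relax \<alpha> f t\<bar> \<le> (\<integral>s. \<bar>f (t - s)\<bar> \<partial>expo \<alpha>)"
      unfolding relax_def using integral_norm_bound[of "expo \<alpha>" "\<lambda>s. f (t - s)"] by simp
    also have "\<dots> \<le> (\<integral>s. (a + b * \<bar>t\<bar>) + b * s \<partial>expo \<alpha>)"
    proof (intro integral_expo_mono integrable_expo_affine integrable_abs linear_growth_integrable assms)
      fix s :: real assume "s \<ge> 0"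
      then have "b * \<bar>t - s\<bar> \<le> b * (\<bar>t\<bar> + s)" using ab(2) by (intro mult_left_mono) auto
      then show "\<bar>f (t - s)\<bar> \<le> (a + b * \<bar>t\<bar>) + b * s"
        using ab(3)[of "t - s"] by (simp add: algebra_simps)
    qed
    also have "\<dots> = (a + b / \<alpha>) + b * \<bar>t\<bar>"
      using integral_expo_affine[OF assms(1)] by simp
    finally show "\<bar>relax \<alpha> f t\<bar> \<le> (a + b / \<alpha>) + b * \<bar>t\<bar>" .
  qed
qed

lemma relax_affine: "\<alpha> > 0 \<Longrightarrow> relax \<alpha> (\<lambda>t. a + b * t) \<tau> = a + b * \<tau> - b / \<alpha>"
  unfolding relax_def using integral_expo_affine[of \<alpha> "a + b * \<tau>" "- b"]
  by (simp add: algebra_simps)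

lemma relax_cmult: "relax \<alpha> (\<lambda>t. c * f t) \<tau> = c * relax \<alpha> f \<tau>"
  unfolding relax_def by simp

lemma relax_add:
  "\<alpha> > 0 \<Longrightarrow> linear_growth f \<Longrightarrow> linear_growth g \<Longrightarrow>
    relax \<alpha> (\<lambda>t. f t + g t) \<tau> = relax \<alpha> f \<tau> + relax \<alpha> g \<tau>"
  unfolding relax_def by (intro Bochner_Integration.integral_add linear_growth_integrable)

lemma linear_growth_affine: "linear_growth (\<lambda>t. a + b * t)"
proof (rule linear_growthI)
  show "\<bar>a + b * t\<bar> \<le> \<bar>a\<bar> + \<bar>b\<bar> * \<bar>t\<bar>" for t
    using abs_triangle_ineq[of a "b * t"] by (simp add: abs_mult)
qed measurable

lemma linear_growth_add:
  assumes "linear_growth f" "linear_growth g"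
  shows "linear_growth (\<lambda>t. f t + g t)"
proof -
  from linear_growthE[OF assms(1)] obtain a b where ab: "\<And>t. \<bar>f t\<bar> \<le> a + b * \<bar>t\<bar>" by metis
  from linear_growthE[OF assms(2)] obtain c d where cd: "\<And>t. \<bar>g t\<bar> \<le> c + d * \<bar>t\<bar>" by metis
  have [measurable]: "f \<in> borel_measurable borel" "g \<in> borel_measurable borel"
    using assms by (auto intro: linear_growth_measurable)
  show ?thesis
  proof (rule linear_growthI)
    show "\<bar>f t + g t\<bar> \<le> (a + c) + (b + d) * \<bar>t\<bar>" for t
      using ab[of t] cd[of t] by (simp add: algebra_simps)
  qed measurable
qed

lemma linear_growth_cmult:
  assumes "linear_growth f"
  shows "linear_growth (\<lambda>t. c * f t)"
proof -
  from linear_growthE[OF assms(1)] obtain a b where ab: "\<And>t. \<bar>f t\<bar> \<le> a + b * \<bar>t\<bar>" by metis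
  have [measurable]: "f \<in> borel_measurable borel" 
    using assms by (auto intro: linear_growth_measurable)
  show ?thesis
  proof (rule linear_growthI)
    show "\<bar>c * f t\<bar> \<le> (\<bar>c\<bar> * a) + (\<bar>c\<bar> * b) * \<bar>t\<bar>" for t
      using mult_left_mono[OF ab[of t], of "\<bar>c\<bar>"] by (simp add: algebra_simps abs_mult)
  qed measurable
qed

text \<open>The substitution \<open>r = \<tau> - s\<close> moves \<open>\<tau>\<close> from the
  integrand to the domain of integration. This is the variation of constants formula, from which the
  comparisons of different times follow.\<close>

lemma relax_eq_lborel:
  assumes "\<alpha> > 0" "linear_growth f"
  shows "relax \<alpha> f \<tau> = exp (- \<alpha> * \<tau>) * (LBINT r. indicator {..\<tau>} r * (\<alpha> * exp (\<alpha> * r) * f r))" (is ?A)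
    and "integrable lborel (\<lambda>r. indicator {..\<tau>} r * (\<alpha> * exp (\<alpha> * r) * f r))" (is ?B)
proof -
  have [measurable]: "f \<in> borel_measurable borel" using assms(2) by (rule linear_growth_measurable)
  let ?h = "\<lambda>s. exponential_density \<alpha> s * f (\<tau> - s)"
  have eq: "?h (\<tau> + (-1) * r) = exp (- \<alpha> * \<tau>) * (indicator {..\<tau>} r * (\<alpha> * exp (\<alpha> * r) * f r))" for r
    by (auto simp: exponential_density_def indicator_def algebra_simps mult_exp_exp simp flip: exp_add)
  have int: "integrable lborel ?h"
    using linear_growth_integrable[OF assms, of \<tau>] unfolding expo_def
    by (subst (asm) integrable_density) (use assms in \<open>auto simp: exponential_density_nonneg\<close>)
  have "relax \<alpha> f \<tau> = (LBINT s. ?h s)"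
    unfolding relax_def by (rule integral_expo_eq_lborel) (use assms in auto)
  also have "\<dots> = (LBINT r. ?h (\<tau> + (-1) * r))"
    using lborel_integral_real_affine[of "-1" ?h \<tau>] by simp
  finally show ?A unfolding eq by simp
  have "integrable lborel (\<lambda>r. ?h (\<tau> + (-1) * r))"
    using lborel_integrable_real_affine[OF int, of "-1" \<tau>] by simp
  then show ?B unfolding eq by simp
qed

text \<open>For nonnegative \<open>f\<close> the integral over the past grows with the end time, so
  only the exponential prefactor is lost. For periodic functions this becomes a Harnack
  inequality.\<close>

lemma relax_earlier_le:
  assumes "\<alpha> > 0" "linear_growth f" "\<And>t. f t \<ge> 0" "\<sigma> \<le> \<tau>"
  shows "relax \<alpha> f \<sigma> \<le> exp (\<alpha> * (\<tau> - \<sigma>)) * relax \<alpha> f \<tau>"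
proof -
  have "(LBINT r. indicator {..\<sigma>} r * (\<alpha> * exp (\<alpha> * r) * f r))
      \<le> (LBINT r. indicator {..\<tau>} r * (\<alpha> * exp (\<alpha> * r) * f r))"
    by (intro integral_mono relax_eq_lborel(2) assms) (use assms in \<open>auto simp: indicator_def\<close>)
  then have "relax \<alpha> f \<sigma> \<le> exp (- \<alpha> * \<sigma>) * (LBINT r. indicator {..\<tau>} r * (\<alpha> * exp (\<alpha> * r) * f r))"
    unfolding relax_eq_lborel(1)[OF assms(1,2)] by (intro mult_left_mono) auto
  also have "\<dots> = exp (\<alpha> * (\<tau> - \<sigma>)) * relax \<alpha> f \<tau>"
    unfolding relax_eq_lborel(1)[OF assms(1,2)] by (simp add: algebra_simps mult_exp_exp)
  finally show ?thesis .
qed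

lemma relax_nonneg: "(\<And>t. f t \<ge> 0) \<Longrightarrow> relax \<alpha> f \<tau> \<ge> 0"
  unfolding relax_def by (simp add: integral_nonneg)

text \<open>Up to the factor \<open>exp (- \<alpha> * \<tau>)\<close>, \<open>relax\<close> is the primitive of \<open>w\<close> below.\<close>

lemma relax_increment:
  assumes "\<alpha> > 0" "linear_growth f" "\<sigma> \<le> \<tau>"
  defines "w \<equiv> \<lambda>r. \<alpha> * exp (\<alpha> * r) * f r"
  shows "exp (\<alpha> * \<tau>) * relax \<alpha> f \<tau> - exp (\<alpha> * \<sigma>) * relax \<alpha> f \<sigma> = (LBINT r:{\<sigma>..\<tau>}. w r)"
proof -
  have [measurable]: "f \<in> borel_measurable borel" using assms(2) by (rule linear_growth_measurable)
  have "exp (\<alpha> * \<tau>) * relax \<alpha> f \<tau> - exp (\<alpha> * \<sigma>) * relax \<alpha> f \<sigma>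
    = (LBINT r. indicator {..\<tau>} r * w r) - (LBINT r. indicator {..\<sigma>} r * w r)"
    unfolding relax_eq_lborel(1)[OF assms(1,2)] w_def by (simp add: mult_exp_exp flip: mult.assoc)
  also have "\<dots> = (LBINT r. indicator {..\<tau>} r * w r - indicator {..\<sigma>} r * w r)"
    unfolding w_def by (intro Bochner_Integration.integral_diff[symmetric] relax_eq_lborel(2) assms)
  also have "\<dots> = (LBINT r. indicator {\<sigma>..\<tau>} r * w r)"
  proof (rule integral_cong_AE)
    have "AE r in lborel. r \<noteq> \<sigma>" by (rule AE_lborel_singleton)
    then show "AE r in lborel. indicator {..\<tau>} r * w r - indicator {..\<sigma>} r * w r = indicator {\<sigma>..\<tau>} r * w r"
      by eventually_elim (use assms(3) in \<open>auto simp: indicator_def\<close>)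
  qed (auto simp: w_def)
  finally show ?thesis by (simp add: set_lebesgue_integral_def)
qed

text \<open>Here \<open>f\<close> may jump: increments of
  \<open>exp (\<alpha> * t) * relax \<alpha> f t\<close> are integrals of a locally bounded
  function, so it is Lipschitz near \<open>\<tau>\<close>. Fixed profiles owe their continuity along
  characteristics to this.\<close>

lemma relax_continuous:
  assumes "\<alpha> > 0" "linear_growth f"
  shows "isCont (relax \<alpha> f) \<tau>"
proof -
  define w where "w = (\<lambda>r. \<alpha> * exp (\<alpha> * r) * f r)"
  have [measurable]: "f \<in> borel_measurable borel" using assms(2) by (rule linear_growth_measurable)
  from linear_growthE[OF assms(2)] obtain a b where ab: "a \<ge> 0" "b \<ge> 0" "\<And>t. \<bar>f t\<bar> \<le> a + b * \<bar>t\<bar>"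
    by metis
  define B where "B = \<alpha> * exp (\<alpha> * (\<tau> + 1)) * (a + b * (\<bar>\<tau>\<bar> + 1))"
  have wB: "\<bar>w r\<bar> \<le> B" if "r \<in> {\<tau> - 1..\<tau> + 1}" for r
  proof -
    have "b * \<bar>r\<bar> \<le> b * (\<bar>\<tau>\<bar> + 1)" using that ab(2) by (intro mult_left_mono) auto
    then have f: "\<bar>f r\<bar> \<le> a + b * (\<bar>\<tau>\<bar> + 1)" using ab(3)[of r] by linarith
    have "\<alpha> * exp (\<alpha> * r) \<le> \<alpha> * exp (\<alpha> * (\<tau> + 1))" using that assms(1) by simp
    then show ?thesis unfolding w_def B_def abs_mult using f assms(1) 
      by (intro mult_mono) auto
  qed
  define \<Phi> where "\<Phi> t = exp (\<alpha> * t) * relax \<alpha> f t" for t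
  have lip: "\<bar>\<Phi> y - \<Phi> x\<bar> \<le> B * (y - x)" if "x \<in> {\<tau> - 1..\<tau> + 1}" "y \<in> {\<tau> - 1..\<tau> + 1}" "x \<le> y" for x y
  proof -
    have "norm (LBINT r:{x..y}. w r) \<le> B * measure lborel {x..y}"
      unfolding set_lebesgue_integral_def
    proof -
      have i: "integrable lborel (\<lambda>r. B * indicator {x..y} r)"
        by (intro integrable_mult_right integrable_real_indicator) (auto simp: emeasure_lborel_Icc_eq)
      have "norm (LBINT r. indicator {x..y} r *\<^sub>R w r) \<le> (LBINT r. B * indicator {x..y} r)"
      proof (rule Bochner_Integration.integral_norm_bound_integral[OF _ i])
        have bd: "norm (indicator {x..y} r *\<^sub>R w r) \<le> B * indicator {x..y} r" for r
          using wB[of r] that by (auto simp: indicator_def)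
        then show "norm (indicator {x..y} r *\<^sub>R w r) \<le> B * indicator {x..y} r" for r .
        show "integrable lborel (\<lambda>r. indicator {x..y} r *\<^sub>R w r)"
        proof (rule Bochner_Integration.integrable_bound[OF i])
          show "AE r in lborel. norm (indicator {x..y} r *\<^sub>R w r) \<le> norm (B * indicator {x..y} r)"
            using bd by (intro AE_I2) (metis abs_le_D1 abs_ge_self order_trans real_norm_def)
        qed (auto simp: w_def)
      qed
      then show "norm (LBINT r. indicator {x..y} r *\<^sub>R w r) \<le> B * measure lborel {x..y}"
        by simp
    qed
    then show ?thesis
      using relax_increment[OF assms that(3)] that(3) unfolding \<Phi>_def w_def by simp
  qed
  have "isCont \<Phi> \<tau>"
  proof (rule continuous_on_interior)
    have "B-lipschitz_on {\<tau> - 1..\<tau> + 1} \<Phi>"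
    proof (rule lipschitz_onI)
      show "0 \<le> B" unfolding B_def using assms(1) ab by (intro mult_nonneg_nonneg) auto
      fix x y assume xy: "x \<in> {\<tau> - 1..\<tau> + 1}" "y \<in> {\<tau> - 1..\<tau> + 1}"
      show "dist (\<Phi> x) (\<Phi> y) \<le> B * dist x y"
        using lip[of x y] lip[of y x] xy by (cases "x \<le> y") (auto simp: dist_real_def abs_minus_commute)
    qed
    then show "continuous_on {\<tau> - 1..\<tau> + 1} \<Phi>" by (rule lipschitz_on_continuous_on)
  qed auto
  then have "isCont (\<lambda>t. exp (- \<alpha> * t) * \<Phi> t) \<tau>" by (intro continuous_intros)
  then show ?thesis unfolding \<Phi>_def by (simp add: mult_exp_exp flip: mult.assoc)
qed

text \<open>The fundamental theorem of calculus for the primitive in \<open>relax_increment\<close>.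
  When it is applied to fixed profiles, \<open>relax_continuous\<close> provides the continuity of
  \<open>f\<close>.\<close>

lemma relax_has_derivative:
  assumes "\<alpha> > 0" "linear_growth f" "continuous_on UNIV f"
  shows "(relax \<alpha> f has_real_derivative \<alpha> * (f \<tau> - relax \<alpha> f \<tau>)) (at \<tau>)"
proof -
  define w where "w = (\<lambda>r. \<alpha> * exp (\<alpha> * r) * f r)"
  define \<Phi> where "\<Phi> t = exp (\<alpha> * t) * relax \<alpha> f t" for t
  have cw: "continuous_on A w" for A
    unfolding w_def using continuous_on_subset[OF assms(3)] by (intro continuous_intros) auto
  have eq: "\<Phi> t = \<Phi> (\<tau> - 1) + integral {\<tau> - 1..t} w" if "t \<in> {\<tau> - 1..\<tau> + 1}" for t
  proof -
    have "(LBINT r:{\<tau> - 1..t}. w r) = integral {\<tau> - 1..t} w"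
      by (intro set_borel_integral_eq_integral(2) borel_integrable_atLeastAtMost' cw)
    then show ?thesis
      using relax_increment[OF assms(1,2), of "\<tau> - 1" t] that unfolding \<Phi>_def w_def by simp
  qed
  have "((\<lambda>t. \<Phi> (\<tau> - 1) + integral {\<tau> - 1..t} w) has_real_derivative 0 + w \<tau>) (at \<tau> within {\<tau> - 1..\<tau> + 1})"
    by (intro DERIV_add DERIV_const integral_has_real_derivative cw) auto
  then have "((\<lambda>t. \<Phi> (\<tau> - 1) + integral {\<tau> - 1..t} w) has_real_derivative w \<tau>) (at \<tau>)"
    using at_within_Icc_at[of "\<tau> - 1" \<tau> "\<tau> + 1"] by simp
  then have "(\<Phi> has_real_derivative w \<tau>) (at \<tau>)"
  proof (rule has_field_derivative_transform_within_open)
    show "open {\<tau> - 1<..<\<tau> + 1}" "\<tau> \<in> {\<tau> - 1<..<\<tau> + 1}" by auto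
    show "\<Phi> (\<tau> - 1) + integral {\<tau> - 1..t} w = \<Phi> t" if "t \<in> {\<tau> - 1<..<\<tau> + 1}" for t
      by (rule eq[symmetric]) (use that in simp)
  qed
  then have "((\<lambda>t. exp (- \<alpha> * t) * \<Phi> t) has_real_derivative
      (- \<alpha> * exp (- \<alpha> * \<tau>)) * \<Phi> \<tau> + w \<tau> * exp (- \<alpha> * \<tau>)) (at \<tau>)"
    by (intro DERIV_mult) (auto intro!: derivative_eq_intros)
  moreover have "(- \<alpha> * exp (- \<alpha> * \<tau>)) * \<Phi> \<tau> + w \<tau> * exp (- \<alpha> * \<tau>) = \<alpha> * (f \<tau> - relax \<alpha> f \<tau>)"
    unfolding \<Phi>_def w_def by (simp add: algebra_simps exp_minus)
  moreover have "(\<lambda>t. exp (- \<alpha> * t) * \<Phi> t) = relax \<alpha> f"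
    unfolding \<Phi>_def by (simp add: fun_eq_iff mult_exp_exp flip: mult.assoc)
  ultimately show ?thesis by simp
qed

subsection \<open>Cooperative systems and profiles\<close>

text \<open>Exponentials are eigenfunctions of \<open>relax\<close>. Truncation at \<open>T\<close>
  keeps the function of linear growth and is invisible at times \<open>\<tau> \<le> T\<close>,
  because \<open>relax\<close> looks only backwards.\<close>

lemma relax_exp_le:
  assumes "\<alpha> > 0" "c \<ge> 0" "\<tau> \<le> T"
  shows "relax \<alpha> (\<lambda>t. exp (c * min t T)) \<tau> = \<alpha> / (\<alpha> + c) * exp (c * \<tau>)"
proof -
  have "relax \<alpha> (\<lambda>t. exp (c * min t T)) \<tau> = (\<integral>s. exp (c * \<tau>) * exp (- c * s) \<partial>expo \<alpha>)"
    unfolding relax_def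
  proof (rule integral_cong_AE)
    show "AE s in expo \<alpha>. exp (c * min (\<tau> - s) T) = exp (c * \<tau>) * exp (- c * s)"
      using AE_expo_nonneg
      by eventually_elim (use assms in \<open>auto simp: min_def algebra_simps mult_exp_exp\<close>)
  qed (auto intro: borel_measurable_continuous_onI continuous_intros)
  then show ?thesis using integral_expo_exp[OF assms(1,2)] by simp
qed

lemma linear_growth_exp_min: "c \<ge> 0 \<Longrightarrow> linear_growth (\<lambda>t. exp (c * min t T))"
  by (rule linear_growthI[where a="exp (c * T)" and b=0])
     (auto intro!: mult_left_mono)

text \<open>\<open>P\<close> is a set of time periods of the system.  With all periods in \<open>P\<close>, the profiles below are
  independent of time when the system is.\<close>

locale cooperative =
  fixes n m :: nat and \<alpha> K B :: real and P :: "real set"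
    and G :: "int \<Rightarrow> real \<Rightarrow> (int \<Rightarrow> real) \<Rightarrow> real"
  assumes n_pos: "n \<ge> 1" and \<alpha>_pos: "\<alpha> > 0" and period_1: "1 \<in> P"
    and K_nonneg: "K \<ge> 0" and B_nonneg: "B \<ge> 0"
    and G_mono: "(\<And>i. i \<in> {- int m..int m} \<Longrightarrow> V i \<le> W i) \<Longrightarrow> G j \<tau> V \<le> G j \<tau> W"
    and G_shift: "G j \<tau> (\<lambda>i. V i + of_int k) = G j \<tau> V + of_int k"
    and G_lipschitz: "w \<ge> 0 \<Longrightarrow> G j \<tau> (\<lambda>i. V i + w) \<le> G j \<tau> V + K * w"
    and G_continuous: "continuous_on UNIV (\<lambda>(\<tau>, V). G j \<tau> V)"
    and G_period: "s \<in> P \<Longrightarrow> G j (\<tau> + s) = G j \<tau>"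
    and G_index: "G (j + int n) = G j"
    and G_next: "(\<And>i. V i \<le> V (i + 1)) \<Longrightarrow> G j \<tau> V \<le> G (j + 1) \<tau> (\<lambda>i. V (i + 1))"
    and G_bound: "(\<And>i. i \<in> {- int m..int m} \<Longrightarrow> \<bar>V i - V 0\<bar> \<le> w) \<Longrightarrow> \<bar>G j \<tau> V - V 0\<bar> \<le> B + K * w"
begin

lemma G_le_add:
  assumes "w \<ge> 0" "\<And>i. i \<in> {- int m..int m} \<Longrightarrow> V i \<le> W i + w"
  shows "G j \<tau> V \<le> G j \<tau> W + K * w"
  using G_mono[of V "\<lambda>i. W i + w" j \<tau>, OF assms(2)] G_lipschitz[OF assms(1), of j \<tau> W]
  by linarith

text \<open>The index set is countable, so measurability into \<open>int \<Rightarrow> real\<close>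
  is checked coordinatewise and then composed with the continuous \<open>G\<close>.\<close>

lemma G_measurable:
  assumes "f \<in> borel_measurable M" "\<And>i. (\<lambda>x. v i x) \<in> borel_measurable M"
  shows "(\<lambda>x. G j (f x) (\<lambda>i. v i x)) \<in> borel_measurable M"
proof -
  have "(\<lambda>(\<tau>, V). G j \<tau> V) \<in> borel_measurable borel"
    by (rule borel_measurable_continuous_onI[OF G_continuous])
  moreover have "(\<lambda>x. (f x, \<lambda>i. v i x)) \<in> borel_measurable M"
    using assms(1) measurable_coordinatewise_then_product[OF assms(2)]
    by (rule borel_measurable_Pair)
  ultimately have "(\<lambda>(\<tau>, V). G j \<tau> V) \<circ> (\<lambda>x. (f x, \<lambda>i. v i x)) \<in> borel_measurable M"
    by (rule measurable_comp[rotated])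
  then show ?thesis by (simp add: comp_def)
qed

lemma linear_growth_G:
  fixes q :: real and V :: "int \<Rightarrow> real \<Rightarrow> real"
  assumes [measurable]: "\<And>j. V j \<in> borel_measurable borel"
    and bound: "\<And>j \<tau>. \<bar>V j \<tau> - lam * \<tau> - q * j\<bar> \<le> C"
  shows "linear_growth (\<lambda>t. G j t (\<lambda>i. V (j + i) t) + l)"
proof (rule linear_growthI[where a="\<bar>q * j\<bar> + C + B + K * (2 * C + \<bar>q\<bar> * m) + \<bar>l\<bar>" and b="\<bar>lam\<bar>"])
  show "(\<lambda>t. G j t (\<lambda>i. V (j + i) t) + l) \<in> borel_measurable borel"
    by (intro borel_measurable_add G_measurable) auto
  fix t
  have "\<bar>V (j + i) t - V (j + 0) t\<bar> \<le> 2 * C + \<bar>q\<bar> * m" if "i \<in> {- int m..int m}" for i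
  proof -
    have "\<bar>q\<bar> * \<bar>of_int i\<bar> \<le> \<bar>q\<bar> * m" using that by (intro mult_left_mono) auto
    then have "\<bar>q * of_int i\<bar> \<le> \<bar>q\<bar> * m" by (simp add: abs_mult)
    then show ?thesis using bound[of "j + i" t] bound[of j t] by (simp add: algebra_simps abs_le_iff)
  qed
  from G_bound[of "\<lambda>i. V (j + i) t", OF this]
  have "\<bar>G j t (\<lambda>i. V (j + i) t) - V j t\<bar> \<le> B + K * (2 * C + \<bar>q\<bar> * m)" by simp
  moreover have "\<bar>lam * t\<bar> = \<bar>lam\<bar> * \<bar>t\<bar>" by (simp add: abs_mult)
  ultimately show "\<bar>G j t (\<lambda>i. V (j + i) t) + l\<bar> \<le> \<bar>q * j\<bar> + C + B + K * (2 * C + \<bar>q\<bar> * m) + \<bar>l\<bar> + \<bar>lam\<bar> * \<bar>t\<bar>"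
    using bound[of j t] by linarith
qed

text \<open>If \<open>U\<close> grew faster than \<open>V\<close>, then \<open>U - V\<close> would be bounded by a multiple of
  \<open>exp (c * \<tau>)\<close>, and for large \<open>c\<close> every application of the equation halves this multiple.\<close>

lemma speed_comparison:
  fixes U V :: "int \<Rightarrow> real \<Rightarrow> real" and q :: real
  assumes [measurable]: "\<And>j. U j \<in> borel_measurable borel" "\<And>j. V j \<in> borel_measurable borel"
    and U: "\<And>j \<tau>. \<bar>U j \<tau> - lam * \<tau> - q * j\<bar> \<le> C"
    and V: "\<And>j \<tau>. \<bar>V j \<tau> - lam' * \<tau> - q * j\<bar> \<le> C'"
    and sub: "\<And>j \<tau>. U j \<tau> \<le> relax \<alpha> (relax \<alpha> (\<lambda>t. G j t (\<lambda>i. U (j + i) t) + l)) \<tau>"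
    and sup: "\<And>j \<tau>. relax \<alpha> (relax \<alpha> (\<lambda>t. G j t (\<lambda>i. V (j + i) t) + l')) \<tau> \<le> V j \<tau>"
    and "l \<le> l'"
  shows "lam \<le> lam'"
proof (rule ccontr)
  define d where "d = lam - lam'"
  assume "\<not> lam \<le> lam'"
  then have d: "d > 0" by (simp add: d_def)
  \<comment> \<open>\<open>\<kappa>\<close> is the factor by which \<open>relax\<close> shrinks
    \<open>exp (c * t)\<close>. This \<open>c\<close> makes it beat the Lipschitz constant:
    \<open>K * \<kappa> \<le> 1 / 2\<close>.\<close>
  define c where "c = 2 * \<alpha> * (K + 1)"
  define \<kappa> where "\<kappa> = \<alpha> / (\<alpha> + c)"
  have c: "c > 0" using \<alpha>_pos K_nonneg by (simp add: c_def)
  have \<kappa>: "\<kappa> > 0" "\<kappa> \<le> 1" "K * \<kappa> \<le> 1 / 2"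
    using \<alpha>_pos K_nonneg c by (auto simp: \<kappa>_def c_def field_simps add_nonneg_pos add_pos_nonneg)
  have contract: "U j T - V j T \<le> W / 2 * exp (c * T)"
    if W: "W \<ge> 0" and le: "\<And>j \<tau>. U j \<tau> - V j \<tau> \<le> W * exp (c * \<tau>)" for W j T
  proof -
    define g where "g t = G j t (\<lambda>i. U (j + i) t) + l" for t
    define h where "h t = G j t (\<lambda>i. V (j + i) t) + l'" for t
    define E where "E t = exp (c * min t T)" for t
    have g: "linear_growth g" unfolding g_def by (rule linear_growth_G[OF _ U]) measurable
    have h: "linear_growth h" unfolding h_def by (rule linear_growth_G[OF _ V]) measurable
    have E: "linear_growth (\<lambda>t. a * E t)" for a
      unfolding E_def using c by (intro linear_growth_cmult linear_growth_exp_min) simp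
    have relE: "relax \<alpha> (\<lambda>t. a * E t) t = a * \<kappa> * E t" if "t \<le> T" for a t
      unfolding relax_cmult E_def using relax_exp_le[OF \<alpha>_pos _ that, of c] c that
      by (simp add: \<kappa>_def min_def)
    have gh: "g t \<le> h t + (K * W) * E t" if "t \<le> T" for t
    proof -
      have "G j t (\<lambda>i. U (j + i) t) \<le> G j t (\<lambda>i. V (j + i) t) + K * (W * E t)"
      proof (rule G_le_add)
        show "W * E t \<ge> 0" using W by (simp add: E_def)
        show "U (j + i) t \<le> V (j + i) t + W * E t" for i
          using le[of "j + i" t] that by (simp add: E_def min_def)
      qed
      then show ?thesis unfolding g_def h_def using \<open>l \<le> l'\<close> by simp
    qed
    have 1: "relax \<alpha> g t \<le> relax \<alpha> h t + (K * W * \<kappa>) * E t" if "t \<le> T" for t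
    proof -
      have "relax \<alpha> g t \<le> relax \<alpha> (\<lambda>t. h t + (K * W) * E t) t"
        by (rule relax_mono[OF \<alpha>_pos g linear_growth_add[OF h E]]) (use gh that in auto)
      also have "\<dots> = relax \<alpha> h t + (K * W * \<kappa>) * E t"
        using relax_add[OF \<alpha>_pos h E] relE[OF that] by simp
      finally show ?thesis .
    qed
    have "relax \<alpha> (relax \<alpha> g) T \<le> relax \<alpha> (\<lambda>t. relax \<alpha> h t + (K * W * \<kappa>) * E t) T"
      by (rule relax_mono[OF \<alpha>_pos linear_growth_relax[OF \<alpha>_pos g] linear_growth_add[OF linear_growth_relax[OF \<alpha>_pos h] E]])
         (rule 1)
    also have "\<dots> = relax \<alpha> (relax \<alpha> h) T + (K * W * \<kappa> * \<kappa>) * E T"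
      using relax_add[OF \<alpha>_pos linear_growth_relax[OF \<alpha>_pos h] E] relE[of T] by simp
    finally have "U j T - V j T \<le> (K * W * \<kappa> * \<kappa>) * exp (c * T)"
      using sub[of j T] sup[of j T] unfolding g_def h_def E_def by simp
    also have "\<dots> \<le> W / 2 * exp (c * T)"
    proof (rule mult_right_mono)
      have "(K * \<kappa>) * (W * \<kappa>) \<le> (1 / 2) * (W * 1)"
        using \<kappa> W K_nonneg by (intro mult_mono) auto
      then show "K * W * \<kappa> * \<kappa> \<le> W / 2" by (simp add: algebra_simps)
    qed simp
    finally show ?thesis .
  qed
  \<comment> \<open>With \<open>x \<le> exp x\<close> for
    \<open>x = c * (C + C') / d + c * \<tau>\<close>, the linear bound
    \<open>d * \<tau> + (C + C')\<close> lies below \<open>W * exp (c * \<tau>)\<close> at all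
    times.\<close>
  define W where "W = d / c * exp (c * (C + C') / d)"
  have W: "W \<ge> 0" using d c by (simp add: W_def)
  have diff: "U j \<tau> - V j \<tau> \<le> d * \<tau> + (C + C')" "U j \<tau> - V j \<tau> \<ge> d * \<tau> - (C + C')" for j \<tau>
    using U[of j \<tau>] V[of j \<tau>] by (auto simp: d_def algebra_simps abs_le_iff)
  have base: "U j \<tau> - V j \<tau> \<le> W * exp (c * \<tau>)" for j \<tau>
  proof -
    define x where "x = c * (C + C') / d + c * \<tau>"
    have "d * \<tau> + (C + C') = d / c * x" using d c by (simp add: x_def field_simps)
    also have "\<dots> \<le> d / c * exp x"
    proof (rule mult_left_mono)
      show "x \<le> exp x" using exp_ge_add_one_self[of x] by linarith
    qed (use d c in simp)
    also have "\<dots> = W * exp (c * \<tau>)" unfolding W_def x_def exp_add by simp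
    finally show ?thesis using diff(1)[of j \<tau>] by simp
  qed
  have iter: "U j \<tau> - V j \<tau> \<le> W / 2 ^ k * exp (c * \<tau>)" for k j \<tau>
  proof (induction k arbitrary: j \<tau>)
    case 0 then show ?case using base by simp
  next
    case (Suc k)
    then show ?case using contract[of "W / 2 ^ k" j \<tau>] W by (simp add: field_simps)
  qed
  \<comment> \<open>At this time the difference of speeds alone forces
    \<open>U 0 \<tau> - V 0 \<tau> \<ge> 1\<close>.\<close>
  define \<tau> where "\<tau> = (C + C' + 1) / d"
  have "U 0 \<tau> - V 0 \<tau> \<le> 0"
  proof (rule tendsto_lowerbound)
    have "(\<lambda>k. W * exp (c * \<tau>) * (1 / 2) ^ k) \<longlonglongrightarrow> W * exp (c * \<tau>) * 0"
      by (intro tendsto_intros LIMSEQ_realpow_zero) auto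
    then show "(\<lambda>k. W / 2 ^ k * exp (c * \<tau>)) \<longlonglongrightarrow> 0" by (simp add: power_divide mult_ac)
  qed (use iter in auto)
  moreover have "d * \<tau> = C + C' + 1" using d by (simp add: \<tau>_def)
  ultimately show False using diff(2)[of \<tau> 0] by simp
qed

text \<open>The counterpart of \<open>hull_profile\<close> on which the operators act. The bound is
  required for index 0 only, since \<open>profile_bound\<close> extends it to all \<open>j\<close>,
  and \<open>C\<close> is explicit because limits need it uniform along a sequence.\<close>

definition profile :: "real \<Rightarrow> real \<Rightarrow> (int \<Rightarrow> real \<times> real \<Rightarrow> real) \<Rightarrow> bool" where
  "profile p C e \<longleftrightarrow>
    (\<forall>j. e j \<in> borel_measurable borel) \<and>
    (\<forall>j \<tau> z. \<forall>s\<in>P. e j (\<tau> + s, z) = e j (\<tau>, z)) \<and>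
    (\<forall>j \<tau> z. e j (\<tau>, z + 1) = e j (\<tau>, z) + 1) \<and>
    (\<forall>j \<tau> z. e (j + int n) (\<tau>, z) = e j (\<tau>, z + p)) \<and>
    (\<forall>j \<tau> z. e j (\<tau>, z) \<le> e (j + 1) (\<tau>, z)) \<and>
    (\<forall>j \<tau> z z'. z \<le> z' \<longrightarrow> e j (\<tau>, z) \<le> e j (\<tau>, z')) \<and>
    (\<forall>\<tau> z. \<bar>e 0 (\<tau>, z) - z\<bar> \<le> C)"

lemma profileD:
  assumes "profile p C e"
  shows "e j \<in> borel_measurable borel"
    and "s \<in> P \<Longrightarrow> e j (\<tau> + s, z) = e j (\<tau>, z)"
    and "e j (\<tau>, z + 1) = e j (\<tau>, z) + 1"
    and "e (j + int n) (\<tau>, z) = e j (\<tau>, z + p)"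
    and "e j (\<tau>, z) \<le> e (j + 1) (\<tau>, z)"
    and "z \<le> z' \<Longrightarrow> e j (\<tau>, z) \<le> e j (\<tau>, z')"
    and "\<bar>e 0 (\<tau>, z) - z\<bar> \<le> C"
  using assms unfolding profile_def by auto

lemma profile_weaken: "profile p C e \<Longrightarrow> C \<le> C' \<Longrightarrow> profile p C' e"
  unfolding profile_def by (meson order_trans)

lemma profile_add_int:
  assumes "profile p C e"
  shows "e j (\<tau>, z + of_int k) = e j (\<tau>, z) + of_int k"
proof -
  have nat: "e j (\<tau>, z + real i) = e j (\<tau>, z) + real i" for z i
    using profileD(3)[OF assms, of j \<tau> "z + real i" for i]
    by (induction i) (auto simp: algebra_simps)
  show ?thesis
  proof (cases "k \<ge> 0")
    case True then show ?thesis using nat[of z "nat k"] by simp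
  next
    case False then show ?thesis using nat[of "z + of_int k" "nat (- k)"] by simp
  qed
qed

lemma shift_index_multiple:
  assumes "\<And>j z. e (j + int n) (\<tau> :: real, z :: real) = (e j (\<tau>, z + p) :: real)"
  shows "e (j + k * int n) (\<tau>, z) = e j (\<tau>, z + of_int k * p)"
proof -
  have nat: "e (j + int i * int n) (\<tau>, z) = e j (\<tau>, z + real i * p)" for i j z
  proof (induction i arbitrary: z)
    case (Suc i)
    have "e (j + int (Suc i) * int n) (\<tau>, z) = e ((j + int i * int n) + int n) (\<tau>, z)"
      by (simp add: algebra_simps)
    also have "\<dots> = e j (\<tau>, (z + p) + real i * p)" unfolding assms Suc ..
    finally show ?case by (simp add: algebra_simps)
  qed simp
  show ?thesis
  proof (cases "k \<ge> 0")
    case True then show ?thesis using nat[of j "nat k" z] by simp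
  next
    case False
    then show ?thesis using nat[of "j + k * int n" "nat (- k)" "z + of_int k * p"] by simp
  qed
qed

text \<open>Division with remainder, \<open>j = r + k * n\<close>, turns the index into a
  translation by \<open>k * p\<close>; monotonicity squeezes \<open>e r\<close> between
  \<open>e 0\<close> and \<open>e n\<close>, the latter being \<open>e 0\<close> translated by
  \<open>p\<close>. This costs one \<open>p\<close>, and replacing \<open>k * p\<close> by
  \<open>p / n * j\<close> costs the other. The offset \<open>d\<close> lets the same argument serve
  \<open>profile_bound\<close> and \<open>profile_oscillation\<close>.\<close>

lemma index_bound:
  fixes e :: "int \<Rightarrow> real \<times> real \<Rightarrow> real"
  assumes shift: "\<And>j z. e (j + int n) (\<tau>, z) = e j (\<tau>, z + p)"
    and mono: "\<And>j z. e j (\<tau>, z) \<le> e (j + 1) (\<tau>, z)"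
    and bound: "\<And>z. \<bar>e 0 (\<tau>, z) - z - d\<bar> \<le> C" and "p \<ge> 0"
  shows "\<bar>e j (\<tau>, z) - z - p / n * j - d\<bar> \<le> C + 2 * p"
proof -
  define k r where "k = j div int n" and "r = j mod int n"
  have j: "j = r + k * int n" by (simp add: k_def r_def)
  have r: "0 \<le> r" "r < int n" using n_pos by (auto simp: r_def)
  have mono': "e i (\<tau>, z) \<le> e (i + int l) (\<tau>, z)" for i l z
  proof (induction l)
    case (Suc l) then show ?case using mono[of "i + int l" z] by (simp add: algebra_simps)
  qed simp
  define z' where "z' = z + of_int k * p"
  have "e j (\<tau>, z) = e r (\<tau>, z')"
    unfolding j z'_def using shift by (rule shift_index_multiple)
  moreover have "e 0 (\<tau>, z') \<le> e r (\<tau>, z')" using mono'[of 0 z' "nat r"] r by simp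
  moreover have "e r (\<tau>, z') \<le> e 0 (\<tau>, z' + p)"
    using mono'[of r z' "nat (int n - r)"] shift[of 0 z'] r by simp
  ultimately have "\<bar>e j (\<tau>, z) - z' - d\<bar> \<le> C + p"
    using bound[of z'] bound[of "z' + p"] \<open>p \<ge> 0\<close> by linarith
  moreover have "p / n * j - of_int k * p = p * (r / n)"
    unfolding j using n_pos by (simp add: field_simps)
  moreover have "0 \<le> p * (r / n)" "p * (r / n) \<le> p * 1"
    using \<open>p \<ge> 0\<close> r n_pos by (intro mult_left_mono mult_nonneg_nonneg; simp)+
  ultimately show ?thesis unfolding z'_def by linarith
qed

lemma profile_bound:
  assumes "profile p C e" "p \<ge> 0"
  shows "\<bar>e j (\<tau>, z) - z - p / n * j\<bar> \<le> C + 2 * p"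
  using index_bound[of e \<tau> p 0 C j z] profileD[OF assms(1)] assms(2) by simp

text \<open>The right-hand side is free of \<open>C\<close>: monotonicity in \<open>z\<close> and
  the unit shift tie all values at time \<open>\<tau>\<close> to the one at \<open>z = 0\<close>.
  What remains uncontrolled is the variation of that value in time, which \<open>harnack\<close>
  handles.\<close>

lemma profile_oscillation:
  assumes "profile p C e" "p \<ge> 0"
  shows "\<bar>e j (\<tau>, z) - z - p / n * j - e 0 (\<tau>, 0)\<bar> \<le> 1 + 2 * p"
proof (rule index_bound)
  fix z
  define r where "r = z - real_of_int \<lfloor>z\<rfloor>"
  have r: "0 \<le> r" "r \<le> 1" unfolding r_def by linarith+
  have "e 0 (\<tau>, z) = e 0 (\<tau>, r) + \<lfloor>z\<rfloor>"
    using profile_add_int[OF assms(1), of 0 \<tau> r "\<lfloor>z\<rfloor>"] by (simp add: r_def)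
  moreover have "e 0 (\<tau>, 0) \<le> e 0 (\<tau>, r)" "e 0 (\<tau>, r) \<le> e 0 (\<tau>, 0) + 1"
    using profileD(6)[OF assms(1), of 0 r 0 \<tau>] profileD(6)[OF assms(1), of r 1 0 \<tau>]
      profileD(3)[OF assms(1), of 0 \<tau> 0] r by auto
  ultimately show "\<bar>e 0 (\<tau>, z) - z - e 0 (\<tau>, 0)\<bar> \<le> 1" using r r_def by linarith
qed (use profileD[OF assms(1)] assms(2) in auto)

text \<open>Twice the oscillation \<open>1 + 2 * p\<close>, plus the drift \<open>p / n * i\<close>,
  which is at most \<open>p * m\<close> in absolute value on the window.\<close>

definition window_width :: "real \<Rightarrow> real" where
  "window_width p = p * m + 4 * p + 2"

lemma profile_window:
  assumes "profile p C e" "p \<ge> 0" "i \<in> {- int m..int m}"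
  shows "\<bar>e (j + i) x - e j x\<bar> \<le> window_width p"
proof -
  obtain \<tau> z where x: "x = (\<tau>, z)" by (cases x)
  have "\<bar>of_int i / n :: real\<bar> \<le> real m" 
  proof -
    have "\<bar>of_int i :: real\<bar> \<le> real m * 1" using assms(3) by (simp add: abs_le_iff)
    also have "\<dots> \<le> real m * real n" using n_pos by (intro mult_left_mono) auto
    finally show ?thesis using n_pos by (simp add: field_simps)
  qed
  then have "\<bar>p * (of_int i / n)\<bar> \<le> p * m" using assms(2) 
    using mult_left_mono[of "\<bar>of_int i / n\<bar>" "real m" p] unfolding abs_mult by simp
  moreover have "p / n * of_int (j + i) - p / n * of_int j = p * (of_int i / n)"
    by (simp add: algebra_simps)
  ultimately show ?thesis
    using profile_oscillation[OF assms(1,2), of "j + i" \<tau> z] profile_oscillation[OF assms(1,2), of j \<tau> z]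
    unfolding x window_width_def by linarith
qed

section \<open>The operators \<open>advect\<close>, \<open>react\<close> and \<open>step\<close> on
  profiles\<close>

definition advect :: "real \<Rightarrow> (real \<times> real \<Rightarrow> real) \<Rightarrow> real \<times> real \<Rightarrow> real" where
  "advect lam f x = (\<integral>s. f (fst x - s, snd x - lam * s) \<partial>expo \<alpha>)"

text \<open>The shift \<open>l\<close> stands for \<open>2 L / \<alpha>\<close>, the effect of replacing \<open>F\<close> by \<open>L + F\<close>.\<close>

definition react :: "real \<Rightarrow> (int \<Rightarrow> real \<times> real \<Rightarrow> real) \<Rightarrow> int \<Rightarrow> real \<times> real \<Rightarrow> real" where
  "react l e j x = G j (fst x) (\<lambda>i. e (j + i) x) + l"

text \<open>This eliminates the second component of a hull function: if
  \<open>step lam l h = h\<close>, then that component is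
  \<open>advect lam (react l h j)\<close>.\<close>

definition step :: "real \<Rightarrow> real \<Rightarrow> (int \<Rightarrow> real \<times> real \<Rightarrow> real) \<Rightarrow> int \<Rightarrow> real \<times> real \<Rightarrow> real" where
  "step lam l e j = advect lam (advect lam (react l e j))"

lemma advect_eq_relax: "advect lam f (\<tau>, z) = relax \<alpha> (\<lambda>t. f (t, z + lam * (t - \<tau>))) \<tau>"
  unfolding advect_def relax_def by simp

text \<open>On a characteristic the average sees only that characteristic, so operators on the plane
  reduce to \<open>relax\<close> in one variable.\<close>

lemma advect_line: "advect lam f (\<tau>, lam * \<tau> + c) = relax \<alpha> (\<lambda>t. f (t, lam * t + c)) \<tau>"
  unfolding advect_eq_relax by (simp add: algebra_simps)

lemma linear_growth_line:
  assumes [measurable]: "f \<in> borel_measurable borel" and bound: "\<And>\<tau> z. \<bar>f (\<tau>, z) - z\<bar> \<le> C"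
  shows "linear_growth (\<lambda>t. f (t, lam * t + c))"
proof (rule linear_growthI[where a="C + \<bar>c\<bar>" and b="\<bar>lam\<bar>"])
  fix t show "\<bar>f (t, lam * t + c)\<bar> \<le> C + \<bar>c\<bar> + \<bar>lam\<bar> * \<bar>t\<bar>"
    using bound[of t "lam * t + c"] abs_triangle_ineq[of "lam * t" c] by (simp add: abs_mult abs_le_iff)
qed measurable

lemma linear_growth_profile:
  assumes "profile p C e" "p \<ge> 0"
  shows "linear_growth (\<lambda>t. e j (t, lam * t + c))"
proof (rule linear_growth_line)
  show "e j \<in> borel_measurable borel" using profileD[OF assms(1)] by auto
  show "\<bar>e j (\<tau>, z) - z\<bar> \<le> C + 2 * p + \<bar>p / n * j\<bar>" for \<tau> z
    using profile_bound[OF assms, of j \<tau> z] by linarith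
qed

lemma linear_growth_profile':
  assumes "profile p C e" "p \<ge> 0"
  shows "linear_growth (\<lambda>t. e j (t, z + lam * (t - \<tau>)))"
  using linear_growth_profile[OF assms, of j lam "z - lam * \<tau>"] by (simp add: algebra_simps)

lemma advect_measurable:
  assumes [measurable]: "f \<in> borel_measurable borel"
  shows "advect lam f \<in> borel_measurable borel"
proof -
  interpret prob_space "expo \<alpha>" by (rule prob_space_expo) (rule \<alpha>_pos)
  have [measurable]: "f \<in> borel_measurable (borel \<Otimes>\<^sub>M borel)" by (simp add: borel_prod)
  have "(\<lambda>x. \<integral>s. f (fst x - s, snd x - lam * s) \<partial>expo \<alpha>) \<in> borel_measurable (borel \<Otimes>\<^sub>M borel)"
    by measurable
  then show ?thesis unfolding advect_def by (simp add: borel_prod)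
qed

text \<open>The conditions pass through the average; the loss
  \<open>\<bar>lam\<bar> / \<alpha>\<close> is the mean displacement in \<open>z\<close>, since the
  mean backward time is \<open>1 / \<alpha>\<close>.\<close>

lemma profile_advect:
  assumes e: "profile p C e" and "p \<ge> 0"
  shows "profile p (C + \<bar>lam\<bar> / \<alpha>) (\<lambda>j. advect lam (e j))"
proof -
  note D = profileD[OF e] and lg = linear_growth_profile'[OF assms]
  have "advect lam (e j) \<in> borel_measurable borel" for j by (rule advect_measurable[OF D(1)])
  moreover have "advect lam (e j) (\<tau> + s, z) = advect lam (e j) (\<tau>, z)" if "s \<in> P" for j \<tau> z s
  proof -
    have "e j (\<tau> + s - r, y) = e j (\<tau> - r, y)" for r y
      using D(2)[OF that, of j "\<tau> - r" y] by (simp add: algebra_simps)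
    then show ?thesis unfolding advect_def by simp
  qed
  moreover have "advect lam (e j) (\<tau>, z + 1) = advect lam (e j) (\<tau>, z) + 1" for j \<tau> z
  proof -
    have "e j (\<tau> - s, z + 1 - lam * s) = e j (\<tau> - s, z - lam * s) + 1" for s
      using D(3)[of j "\<tau> - s" "z - lam * s"] by (simp add: algebra_simps)
    then show ?thesis
      using linear_growth_integrable[OF \<alpha>_pos lg[of j z lam \<tau>], of \<tau>] \<alpha>_pos
      unfolding advect_def by (simp add: measure_expo_UNIV)
  qed
  moreover have "advect lam (e (j + int n)) (\<tau>, z) = advect lam (e j) (\<tau>, z + p)" for j \<tau> z
    unfolding advect_def fst_conv snd_conv D(4) by (simp add: algebra_simps)
  moreover have "advect lam (e j) (\<tau>, z) \<le> advect lam (e (j + 1)) (\<tau>, z)" for j \<tau> z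
    unfolding advect_eq_relax by (intro relax_mono \<alpha>_pos lg D(5))
  moreover have "advect lam (e j) (\<tau>, z) \<le> advect lam (e j) (\<tau>, z')" if "z \<le> z'" for j \<tau> z z'
    unfolding advect_eq_relax by (intro relax_mono \<alpha>_pos lg D(6)) (use that in auto)
  moreover have "\<bar>advect lam (e 0) (\<tau>, z) - z\<bar> \<le> C + \<bar>lam\<bar> / \<alpha>" for \<tau> z
  proof -
    have b: "z - lam * \<tau> - C + lam * t \<le> e 0 (t, z + lam * (t - \<tau>))"
      "e 0 (t, z + lam * (t - \<tau>)) \<le> z - lam * \<tau> + C + lam * t" for t
      using D(7)[of t "z + lam * (t - \<tau>)"] by (auto simp: algebra_simps abs_le_iff)
    have "relax \<alpha> (\<lambda>t. z - lam * \<tau> - C + lam * t) \<tau> \<le> advect lam (e 0) (\<tau>, z)"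
      "advect lam (e 0) (\<tau>, z) \<le> relax \<alpha> (\<lambda>t. z - lam * \<tau> + C + lam * t) \<tau>"
      unfolding advect_eq_relax by (intro relax_mono \<alpha>_pos lg linear_growth_affine b)+
    then have "z - C - lam / \<alpha> \<le> advect lam (e 0) (\<tau>, z)" "advect lam (e 0) (\<tau>, z) \<le> z + C - lam / \<alpha>"
      unfolding relax_affine[OF \<alpha>_pos] by auto
    moreover have "\<bar>lam / \<alpha>\<bar> = \<bar>lam\<bar> / \<alpha>" using \<alpha>_pos by simp
    ultimately show ?thesis by linarith
  qed
  ultimately show ?thesis unfolding profile_def by blast
qed

text \<open>The width of a window does not involve \<open>C\<close>, so one reaction displaces every
  profile by the same bounded amount, however far it is from the identity.\<close>

lemma react_close:
  assumes "profile p C e" "p \<ge> 0"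
  shows "\<bar>react l e j x - e j x\<bar> \<le> B + K * window_width p + \<bar>l\<bar>"
  using G_bound[of "\<lambda>i. e (j + i) x" "window_width p" j "fst x"] profile_window[OF assms, of _ j x]
  unfolding react_def by auto

lemma profile_mono_index:
  assumes "profile p C e" "i \<le> j"
  shows "e i x \<le> e j x"
proof -
  obtain \<tau> z where x: "x = (\<tau>, z)" by (cases x)
  have "e i (\<tau>, z) \<le> e (i + int l) (\<tau>, z)" for l
  proof (induction l)
    case (Suc l) then show ?case using profileD(5)[OF assms(1), of "i + int l" \<tau> z] by (simp add: algebra_simps)
  qed simp
  from this[of "nat (j - i)"] show ?thesis using assms(2) x by simp
qed

lemma profile_react:
  assumes e: "profile p C e" and "p \<ge> 0"
  shows "profile p (C + (B + K * window_width p + \<bar>l\<bar>)) (react l e)"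
proof -
  note D = profileD[OF e]
  have "react l e j \<in> borel_measurable borel" for j
    unfolding react_def by (intro borel_measurable_add G_measurable D) (auto intro!: borel_measurable_continuous_onI continuous_intros)
  moreover have "react l e j (\<tau> + s, z) = react l e j (\<tau>, z)" if "s \<in> P" for j \<tau> z s
    unfolding react_def fst_conv D(2)[OF that] G_period[OF that] ..
  moreover have "react l e j (\<tau>, z + 1) = react l e j (\<tau>, z) + 1" for j \<tau> z
    unfolding react_def fst_conv D(3) using G_shift[of j \<tau> _ 1] by simp
  moreover have "react l e (j + int n) (\<tau>, z) = react l e j (\<tau>, z + p)" for j \<tau> z
  proof -
    have "e (j + int n + i) (\<tau>, z) = e (j + i) (\<tau>, z + p)" for i
      using D(4)[of "j + i" \<tau> z] by (simp add: algebra_simps)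
    then show ?thesis unfolding react_def fst_conv G_index by simp
  qed
  moreover have "react l e j (\<tau>, z) \<le> react l e (j + 1) (\<tau>, z)" for j \<tau> z
    using G_next[of "\<lambda>i. e (j + i) (\<tau>, z)" j \<tau>] D(5)[of "j + i" \<tau> z for i]
    unfolding react_def by (simp add: algebra_simps)
  moreover have "react l e j (\<tau>, z) \<le> react l e j (\<tau>, z')" if "z \<le> z'" for j \<tau> z z'
    unfolding react_def using that by (auto intro!: G_mono D(6))
  moreover have "\<bar>react l e 0 (\<tau>, z) - z\<bar> \<le> C + (B + K * window_width p + \<bar>l\<bar>)" for \<tau> z
    using react_close[OF assms, of l 0 "(\<tau>, z)"] D(7)[of \<tau> z] by linarith
  ultimately show ?thesis unfolding profile_def by blast
qed

text \<open>One displacement as in \<open>react_close\<close> and two of size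
  \<open>\<bar>lam\<bar> / \<alpha>\<close>, one for each average.\<close>

definition step_bound :: "real \<Rightarrow> real \<Rightarrow> real \<Rightarrow> real" where
  "step_bound p lam l = B + K * window_width p + \<bar>l\<bar> + 2 * (\<bar>lam\<bar> / \<alpha>)"

lemma profile_step:
  assumes "profile p C e" "p \<ge> 0"
  shows "profile p (C + step_bound p lam l) (step lam l e)"
  using profile_advect[OF profile_advect[OF profile_react[OF assms] assms(2)] assms(2), of l lam lam]
  unfolding step_def step_bound_def by (rule profile_weaken) simp

lemma advect_mono:
  assumes "profile p C e" "profile p' C' e'" "p \<ge> 0" "p' \<ge> 0" "\<And>x. e j x \<le> e' j' x"
  shows "advect lam (e j) x \<le> advect lam (e' j') x"
  using assms by (cases x) (auto simp: advect_eq_relax intro!: relax_mono \<alpha>_pos linear_growth_profile')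

lemma react_mono: "(\<And>j x. e j x \<le> e' j x) \<Longrightarrow> l \<le> l' \<Longrightarrow> react l e j x \<le> react l' e' j x"
  unfolding react_def by (intro add_mono G_mono) (cases x, blast)+

lemma step_mono:
  assumes e: "profile p C e" "profile p' C' e'" "p \<ge> 0" "p' \<ge> 0" 
    and "\<And>j x. e j x \<le> e' j x"
  shows "step lam l e j x \<le> step lam l e' j x"
  unfolding step_def
  by (rule advect_mono[OF profile_advect[OF profile_react[OF e(1,3)] e(3)] profile_advect[OF profile_react[OF e(2,4)] e(4)] e(3,4)]
           advect_mono[OF profile_react[OF e(1,3)] profile_react[OF e(2,4)] e(3,4)] react_mono)+
     (use assms in auto)

lemma react_tendsto:
  assumes "\<And>i. (\<lambda>k. e k i x) \<longlonglongrightarrow> e' i x"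
  shows "(\<lambda>k. react l (e k) j x) \<longlonglongrightarrow> react l e' j x"
proof -
  define w where "w k = (\<Sum>i\<in>{- int m..int m}. \<bar>e k (j + i) x - e' (j + i) x\<bar>)" for k
  have "w \<longlonglongrightarrow> (\<Sum>i\<in>{- int m..int m}. \<bar>e' (j + i) x - e' (j + i) x\<bar>)"
    unfolding w_def by (intro tendsto_intros assms)
  then have w: "(\<lambda>k. K * w k) \<longlonglongrightarrow> 0" by (auto intro: tendsto_mult_right_zero)
  have w0: "w k \<ge> 0" for k unfolding w_def by (intro sum_nonneg) auto
  have close: "\<bar>e k (j + i) x - e' (j + i) x\<bar> \<le> w k" if "i \<in> {- int m..int m}" for i k
    unfolding w_def by (rule member_le_sum[OF that]) auto
  have "react l (e k) j x \<le> react l e' j x + K * w k" "react l e' j x \<le> react l (e k) j x + K * w k" for k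
  proof -
    have "e k (j + i) x \<le> e' (j + i) x + w k" "e' (j + i) x \<le> e k (j + i) x + w k" if "i \<in> {- int m..int m}" for i
      using close[OF that, of k] by linarith+
    then show "react l (e k) j x \<le> react l e' j x + K * w k" "react l e' j x \<le> react l (e k) j x + K * w k"
      unfolding react_def using G_le_add[OF w0] by fastforce+
  qed
  then have "\<bar>react l (e k) j x - react l e' j x\<bar> \<le> K * w k" for k by (simp add: abs_le_iff algebra_simps)
  then have "(\<lambda>k. react l (e k) j x - react l e' j x) \<longlonglongrightarrow> 0"
    by (intro Lim_null_comparison[OF _ w]) auto
  then show ?thesis by (simp add: LIM_zero_iff)
qed

lemma advect_tendsto:
  assumes [measurable]: "\<And>k. f k \<in> borel_measurable borel" "f' \<in> borel_measurable borel"
    and bound: "\<And>k \<tau> z. \<bar>f k (\<tau>, z) - z\<bar> \<le> C" and lim: "\<And>x. (\<lambda>k. f k x) \<longlonglongrightarrow> f' x"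
  shows "(\<lambda>k. advect lam (f k) x) \<longlonglongrightarrow> advect lam f' x"
  unfolding advect_def
proof (rule integral_dominated_convergence)
  have [measurable]: "\<And>k. f k \<in> borel_measurable (borel \<Otimes>\<^sub>M borel)" "f' \<in> borel_measurable (borel \<Otimes>\<^sub>M borel)"
    by (simp_all add: borel_prod)
  show "(\<lambda>s. f' (fst x - s, snd x - lam * s)) \<in> borel_measurable (expo \<alpha>)"
    "(\<lambda>s. f k (fst x - s, snd x - lam * s)) \<in> borel_measurable (expo \<alpha>)" for k
    by measurable
  show "integrable (expo \<alpha>) (\<lambda>s. (C + \<bar>snd x\<bar>) + \<bar>lam\<bar> * s)"
    by (rule integrable_expo_affine[OF \<alpha>_pos])
  show "AE s in expo \<alpha>. norm (f k (fst x - s, snd x - lam * s)) \<le> (C + \<bar>snd x\<bar>) + \<bar>lam\<bar> * s" for k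
    using AE_expo_nonneg
  proof eventually_elim
    fix s :: real assume "s \<ge> 0"
    then have "\<bar>lam * s\<bar> = \<bar>lam\<bar> * s" by (simp add: abs_mult)
    then show "norm (f k (fst x - s, snd x - lam * s)) \<le> (C + \<bar>snd x\<bar>) + \<bar>lam\<bar> * s"
      using bound[of k "fst x - s" "snd x - lam * s"] unfolding real_norm_def by linarith
  qed
qed (use lim in auto)

text \<open>The common bound \<open>C\<close> yields dominating functions for both averages,
  uniformly in \<open>k\<close>, so pointwise limits pass through the two integrals.\<close>

lemma step_tendsto:
  assumes e: "\<And>k. profile p C (e k)" "profile p C e'" and "p \<ge> 0"
    and lim: "\<And>j x. (\<lambda>k. e k j x) \<longlonglongrightarrow> e' j x"
  shows "(\<lambda>k. step lam l (e k) j x) \<longlonglongrightarrow> step lam l e' j x"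
  unfolding step_def
proof (rule advect_tendsto)
  define C1 where "C1 = C + (B + K * window_width p + \<bar>l\<bar>)"
  have r: "profile p C1 (react l (e k))" "profile p C1 (react l e')" for k
    unfolding C1_def by (intro profile_react e \<open>p \<ge> 0\<close>)+
  have a: "profile p (C1 + \<bar>lam\<bar> / \<alpha>) (\<lambda>j. advect lam (react l (e k) j))"
    "profile p (C1 + \<bar>lam\<bar> / \<alpha>) (\<lambda>j. advect lam (react l e' j))" for k
    by (intro profile_advect r \<open>p \<ge> 0\<close>)+
  show "advect lam (react l (e k) j) \<in> borel_measurable borel" "advect lam (react l e' j) \<in> borel_measurable borel" for k
    using a profileD(1) by blast+
  show "\<bar>advect lam (react l (e k) j) (\<tau>, z) - z\<bar> \<le> C1 + \<bar>lam\<bar> / \<alpha> + 2 * p + \<bar>p / n * j\<bar>" for k \<tau> z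
    using profile_bound[OF a(1) \<open>p \<ge> 0\<close>, of k j \<tau> z] by linarith
  show "(\<lambda>k. advect lam (react l (e k) j) x) \<longlonglongrightarrow> advect lam (react l e' j) x" for x
  proof (rule advect_tendsto)
    show "react l (e k) j \<in> borel_measurable borel" "react l e' j \<in> borel_measurable borel" for k
      using r profileD(1) by blast+
    show "\<bar>react l (e k) j (\<tau>, z) - z\<bar> \<le> C1 + 2 * p + \<bar>p / n * j\<bar>" for k \<tau> z
      using profile_bound[OF r(1) \<open>p \<ge> 0\<close>, of k j \<tau> z] by linarith
  qed (intro react_tendsto lim)
qed

subsection \<open>Sub- and super-profiles\<close>

lemma profile_rebound:
  "profile p C e \<Longrightarrow> (\<And>\<tau> z. \<bar>e 0 (\<tau>, z) - z\<bar> \<le> C') \<Longrightarrow> profile p C' e"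
  unfolding profile_def by blast

lemma profile_add_const:
  assumes "profile p C e"
  shows "profile p (C + \<bar>c\<bar>) (\<lambda>j x. e j x + c)"
proof -
  have "\<bar>e 0 (\<tau>, z) + c - z\<bar> \<le> C + \<bar>c\<bar>" for \<tau> z
    using profileD(7)[OF assms, of \<tau> z] by linarith
  then show ?thesis using profileD[OF assms] unfolding profile_def by auto
qed

lemma profile_max:
  assumes "profile p C e" "profile p C e'"
  shows "profile p C (\<lambda>j x. max (e j x) (e' j x))"
proof -
  note D = profileD[OF assms(1)] and D' = profileD[OF assms(2)]
  have "max (e j (\<tau>, z)) (e' j (\<tau>, z)) \<le> max (e (j + 1) (\<tau>, z)) (e' (j + 1) (\<tau>, z))" for j \<tau> z
    by (intro max.mono D(5) D'(5))
  moreover have "max (e j (\<tau>, z)) (e' j (\<tau>, z)) \<le> max (e j (\<tau>, z')) (e' j (\<tau>, z'))" if "z \<le> z'" for j \<tau> z z'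
    by (intro max.mono D(6) D'(6) that)
  moreover have "\<bar>max (e 0 (\<tau>, z)) (e' 0 (\<tau>, z)) - z\<bar> \<le> C" for \<tau> z
    using D(7)[of \<tau> z] D'(7)[of \<tau> z] by (simp add: max_def)
  ultimately show ?thesis
    unfolding profile_def using D D' by (auto simp: max_def)
qed

lemma profile_limit:
  assumes e: "\<And>k. profile p C (e k)" and lim: "\<And>j x. (\<lambda>k. e k j x) \<longlonglongrightarrow> e' j x"
  shows "profile p C e'"
proof -
  note D = profileD[OF e]
  have "e' j \<in> borel_measurable borel" for j
    by (rule borel_measurable_LIMSEQ_real[OF lim D(1)])
  moreover have "e' j (\<tau> + s, z) = e' j (\<tau>, z)" if "s \<in> P" for j \<tau> z s
    using lim[of j "(\<tau> + s, z)"] lim[of j "(\<tau>, z)"] unfolding D(2)[OF that] by (rule LIMSEQ_unique)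
  moreover have "e' j (\<tau>, z + 1) = e' j (\<tau>, z) + 1" for j \<tau> z
    using lim[of j "(\<tau>, z + 1)"] tendsto_add[OF lim[of j "(\<tau>, z)"] tendsto_const[of 1]]
    unfolding D(3) by (rule LIMSEQ_unique)
  moreover have "e' (j + int n) (\<tau>, z) = e' j (\<tau>, z + p)" for j \<tau> z
    using lim[of "j + int n" "(\<tau>, z)"] lim[of j "(\<tau>, z + p)"]
    unfolding D(4) by (rule LIMSEQ_unique)
  moreover have "e' j (\<tau>, z) \<le> e' (j + 1) (\<tau>, z)" for j \<tau> z
    by (rule LIMSEQ_le[OF lim lim]) (use D(5) in blast)
  moreover have "e' j (\<tau>, z) \<le> e' j (\<tau>, z')" if "z \<le> z'" for j \<tau> z z'
    by (rule LIMSEQ_le[OF lim lim]) (use D(6)[OF that] in blast)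
  moreover have "\<bar>e' 0 (\<tau>, z) - z\<bar> \<le> C" for \<tau> z
    by (rule tendsto_upperbound[OF tendsto_rabs[OF tendsto_diff[OF lim[of 0 "(\<tau>, z)"] tendsto_const]]])
       (use D(7) in auto)
  ultimately show ?thesis unfolding profile_def by blast
qed

lemma advect_add_const:
  assumes "profile p C e" "p \<ge> 0"
  shows "advect lam (\<lambda>x. e j x + c) x = advect lam (e j) x + c"
proof (cases x)
  case (Pair \<tau> z)
  then show ?thesis
    using linear_growth_integrable[OF \<alpha>_pos linear_growth_profile'[OF assms, of j z lam \<tau>], of \<tau>] \<alpha>_pos
    unfolding advect_def by simp
qed

text \<open>\<open>G\<close> commutes with integer shifts because (A4) is a periodicity. This is why
  the shifts in \<open>sub_profile_normalized\<close> and \<open>fixed_profile_exists\<close> are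
  rounded to integers.\<close>

lemma step_add_int:
  assumes "profile p C e" "p \<ge> 0"
  shows "step lam l (\<lambda>j x. e j x + of_int k) j x = step lam l e j x + of_int k"
proof -
  have "react l (\<lambda>j x. e j x + of_int k) j = (\<lambda>x. react l e j x + of_int k)" for j
    unfolding react_def G_shift by (simp add: fun_eq_iff)
  then show ?thesis
    unfolding step_def
    using advect_add_const[OF profile_react[OF assms] assms(2), of lam l j "of_int k"]
      advect_add_const[OF profile_advect[OF profile_react[OF assms] assms(2)] assms(2), of lam lam l j "of_int k" x]
    by presburger
qed

text \<open>The estimate keeps the time-dependent offset \<open>D\<close> exactly and puts only the
  displacement in \<open>z\<close> into the error. Applied twice, it gives
  \<open>step_close\<close>.\<close>

lemma advect_close:
  assumes e: "profile p C e" "p \<ge> 0" and D: "linear_growth D"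
    and close: "\<And>\<tau> z. \<bar>e j (\<tau>, z) - z - a - D \<tau>\<bar> \<le> c"
  shows "\<bar>advect lam (e j) (\<tau>, z) - z - a - relax \<alpha> D \<tau>\<bar> \<le> c + \<bar>lam\<bar> / \<alpha>"
proof -
  have rel: "relax \<alpha> (\<lambda>t. (b + lam * t) + D t) \<tau> = b + lam * \<tau> - lam / \<alpha> + relax \<alpha> D \<tau>" for b
    using relax_add[OF \<alpha>_pos linear_growth_affine D] relax_affine[OF \<alpha>_pos] by simp
  have "(z - lam * \<tau> + a - c + lam * t) + D t \<le> e j (t, z + lam * (t - \<tau>))"
    "e j (t, z + lam * (t - \<tau>)) \<le> (z - lam * \<tau> + a + c + lam * t) + D t" for t
    using close[of t "z + lam * (t - \<tau>)"] by (auto simp: algebra_simps abs_le_iff)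
  then have "relax \<alpha> (\<lambda>t. (z - lam * \<tau> + a - c + lam * t) + D t) \<tau> \<le> advect lam (e j) (\<tau>, z)"
    "advect lam (e j) (\<tau>, z) \<le> relax \<alpha> (\<lambda>t. (z - lam * \<tau> + a + c + lam * t) + D t) \<tau>"
    unfolding advect_eq_relax
    by (intro relax_mono \<alpha>_pos linear_growth_profile'[OF e] linear_growth_add linear_growth_affine D; simp)+
  then have "z + a - c - lam / \<alpha> + relax \<alpha> D \<tau> \<le> advect lam (e j) (\<tau>, z)"
    "advect lam (e j) (\<tau>, z) \<le> z + a + c - lam / \<alpha> + relax \<alpha> D \<tau>"
    unfolding rel by auto
  moreover have "\<bar>lam / \<alpha>\<bar> = \<bar>lam\<bar> / \<alpha>" using \<alpha>_pos by simp
  ultimately show ?thesis by linarith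
qed

lemma step_close:
  assumes e: "profile p C e" "p \<ge> 0"
  shows "\<bar>step lam l e j (\<tau>, z) - z - p / n * j - relax \<alpha> (relax \<alpha> (\<lambda>t. e 0 (t, 0))) \<tau>\<bar>
    \<le> 1 + 2 * p + step_bound p lam l"
proof -
  have D: "linear_growth (\<lambda>t. e 0 (t, 0))"
    using linear_growth_profile[OF e, of 0 0 0] by simp
  have "\<bar>react l e j (\<tau>, z) - z - p / n * j - e 0 (\<tau>, 0)\<bar> \<le> 1 + 2 * p + (B + K * window_width p + \<bar>l\<bar>)" for \<tau> z
    using react_close[OF e, of l j "(\<tau>, z)"] profile_oscillation[OF e, of j \<tau> z] by linarith
  note advect_close[OF profile_react[OF e] e(2) D this, of lam]
  from advect_close[OF profile_advect[OF profile_react[OF e] e(2)] e(2) linear_growth_relax[OF \<alpha>_pos D] this,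
      where lam=lam and \<tau>=\<tau> and z=z]
  show ?thesis unfolding step_def step_bound_def by (simp add: algebra_simps)
qed

text \<open>With \<open>c = 1 + 2 * p + step_bound p lam l\<close>, the error in
  \<open>step_close\<close>, this equals \<open>exp \<alpha> * (1 + c) + c\<close>: the value
  \<open>1 + c\<close> at one time, spread to all times, and the error of returning from the time
  profile.\<close>

definition harnack_const :: "real \<Rightarrow> real \<Rightarrow> real \<Rightarrow> real" where
  "harnack_const p lam l = exp \<alpha> * (2 + 2 * p + step_bound p lam l) + (1 + 2 * p + step_bound p lam l)"

lemma step_bound_nonneg: "p \<ge> 0 \<Longrightarrow> step_bound p lam l \<ge> 0"
  using K_nonneg B_nonneg \<alpha>_pos by (simp add: step_bound_def window_width_def)

text \<open>Up to a bounded error, \<open>step\<close> acts on the time profile \<open>D\<close> by relaxing it twice.  The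
  relaxation \<open>R\<close> of a nonnegative \<open>1\<close>-periodic function satisfies \<open>R \<tau> \<le> exp \<alpha> * R \<tau>'\<close> for all
  \<open>\<tau>\<close> and \<open>\<tau>'\<close>; this is applied to \<open>M - D\<close>.\<close>

lemma harnack:
  assumes e: "profile p C e" "p \<ge> 0"
    and M: "\<And>t. e 0 (t, 0) \<le> M" and large: "step lam l e 0 (\<tau>', 0) \<ge> M - 1"
  shows "\<bar>step lam l e j (\<tau>, z) - z - p / n * j - M\<bar> \<le> harnack_const p lam l"
proof -
  define c where "c = 1 + 2 * p + step_bound p lam l"
  define D where "D = (\<lambda>t. e 0 (t, 0))"
  define f where "f = (\<lambda>t. (M + 0 * t) + (-1) * D t)"
  define Q where "Q = relax \<alpha> (relax \<alpha> f)"
  have D: "linear_growth D"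
    unfolding D_def using linear_growth_profile[OF e, of 0 0 0] by simp
  have D': "linear_growth (\<lambda>t. (-1) * D t)" by (rule linear_growth_cmult[OF D])
  have f: "linear_growth f"
    unfolding f_def by (intro linear_growth_add linear_growth_affine D')
  have rf: "relax \<alpha> f = (\<lambda>t. (M + 0 * t) + (-1) * relax \<alpha> D t)"
    unfolding f_def relax_add[OF \<alpha>_pos linear_growth_affine D'] relax_affine[OF \<alpha>_pos] relax_cmult by simp
  have Q: "Q t = M - relax \<alpha> (relax \<alpha> D) t" for t
    unfolding Q_def rf
    unfolding relax_add[OF \<alpha>_pos linear_growth_affine linear_growth_cmult[OF linear_growth_relax[OF \<alpha>_pos D]]]
      relax_affine[OF \<alpha>_pos] relax_cmult by simp
  have f0: "f t \<ge> 0" for t using M[of t] by (simp add: f_def D_def)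
  have rf0: "relax \<alpha> f t \<ge> 0" for t by (rule relax_nonneg) (rule f0)
  have Q0: "Q t \<ge> 0" for t unfolding Q_def by (rule relax_nonneg) (rule rf0)
  have per: "relax \<alpha> g (t + of_int k) = relax \<alpha> g t" if "\<And>t. g (t + of_int k) = g t" for g t k
    unfolding relax_def using that[of "t - s" for s] by (simp add: algebra_simps)
  have D_per: "D (t + of_int k) = D t" for t k
  proof -
    have nat: "D (t + real i) = D t" for t i
      using profileD(2)[OF e(1) period_1, of 0 "t + real i" 0 for i]
      by (induction i) (auto simp: D_def algebra_simps)
    show ?thesis
    proof (cases "k \<ge> 0")
      case True then show ?thesis using nat[of t "nat k"] by simp
    next
      case False then show ?thesis using nat[of "t + of_int k" "nat (- k)"] by simp
    qed
  qed
  have Q_per: "Q (t + of_int k) = Q t" for t k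
    unfolding Q_def by (intro per) (simp add: f_def D_per)
  have c0: "c \<ge> 0" using step_bound_nonneg[OF e(2)] e(2) by (simp add: c_def)
  \<comment> \<open>The hypothesis \<open>large\<close> makes the nonnegative \<open>Q\<close> small
    at one time; the rest of the proof spreads this to all times.\<close>
  have Q1: "Q \<tau>' \<le> 1 + c"
    using step_close[OF e, of lam l 0 \<tau>' 0] large Q[of \<tau>'] unfolding c_def D_def by simp
  \<comment> \<open>\<open>relax_earlier_le\<close> compares only with later times, so
    \<open>\<tau>\<close> is moved by an integer into the unit interval that ends at
    \<open>\<tau>'\<close>.\<close>
  define t where "t = \<tau> + of_int \<lfloor>\<tau>' - \<tau>\<rfloor>"
  have t: "t \<le> \<tau>'" "\<tau>' - t \<le> 1" unfolding t_def by linarith+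
  have "Q \<tau> = Q t" unfolding t_def Q_per ..
  also have "\<dots> \<le> exp (\<alpha> * (\<tau>' - t)) * Q \<tau>'"
    unfolding Q_def by (rule relax_earlier_le[OF \<alpha>_pos linear_growth_relax[OF \<alpha>_pos f] rf0 t(1)])
  also have "\<dots> \<le> exp \<alpha> * (1 + c)"
    using t \<alpha>_pos Q1 Q0[of \<tau>'] by (intro mult_mono) (auto simp: mult_left_le)
  finally have "Q \<tau> \<le> exp \<alpha> * (1 + c)" .
  then show ?thesis
    using step_close[OF e, of lam l j \<tau> z] Q[of \<tau>] Q0[of \<tau>]
    unfolding harnack_const_def c_def D_def by (simp add: algebra_simps)
qed

definition sub_profile :: "real \<Rightarrow> real \<Rightarrow> real \<Rightarrow> (int \<Rightarrow> real \<times> real \<Rightarrow> real) \<Rightarrow> bool" where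
  "sub_profile p l lam e \<longleftrightarrow> (\<exists>C. profile p C e) \<and> (\<forall>j x. e j x \<le> step lam l e j x)"

definition super_profile :: "real \<Rightarrow> real \<Rightarrow> real \<Rightarrow> (int \<Rightarrow> real \<times> real \<Rightarrow> real) \<Rightarrow> bool" where
  "super_profile p l lam e \<longleftrightarrow> (\<exists>C. profile p C e) \<and> (\<forall>j x. step lam l e j x \<le> e j x)"

text \<open>A profile may jump in time, so the supremum need not be attained; the slack 1 is the one
  allowed in \<open>harnack\<close>.\<close>

lemma Sup_time:
  assumes "profile p C e"
  obtains M \<tau> where "\<And>t. e 0 (t, 0) \<le> M" "e 0 (\<tau>, 0) \<ge> M - 1"
proof -
  define M where "M = (SUP t. e 0 (t, 0))"
  have b: "bdd_above (range (\<lambda>t. e 0 (t, 0)))"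
    using profileD(7)[OF assms, of _ 0] by (auto simp: abs_le_iff intro!: bdd_aboveI[where M=C])
  have "\<exists>\<tau>. M - 1 < e 0 (\<tau>, 0)"
    using less_cSUP_iff[OF _ b, of "M - 1"] unfolding M_def by auto
  then show ?thesis using that[of M] cSUP_upper[OF UNIV_I b] unfolding M_def by (auto intro: less_imp_le)
qed

text \<open>The new bound depends on the parameters only, which is what sequences of sub-profiles
  need. At a time where \<open>e\<close> is nearly maximal, \<open>e \<le> step lam l e\<close>
  supplies the hypothesis of \<open>harnack\<close>, so \<open>step lam l e\<close>, lowered by the
  integer part of \<open>M\<close>, is close to the identity. The extra 1 pays for the fractional
  part of \<open>M\<close>.\<close>

lemma sub_profile_normalized:
  assumes "sub_profile p l lam e" "p \<ge> 0"
  shows "\<exists>e'. profile p (harnack_const p lam l + 1) e' \<and> (\<forall>j x. e' j x \<le> step lam l e' j x)"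
proof -
  from assms obtain C where e: "profile p C e" and sub: "\<And>j x. e j x \<le> step lam l e j x"
    by (auto simp: sub_profile_def)
  note s = profile_step[OF e assms(2), of lam l]
  obtain M \<tau>' where M: "\<And>t. e 0 (t, 0) \<le> M" and \<tau>': "e 0 (\<tau>', 0) \<ge> M - 1"
    using Sup_time[OF e] by blast
  have close: "\<bar>step lam l e j (\<tau>, z) - z - p / n * j - M\<bar> \<le> harnack_const p lam l" for j \<tau> z
    by (rule harnack[OF e assms(2) M]) (use \<tau>' sub in \<open>auto intro: order_trans\<close>)
  define e' where "e' j x = step lam l e j x + of_int (- \<lfloor>M\<rfloor>)" for j x
  have "profile p (harnack_const p lam l + 1) e'"
  proof (rule profile_rebound)
    show "profile p (C + step_bound p lam l + \<bar>of_int (- \<lfloor>M\<rfloor>)\<bar>) e'"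
      unfolding e'_def by (rule profile_add_const[OF s])
    show "\<bar>e' 0 (\<tau>, z) - z\<bar> \<le> harnack_const p lam l + 1" for \<tau> z
      using close[of 0 \<tau> z] unfolding e'_def by (simp add: abs_le_iff) linarith
  qed
  moreover have "e' j x \<le> step lam l e' j x" for j x
    unfolding e'_def step_add_int[OF s assms(2)]
    using step_mono[OF e s assms(2,2) sub] by simp
  ultimately show ?thesis by blast
qed

definition linear_profile :: "real \<Rightarrow> int \<Rightarrow> real \<times> real \<Rightarrow> real" where
  "linear_profile p j x = snd x + p / n * j"

lemma profile_linear: "p \<ge> 0 \<Longrightarrow> profile p 0 (linear_profile p)"
  unfolding profile_def linear_profile_def using n_pos
  by (auto intro!: borel_measurable_continuous_onI continuous_intros simp: field_simps)

lemma profile_mono_limit: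
  assumes e: "\<And>k. profile p C (e k)" and "p \<ge> 0" and inc: "\<And>k j x. e k j x \<le> e (Suc k) j x"
  obtains e' where "profile p C e'" "\<And>j x. (\<lambda>k. e k j x) \<longlonglongrightarrow> e' j x"
proof -
  have conv: "convergent (\<lambda>k. e k j x)" for j x
  proof (cases x)
    case (Pair \<tau> z)
    have "e k j (\<tau>, z) \<le> z + p / n * j + C + 2 * p" for k
      using profile_bound[OF e assms(2), of k j \<tau> z] by linarith
    then show ?thesis
      unfolding Pair by (intro Bseq_monoseq_convergent BseqI'[where K="\<bar>z + p / n * j\<bar> + C + 2 * p"] mono_SucI1 inc allI)
        (unfold real_norm_def, use profile_bound[OF e assms(2), of _ j \<tau> z] in smt)
  qed
  define e' where "e' j x = lim (\<lambda>k. e k j x)" for j x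
  have lim: "(\<lambda>k. e k j x) \<longlonglongrightarrow> e' j x" for j x
    unfolding e'_def using conv by (simp add: convergent_LIMSEQ_iff)
  then show ?thesis using that profile_limit[OF e lim] by blast
qed

text \<open>Iterating \<open>e \<mapsto> max (linear_profile p) (step e)\<close> from the linear profile gives a
  super-profile in the limit if the iterates stay bounded; otherwise, by \<open>harnack\<close>, one of them
  lies above the linear profile everywhere, and this iterate is a sub-profile.\<close>

lemma sub_or_super:
  assumes "p \<ge> 0"
  shows "(\<exists>e. sub_profile p l lam e) \<or> (\<exists>e. super_profile p l lam e)"
proof -
  define h where "h = linear_profile p"
  define S where "S e j x = max (h j x) (step lam l e j x)" for e j x
  define f where "f k = (S ^^ k) h" for k
  have f0: "f 0 = h" and fS: "f (Suc k) = S (f k)" for k by (auto simp: f_def)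
  have ex: "\<exists>C. profile p C (f k)" for k
  proof (induction k)
    case 0 then show ?case using profile_linear[OF assms] by (auto simp: f0 h_def)
  next
    case (Suc k)
    then obtain C where C: "profile p C (f k)" by blast
    have "profile p (max 0 (C + step_bound p lam l)) (f (Suc k))"
      unfolding fS S_def
      by (rule profile_max; rule profile_weaken)
         (use profile_linear[OF assms] profile_step[OF C assms] in \<open>auto simp: h_def\<close>)
    then show ?case by blast
  qed
  have h_le: "h j x \<le> f k j x" for k j x
    by (cases k) (auto simp: f0 fS S_def)
  have step_f_mono: "step lam l (f k) j x \<le> step lam l (f k') j x" if "\<And>j x. f k j x \<le> f k' j x" for k k' j x
  proof -
    obtain C C' where "profile p C (f k)" "profile p C' (f k')" using ex by blast
    then show ?thesis by (rule step_mono[OF _ _ assms assms that])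
  qed
  have inc: "f k j x \<le> f (Suc k) j x" for k j x
  proof (induction k arbitrary: j x)
    case 0 then show ?case using h_le by (simp add: f0)
  next
    case (Suc k)
    have "step lam l (f k) j x \<le> step lam l (f (Suc k)) j x"
      by (rule step_f_mono) (rule Suc)
    then have "S (f k) j x \<le> S (f (Suc k)) j x"
      unfolding S_def by (intro max.mono order_refl)
    then show ?case unfolding fS[symmetric] .
  qed
  show ?thesis
  proof (cases "\<exists>N. \<forall>k \<tau> z. f k 0 (\<tau>, z) \<le> z + N")
    case True
    then obtain N where N: "\<And>k \<tau> z. f k 0 (\<tau>, z) \<le> z + N" by blast
    have pf: "profile p N (f k)" for k
    proof -
      obtain C where "profile p C (f k)" using ex by blast
      then show ?thesis
      proof (rule profile_rebound)
        show "\<bar>f k 0 (\<tau>, z) - z\<bar> \<le> N" for \<tau> z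
          using N[of k \<tau> z] h_le[of 0 "(\<tau>, z)" k] by (simp add: h_def linear_profile_def)
      qed
    qed
    from profile_mono_limit[where e=f, OF pf assms inc] obtain e'
      where e': "profile p N e'" and lim: "\<And>j x. (\<lambda>k. f k j x) \<longlonglongrightarrow> e' j x" by blast
    have "step lam l e' j x \<le> e' j x" for j x
    proof (rule LIMSEQ_le)
      show "(\<lambda>k. step lam l (f k) j x) \<longlonglongrightarrow> step lam l e' j x"
        by (rule step_tendsto[where e=f, OF pf e' assms lim])
      show "(\<lambda>k. f (Suc k) j x) \<longlonglongrightarrow> e' j x"
        using lim by (rule LIMSEQ_Suc)
    qed (auto simp: fS S_def)
    then show ?thesis using e' unfolding super_profile_def by blast
  next
    case False
    define H where "H = harnack_const p lam l"
    have H0: "H \<ge> 0" using step_bound_nonneg[OF assms] assms by (simp add: H_def harnack_const_def)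
    \<comment> \<open>\<open>profile_oscillation\<close> costs \<open>1 + 2 * p\<close> in passing
      to \<open>z = 0\<close>, so \<open>M > H + 1\<close> follows. Then even the near-maximum
      \<open>M - 1\<close> lies above the linear profile, and at that time the maximum in
      \<open>S\<close> is realized by \<open>step\<close>.\<close>
    obtain k \<tau> z where big: "f k 0 (\<tau>, z) > z + (H + 3 + 2 * p)"
      using False by (meson linorder_not_le)
    have "k \<noteq> 0"
    proof
      assume "k = 0"
      then show False using big H0 assms by (simp add: f0 h_def linear_profile_def)
    qed
    then obtain i where k: "k = Suc i" by (cases k) auto
    obtain C where fk: "profile p C (f k)" using ex by blast
    obtain C' where fi: "profile p C' (f i)" using ex by blast
    obtain M \<tau>' where M: "\<And>t. f k 0 (t, 0) \<le> M" and \<tau>': "f k 0 (\<tau>', 0) \<ge> M - 1"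
      using Sup_time[OF fk] by blast
    have M_big: "M > H + 1"
      using profile_oscillation[OF fk assms, of 0 \<tau> z] M[of \<tau>] big by simp
    then have "f k 0 (\<tau>', 0) > h 0 (\<tau>', 0)"
      using \<tau>' H0 by (simp add: h_def linear_profile_def)
    then have "step lam l (f i) 0 (\<tau>', 0) \<ge> M - 1"
      using \<tau>' unfolding k fS S_def by (auto simp: max_def split: if_splits)
    moreover have "f i 0 (t, 0) \<le> M" for t
      using inc[of i 0 "(t, 0)"] M[of t] k by simp
    ultimately have "\<bar>step lam l (f i) j (\<tau>, z) - z - p / n * j - M\<bar> \<le> H" for j \<tau> z
      unfolding H_def by (intro harnack[OF fi assms])
    then have "h j (\<tau>, z) \<le> step lam l (f i) j (\<tau>, z)" for j \<tau> z
      using M_big by (simp add: h_def linear_profile_def abs_le_iff) smt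
    then have "f k j x = step lam l (f i) j x" for j x
      unfolding k fS S_def by (cases x) (simp add: max_def)
    then have "f k j x \<le> step lam l (f k) j x" for j x
      using step_f_mono[of i k j x] inc[of i] k by simp
    then show ?thesis using fk unfolding sub_profile_def by blast
  qed
qed

text \<open>On the lines \<open>z = lam * \<tau>\<close> and \<open>z = lam' * \<tau>\<close> both
  profiles become trajectories of the same system up to \<open>l\<close> and \<open>l'\<close>, and
  the speeds appear as growth rates in time.\<close>

lemma speed_le:
  assumes "sub_profile p l lam e" "super_profile p l' lam' f" "l \<le> l'" "p \<ge> 0"
  shows "lam \<le> lam'"
proof -
  from assms(1) obtain C where e: "profile p C e" and sub: "\<And>j x. e j x \<le> step lam l e j x"
    by (auto simp: sub_profile_def)
  from assms(2) obtain C' where f: "profile p C' f" and sup: "\<And>j x. step lam' l' f j x \<le> f j x"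
    by (auto simp: super_profile_def)
  have line: "step lam l e j (\<tau>, lam * \<tau>) 
      = relax \<alpha> (relax \<alpha> (\<lambda>t. G j t (\<lambda>i. e (j + i) (t, lam * t)) + l)) \<tau>" for lam l e j \<tau>
    unfolding step_def using advect_line[of lam _ _ 0] by (simp add: react_def)
  show ?thesis
  proof (rule speed_comparison[where U="\<lambda>j \<tau>. e j (\<tau>, lam * \<tau>)" and V="\<lambda>j \<tau>. f j (\<tau>, lam' * \<tau>)"
        and q="p / n" and C="C + 2 * p" and C'="C' + 2 * p" and l=l and l'=l'])
    show "(\<lambda>\<tau>. e j (\<tau>, lam * \<tau>)) \<in> borel_measurable borel" for j
      using linear_growth_profile[OF e assms(4), of j lam 0] by (simp add: linear_growth_def)
    show "(\<lambda>\<tau>. f j (\<tau>, lam' * \<tau>)) \<in> borel_measurable borel" for j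
      using linear_growth_profile[OF f assms(4), of j lam' 0] by (simp add: linear_growth_def)
    show "\<bar>e j (\<tau>, lam * \<tau>) - lam * \<tau> - p / n * j\<bar> \<le> C + 2 * p" for j \<tau>
      by (rule profile_bound[OF e assms(4)])
    show "\<bar>f j (\<tau>, lam' * \<tau>) - lam' * \<tau> - p / n * j\<bar> \<le> C' + 2 * p" for j \<tau>
      by (rule profile_bound[OF f assms(4)])
  qed (use sub sup line assms(3) in metis)+
qed

lemma advect_linear_profile:
  "advect lam (\<lambda>x. linear_profile p j x + c) x = linear_profile p j x + (c - lam / \<alpha>)"
proof (cases x)
  case (Pair \<tau> z)
  have "advect lam (\<lambda>x. linear_profile p j x + c) (\<tau>, z) = relax \<alpha> (\<lambda>t. (z - lam * \<tau> + p / n * j + c) + lam * t) \<tau>"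
    unfolding advect_eq_relax linear_profile_def by (simp add: algebra_simps)
  then show ?thesis unfolding relax_affine[OF \<alpha>_pos] Pair by (simp add: linear_profile_def)
qed

text \<open>On the linear profile, \<open>react\<close> adds at least
  \<open>c = l - (B + K * window_width p)\<close> and each average subtracts
  \<open>lam / \<alpha>\<close>. The speed is the one at which these contributions cancel.\<close>

lemma sub_profile_linear:
  fixes p l :: real
  assumes "p \<ge> 0"
  defines "lam \<equiv> \<alpha> / 2 * (l - (B + K * window_width p))"
  shows "sub_profile p l lam (linear_profile p)"
  unfolding sub_profile_def
proof (intro conjI allI exI)
  note lin = profile_linear[OF assms(1)]
  show "profile p 0 (linear_profile p)" by (rule lin)
  define c where "c = l - (B + K * window_width p)"
  have r: "linear_profile p j x + c \<le> react l (linear_profile p) j x" for j x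
  proof -
    have "\<bar>react 0 (linear_profile p) j x - linear_profile p j x\<bar> \<le> B + K * window_width p"
      using react_close[OF lin assms(1), of 0 j x] by simp
    then show ?thesis unfolding react_def c_def by linarith
  qed
  note pc = profile_add_const[OF lin, of c] and pr = profile_react[OF lin assms(1), of l]
  have "linear_profile p j x + (c - lam / \<alpha>) \<le> advect lam (react l (linear_profile p) j) x" for j x
    using advect_mono[OF pc pr assms(1,1) r, where lam=lam and x=x] unfolding advect_linear_profile by simp
  from advect_mono[OF profile_add_const[OF lin] profile_advect[OF pr assms(1)] assms(1,1) this, where lam=lam]
  have "linear_profile p j x + (c - lam / \<alpha> - lam / \<alpha>) \<le> step lam l (linear_profile p) j x" for j x
    unfolding advect_linear_profile step_def .
  moreover have "c - lam / \<alpha> - lam / \<alpha> = 0" using \<alpha>_pos by (simp add: lam_def c_def)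
  ultimately show "linear_profile p j x \<le> step lam l (linear_profile p) j x" for j x by simp
qed

end

subsection \<open>Reflection, closedness and existence of the speed\<close>

text \<open>Conjugation by the sign change of all values. Indices are reversed as well, so that
  profiles stay non-decreasing in \<open>j\<close>; the direction of time is kept.\<close>

definition reflect_G :: "(int \<Rightarrow> real \<Rightarrow> (int \<Rightarrow> real) \<Rightarrow> real) \<Rightarrow> int \<Rightarrow> real \<Rightarrow> (int \<Rightarrow> real) \<Rightarrow> real" where
  "reflect_G G j \<tau> V = - G (- j) \<tau> (\<lambda>i. - V (- i))"

definition reflect :: "(int \<Rightarrow> real \<times> real \<Rightarrow> real) \<Rightarrow> int \<Rightarrow> real \<times> real \<Rightarrow> real" where
  "reflect e j x = - e (- j) (fst x, - snd x)"

lemma reflect_reflect [simp]: "reflect (reflect e) = e"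
  by (simp add: reflect_def fun_eq_iff)

context cooperative
begin

text \<open>Together with \<open>super_profile_iff_reflect\<close> this turns results on
  sub-profiles into results on super-profiles, with \<open>l\<close> and \<open>lam\<close> changing
  sign.\<close>

lemma cooperative_reflect: "cooperative n m \<alpha> K B P (reflect_G G)"
proof
  fix j :: int and \<tau> :: real and V W :: "int \<Rightarrow> real" and k :: int and w s :: real
  show "reflect_G G j \<tau> V \<le> reflect_G G j \<tau> W" if "\<And>i. i \<in> {- int m..int m} \<Longrightarrow> V i \<le> W i"
    unfolding reflect_G_def by (auto intro!: G_mono that)
  show "reflect_G G j \<tau> (\<lambda>i. V i + of_int k) = reflect_G G j \<tau> V + of_int k"
    using G_shift[of "- j" \<tau> "\<lambda>i. - V (- i)" "- k"] by (simp add: reflect_G_def)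
  show "reflect_G G j \<tau> (\<lambda>i. V i + w) \<le> reflect_G G j \<tau> V + K * w" if "w \<ge> 0"
    using G_lipschitz[OF that, of "- j" \<tau> "\<lambda>i. - V (- i) - w"] by (simp add: reflect_G_def)
  show "continuous_on UNIV (\<lambda>(\<tau>, V). reflect_G G j \<tau> V)"
  proof -
    have "continuous_on UNIV (\<lambda>x :: real \<times> (int \<Rightarrow> real). (fst x, \<lambda>i. - snd x (- i)))"
    proof (rule continuous_on_Pair[OF continuous_on_fst[OF continuous_on_id]],
        rule continuous_on_coordinatewise_then_product, rule continuous_on_minus)
      fix i :: int
      have c: "continuous_on UNIV (\<lambda>V :: int \<Rightarrow> real. V (- i))"
        by (rule continuous_on_product_coordinates)
      show "continuous_on UNIV (\<lambda>x :: real \<times> (int \<Rightarrow> real). snd x (- i))"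
        by (rule continuous_on_compose2[OF c continuous_on_snd[OF continuous_on_id]]) simp
    qed
    from continuous_on_compose2[OF G_continuous this, of "- j"]
    have "continuous_on UNIV (\<lambda>x. - G (- j) (fst x) (\<lambda>i. - snd x (- i)))"
      by (intro continuous_on_minus) simp
    then show ?thesis by (simp add: reflect_G_def case_prod_beta')
  qed
  show "reflect_G G j (\<tau> + s) = reflect_G G j \<tau>" if "s \<in> P"
    by (rule ext) (simp add: reflect_G_def G_period[OF that])
  show "reflect_G G (j + int n) = reflect_G G j"
    using G_index[of "- j - int n"] by (simp add: reflect_G_def fun_eq_iff)
  show "reflect_G G j \<tau> V \<le> reflect_G G (j + 1) \<tau> (\<lambda>i. V (i + 1))" if V: "\<And>i. V i \<le> V (i + 1)"
  proof -
    have "V (- i) \<le> V (1 - i)" for i using V[of "- i"] by simp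
    then show ?thesis
      using G_next[of "\<lambda>i. - V (1 - i)" "- j - 1" \<tau>] by (simp add: reflect_G_def)
  qed
  show "\<bar>reflect_G G j \<tau> V - V 0\<bar> \<le> B + K * w" if V: "\<And>i. i \<in> {- int m..int m} \<Longrightarrow> \<bar>V i - V 0\<bar> \<le> w"
  proof -
    have "\<bar>- V (- i) - - V (- 0)\<bar> \<le> w" if "i \<in> {- int m..int m}" for i
      using V[of "- i"] that by (simp add: abs_minus_commute)
    from G_bound[of "\<lambda>i. - V (- i)", OF this, of "- j" \<tau>] show ?thesis
      by (simp add: reflect_G_def abs_minus_commute)
  qed
qed (use n_pos \<alpha>_pos period_1 K_nonneg B_nonneg in auto)

lemma profile_reflect:
  assumes "profile p C e"
  shows "profile p C (reflect e)"
proof -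
  note D = profileD[OF assms]
  have "reflect e j \<in> borel_measurable borel" for j
  proof -
    have [measurable]: "e (- j) \<in> borel_measurable (borel \<Otimes>\<^sub>M borel)" using D(1) by (simp add: borel_prod)
    have "(\<lambda>x. - e (- j) (fst x, - snd x)) \<in> borel_measurable (borel \<Otimes>\<^sub>M borel)" by measurable
    then show ?thesis by (simp add: reflect_def[abs_def] borel_prod)
  qed
  moreover have "reflect e j (\<tau>, z + 1) = reflect e j (\<tau>, z) + 1" for j \<tau> z
    using D(3)[of "- j" \<tau> "- z - 1"] by (simp add: reflect_def)
  moreover have "reflect e (j + int n) (\<tau>, z) = reflect e j (\<tau>, z + p)" for j \<tau> z
    using D(4)[of "- j - int n" \<tau> "- z - p"] by (simp add: reflect_def)
  moreover have "reflect e j (\<tau>, z) \<le> reflect e (j + 1) (\<tau>, z)" for j \<tau> z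
    using D(5)[of "- j - 1" \<tau> "- z"] by (simp add: reflect_def)
  moreover have "\<bar>reflect e 0 (\<tau>, z) - z\<bar> \<le> C" for \<tau> z
    using D(7)[of \<tau> "- z"] by (simp add: reflect_def abs_le_iff)
  ultimately show ?thesis
    unfolding profile_def using D(2,6) by (auto simp: reflect_def)
qed

lemma advect_reflect: "advect (- lam) (reflect e j) = reflect (\<lambda>i. advect lam (e i)) j"
  unfolding advect_def reflect_def by (simp add: fun_eq_iff)

lemma step_reflect:
  "cooperative.step \<alpha> (reflect_G G) (- lam) (- l) (reflect e) = reflect (step lam l e)"
proof -
  interpret R: cooperative n m \<alpha> K B P "reflect_G G" by (rule cooperative_reflect)
  have r: "R.react (- l) (reflect e) = reflect (react l e)"
  proof (intro ext)
    fix j and x :: "real \<times> real"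
    have "- (j + - i) = - j + i" for i :: int by simp
    then show "R.react (- l) (reflect e) j x = reflect (react l e) j x"
      by (simp only: R.react_def) (simp add: react_def reflect_def reflect_G_def)
  qed
  show ?thesis
  proof
    fix j
    have "R.step (- lam) (- l) (reflect e) j = advect (- lam) (advect (- lam) (reflect (react l e) j))"
      by (simp only: R.step_def r)
    also have "advect (- lam) (reflect (react l e) j) = reflect (\<lambda>i. advect lam (react l e i)) j"
      by (rule advect_reflect)
    also have "advect (- lam) (reflect (\<lambda>i. advect lam (react l e i)) j) = reflect (\<lambda>i. advect lam (advect lam (react l e i))) j"
      by (rule advect_reflect)
    also have "(\<lambda>i. advect lam (advect lam (react l e i))) = step lam l e"
      by (rule ext) (simp only: step_def)
    finally show "R.step (- lam) (- l) (reflect e) j = reflect (step lam l e) j" .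
  qed
qed

lemma super_profile_iff_reflect:
  "super_profile p l lam e \<longleftrightarrow>
    cooperative.sub_profile n \<alpha> P (reflect_G G) p (- l) (- lam) (reflect e)"
proof -
  interpret R: cooperative n m \<alpha> K B P "reflect_G G" by (rule cooperative_reflect)
  have prof: "(\<exists>C. profile p C e) \<longleftrightarrow> (\<exists>C. profile p C (reflect e))"
    by (metis profile_reflect reflect_reflect)
  have iff: "(\<forall>j x. step lam l e j x \<le> e j x) \<longleftrightarrow> (\<forall>j x. reflect e j x \<le> reflect (step lam l e) j x)"
  proof
    assume L: "\<forall>j x. step lam l e j x \<le> e j x"
    show "\<forall>j x. reflect e j x \<le> reflect (step lam l e) j x"
      using L by (simp add: reflect_def)
  next
    assume R: "\<forall>j x. reflect e j x \<le> reflect (step lam l e) j x"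
    show "\<forall>j x. step lam l e j x \<le> e j x"
    proof (intro allI)
      fix j and x :: "real \<times> real"
      show "step lam l e j x \<le> e j x"
        using R[rule_format, of "- j" "(fst x, - snd x)"] by (simp add: reflect_def)
    qed
  qed
  show ?thesis
    unfolding super_profile_def R.sub_profile_def prof step_reflect iff ..
qed

text \<open>The upper limit along the sequence, relaxed to the right in \<open>z\<close>: for functions that are
  monotone in \<open>z\<close> it absorbs perturbations of \<open>z\<close> that tend to \<open>0\<close>.\<close>

definition tail_sup :: "(nat \<Rightarrow> real \<times> real \<Rightarrow> real) \<Rightarrow> nat \<Rightarrow> real \<times> real \<Rightarrow> real" where
  "tail_sup f r x = (SUP k\<in>{r..}. f k (fst x, snd x + 1 / (Suc r)))"

definition upper_limit :: "(nat \<Rightarrow> real \<times> real \<Rightarrow> real) \<Rightarrow> real \<times> real \<Rightarrow> real" where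
  "upper_limit f x = (INF r. tail_sup f r x)"

text \<open>The uniform bound makes the suprema and infima in \<open>upper_limit\<close> finite.
  Monotonicity in \<open>z\<close> makes \<open>tail_sup\<close> decrease in \<open>r\<close>, so
  that the infimum is a limit and stays measurable.\<close>

definition tame :: "(nat \<Rightarrow> real \<times> real \<Rightarrow> real) \<Rightarrow> bool" where
  "tame f \<longleftrightarrow> (\<forall>k. f k \<in> borel_measurable borel) \<and>
    (\<forall>k \<tau> z z'. z \<le> z' \<longrightarrow> f k (\<tau>, z) \<le> f k (\<tau>, z')) \<and> (\<exists>c. \<forall>k \<tau> z. \<bar>f k (\<tau>, z) - z\<bar> \<le> c)"

lemma tameE:
  assumes "tame f"
  obtains c where "c \<ge> 0" "\<And>k \<tau> z. \<bar>f k (\<tau>, z) - z\<bar> \<le> c"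
  using assms unfolding tame_def by (metis abs_ge_zero order_trans)

lemma tame_bdd:
  assumes "tame f" "\<And>k. k \<ge> r \<Longrightarrow> \<bar>b k\<bar> \<le> c"
  shows "bdd_above ((\<lambda>k. f k (\<tau>, b k)) ` {r..})"
proof -
  obtain d where d: "\<And>k \<tau> z. \<bar>f k (\<tau>, z) - z\<bar> \<le> d" using tameE[OF assms(1)] by metis
  show ?thesis
  proof (rule bdd_aboveI2)
    fix k assume "k \<in> {r..}"
    then show "f k (\<tau>, b k) \<le> c + d" using d[of k \<tau> "b k"] assms(2)[of k] by auto
  qed
qed

lemma tame_bdd_const: "tame f \<Longrightarrow> bdd_above ((\<lambda>k. f k (\<tau>, b)) ` {r..})"
  by (rule tame_bdd[where c="\<bar>b\<bar>"]) auto

lemma tail_sup_upper: "tame f \<Longrightarrow> k \<ge> r \<Longrightarrow> f k (\<tau>, z + 1 / (Suc r)) \<le> tail_sup f r (\<tau>, z)"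
  unfolding tail_sup_def fst_conv snd_conv by (rule cSUP_upper[OF _ tame_bdd_const]) auto

lemma tail_sup_least:
  "(\<And>k. k \<ge> r \<Longrightarrow> f k (\<tau>, z + 1 / (Suc r)) \<le> a) \<Longrightarrow> tail_sup f r (\<tau>, z) \<le> a"
  unfolding tail_sup_def fst_conv snd_conv by (rule cSUP_least) auto

lemma tame_mono: "tame f \<Longrightarrow> z \<le> z' \<Longrightarrow> f k (\<tau>, z) \<le> f k (\<tau>, z')"
  unfolding tame_def by blast

lemma tail_sup_decseq:
  assumes "tame f"
  shows "decseq (\<lambda>r. tail_sup f r x)"
proof (cases x)
  case (Pair \<tau> z)
  have "tail_sup f r' (\<tau>, z) \<le> tail_sup f r (\<tau>, z)" if "r \<le> r'" for r r'
  proof (rule tail_sup_least)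
    fix k assume "k \<ge> r'"
    have "f k (\<tau>, z + 1 / (Suc r')) \<le> f k (\<tau>, z + 1 / (Suc r))"
      using that by (intro tame_mono[OF assms]) (auto simp: frac_le)
    also have "\<dots> \<le> tail_sup f r (\<tau>, z)" 
      using \<open>k \<ge> r'\<close> that by (intro tail_sup_upper[OF assms]) auto
    finally show "f k (\<tau>, z + 1 / (Suc r')) \<le> tail_sup f r (\<tau>, z)" .
  qed
  then show ?thesis unfolding Pair decseq_def by blast
qed

lemma tail_sup_bounds:
  assumes "tame f" "\<And>k \<tau> z. \<bar>f k (\<tau>, z) - z\<bar> \<le> c"
  shows "z - c \<le> tail_sup f r (\<tau>, z)" "tail_sup f r (\<tau>, z) \<le> z + (c + 1)"
proof -
  have one: "1 / real (Suc r) \<ge> 0" "1 / real (Suc r) \<le> 1" by auto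
  show "tail_sup f r (\<tau>, z) \<le> z + (c + 1)"
  proof (rule tail_sup_least)
    show "f k (\<tau>, z + 1 / (Suc r)) \<le> z + (c + 1)" for k
      using assms(2)[of k \<tau> "z + 1 / (Suc r)"] one by linarith
  qed
  show "z - c \<le> tail_sup f r (\<tau>, z)"
    using tail_sup_upper[OF assms(1), of r r \<tau> z] assms(2)[of r \<tau> "z + 1 / (Suc r)"] one
    by linarith
qed

lemma tail_sup_bdd: "tame f \<Longrightarrow> bdd_below (range (\<lambda>r. tail_sup f r x))"
  by (cases x) (metis tameE tail_sup_bounds(1) bdd_belowI2)

lemma tail_sup_tendsto: "tame f \<Longrightarrow> (\<lambda>r. tail_sup f r x) \<longlonglongrightarrow> upper_limit f x"
  unfolding upper_limit_def by (intro LIMSEQ_decseq_INF tail_sup_bdd tail_sup_decseq)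

lemma upper_limit_le_tail_sup: "tame f \<Longrightarrow> upper_limit f x \<le> tail_sup f r x"
  unfolding upper_limit_def by (intro cINF_lower tail_sup_bdd) auto

lemma upper_limit_bounds:
  assumes "tame f" "\<And>k \<tau> z. \<bar>f k (\<tau>, z) - z\<bar> \<le> c"
  shows "\<bar>upper_limit f (\<tau>, z) - z\<bar> \<le> c + 1"
proof -
  have "z - c \<le> upper_limit f (\<tau>, z)"
    unfolding upper_limit_def by (intro cINF_greatest tail_sup_bounds assms) auto
  moreover have "upper_limit f (\<tau>, z) \<le> z + (c + 1)"
    using upper_limit_le_tail_sup[OF assms(1)] tail_sup_bounds(2)[OF assms] order_trans by blast
  ultimately show ?thesis by linarith
qed

lemma upper_limit_bounded:
  assumes "tame f"
  shows "\<exists>c. \<forall>\<tau> z. \<bar>upper_limit f (\<tau>, z) - z\<bar> \<le> c"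
proof -
  obtain c where "\<And>k \<tau> z. \<bar>f k (\<tau>, z) - z\<bar> \<le> c" using tameE[OF assms] by metis
  then have "\<bar>upper_limit f (\<tau>, z) - z\<bar> \<le> c + 1" for \<tau> z by (rule upper_limit_bounds[OF assms])
  then show ?thesis by blast
qed

lemma advect_mono_bounded:
  assumes "f \<in> borel_measurable borel" "g \<in> borel_measurable borel"
    and f: "\<And>\<tau> z. \<bar>f (\<tau>, z) - z\<bar> \<le> cf" and g: "\<And>\<tau> z. \<bar>g (\<tau>, z) - z\<bar> \<le> cg" and le: "\<And>x. f x \<le> g x"
  shows "advect lam f x \<le> advect lam g x"
proof (cases x)
  case (Pair \<tau> z)
  have "linear_growth (\<lambda>t. f (t, lam * t + (z - lam * \<tau>)))" "linear_growth (\<lambda>t. g (t, lam * t + (z - lam * \<tau>)))"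
    using linear_growth_line[OF assms(1) f] linear_growth_line[OF assms(2) g] by blast+
  from relax_mono[OF \<alpha>_pos this le]
  have "advect lam f (\<tau>, lam * \<tau> + (z - lam * \<tau>)) \<le> advect lam g (\<tau>, lam * \<tau> + (z - lam * \<tau>))"
    unfolding advect_line .
  then show ?thesis unfolding Pair by simp
qed

lemma tail_sup_measurable:
  assumes "tame f"
  shows "tail_sup f r \<in> borel_measurable borel"
proof -
  have [measurable]: "f k \<in> borel_measurable (borel \<Otimes>\<^sub>M borel)" for k
    using assms by (simp add: tame_def borel_prod)
  have "(\<lambda>x. SUP k\<in>{r..}. f k (fst x, snd x + 1 / (Suc r))) \<in> borel_measurable (borel \<Otimes>\<^sub>M borel)"
    by (rule borel_measurable_cSUP) (auto intro: tame_bdd_const[OF assms])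
  then show ?thesis by (simp add: tail_sup_def[abs_def] borel_prod)
qed

lemma upper_limit_measurable: "tame f \<Longrightarrow> upper_limit f \<in> borel_measurable borel"
  by (rule borel_measurable_LIMSEQ_real[OF tail_sup_tendsto tail_sup_measurable])

text \<open>The left side may use a later tail \<open>r'\<close> and therefore a smaller right shift
  than the right side. The difference of the two shifts is the room in which vanishing perturbations
  of \<open>z\<close> are absorbed.\<close>

lemma upper_limit_le:
  assumes "tame f" "tame g"
    and le: "\<And>r. \<exists>r'\<ge>r. \<forall>k\<ge>r'. f k (\<tau>, z + 1 / (Suc r')) \<le> g k (\<tau>, z' + 1 / (Suc r)) + c"
  shows "upper_limit f (\<tau>, z) \<le> upper_limit g (\<tau>, z') + c"
proof -
  have "upper_limit f (\<tau>, z) - c \<le> tail_sup g r (\<tau>, z')" for r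
  proof -
    obtain r' where r': "r' \<ge> r" "\<And>k. k \<ge> r' \<Longrightarrow> f k (\<tau>, z + 1 / (Suc r')) \<le> g k (\<tau>, z' + 1 / (Suc r)) + c"
      using le by blast
    have "tail_sup f r' (\<tau>, z) \<le> tail_sup g r (\<tau>, z') + c"
    proof (rule tail_sup_least)
      fix k assume "k \<ge> r'"
      then show "f k (\<tau>, z + 1 / (Suc r')) \<le> tail_sup g r (\<tau>, z') + c"
        using r'(2)[of k] tail_sup_upper[OF assms(2), of r k \<tau> z'] r'(1) by simp
    qed
    then show ?thesis using upper_limit_le_tail_sup[OF assms(1), of "(\<tau>, z)" r'] by simp
  qed
  then have "upper_limit f (\<tau>, z) - c \<le> upper_limit g (\<tau>, z')"
    unfolding upper_limit_def[of g] by (intro cINF_greatest) auto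
  then show ?thesis by simp
qed

lemma upper_limit_mono:
  assumes "tame f" "tame g" "\<And>k x. f k x \<le> g k x"
  shows "upper_limit f x \<le> upper_limit g x"
  by (cases x) (use upper_limit_le[OF assms(1,2), of "fst x" "snd x" "snd x" 0] assms(3) in auto)

text \<open>Any \<open>r' \<ge> 2 * r + 1\<close> has
  \<open>1 / (Suc r') \<le> 1 / (Suc r) / 2\<close>, which leaves the other half for
  \<open>a k\<close>.\<close>

lemma eventually_gap:
  assumes "a \<longlonglongrightarrow> (0 :: real)"
  obtains r' where "r' \<ge> r" "\<And>k. k \<ge> r' \<Longrightarrow> 1 / (Suc r') + a k \<le> 1 / (Suc r)"
proof -
  have "1 / real (Suc r) / 2 > 0" by simp
  then have "\<forall>\<^sub>F k in sequentially. a k < 1 / real (Suc r) / 2"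
    using order_tendstoD(2)[OF assms] by blast
  then obtain N where N: "\<And>k. k \<ge> N \<Longrightarrow> a k < 1 / real (Suc r) / 2"
    by (auto simp: eventually_sequentially)
  show ?thesis
  proof (rule that)
    fix k assume k: "k \<ge> max N (2 * r + 1)"
    have "1 / real (Suc (max N (2 * r + 1))) \<le> 1 / real (Suc (2 * r + 1))"
      by (intro frac_le) auto
    also have "\<dots> = 1 / real (Suc r) / 2" by (simp add: field_simps)
    finally show "1 / (Suc (max N (2 * r + 1))) + a k \<le> 1 / (Suc r)" using N[of k] k by linarith
  qed auto
qed

text \<open>A reverse Fatou inequality with moving characteristics. The suprema \<open>q r\<close>
  over tails dominate the integrands, decrease in \<open>r\<close> and share an integrable bound, so
  dominated convergence brings the infimum under the integral.\<close>

lemma upper_limit_advect: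
  assumes f: "tame f" and lam: "lams \<longlonglongrightarrow> lam" and af: "tame (\<lambda>k. advect (lams k) (f k))"
  shows "upper_limit (\<lambda>k. advect (lams k) (f k)) x \<le> advect lam (upper_limit f) x"
proof (cases x)
  case (Pair \<tau> z)
  obtain c where c: "c \<ge> 0" "\<And>k \<tau> z. \<bar>f k (\<tau>, z) - z\<bar> \<le> c" using tameE[OF f] by metis
  have "Bseq lams" using lam by (intro convergent_imp_Bseq) (auto simp: convergent_def)
  then obtain \<Lambda> where \<Lambda>: "\<And>k. \<bar>lams k\<bar> \<le> \<Lambda>" by (auto simp: Bseq_def)
  have [measurable]: "f k \<in> borel_measurable (borel \<Otimes>\<^sub>M borel)" "upper_limit f \<in> borel_measurable (borel \<Otimes>\<^sub>M borel)" for k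
    using f upper_limit_measurable[OF f] by (simp_all add: tame_def borel_prod)
  \<comment> \<open>The position, \<open>s\<close> units of time back, on the characteristic of
    slope \<open>lams k\<close> through the point shifted to the right by
    \<open>1 / (Suc r)\<close>.\<close>
  define b where "b r k s = z + 1 / (Suc r) - lams k * s" for r k s
  define q where "q r s = (SUP k\<in>{r..}. f k (\<tau> - s, b r k s))" for r s
  have babs: "\<bar>b r k s - z\<bar> \<le> 1 + \<Lambda> * \<bar>s\<bar>" for r k s
  proof -
    have "\<bar>lams k * s\<bar> \<le> \<Lambda> * \<bar>s\<bar>" unfolding abs_mult using \<Lambda> by (intro mult_right_mono) auto
    moreover have "0 \<le> 1 / real (Suc r)" "1 / real (Suc r) \<le> 1" by auto
    ultimately show ?thesis unfolding b_def by linarith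
  qed
  have bdd: "bdd_above ((\<lambda>k. f k (\<tau> - s, b r' k s)) ` {r..})" for r r' s
    by (rule tame_bdd[OF f, where c="\<bar>z\<bar> + 1 + \<Lambda> * \<bar>s\<bar>"]) (use babs[of r' _ s] in \<open>simp add: abs_le_iff, smt\<close>)
  have q_upper: "f k (\<tau> - s, b r k s) \<le> q r s" if "k \<ge> r" for r k s
    unfolding q_def by (rule cSUP_upper[OF _ bdd]) (use that in auto)
  have q_meas [measurable]: "q r \<in> borel_measurable borel" for r
    unfolding q_def b_def by (rule borel_measurable_cSUP) (use bdd[unfolded b_def] in \<open>auto\<close>)
  have q_le: "q r s \<le> z + 1 + \<Lambda> * \<bar>s\<bar> + c" for r s
    unfolding q_def
  proof (rule cSUP_least)
    show "f k (\<tau> - s, b r k s) \<le> z + 1 + \<Lambda> * \<bar>s\<bar> + c" for k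
      using c(2)[of k "\<tau> - s" "b r k s"] babs[of r k s] by linarith
  qed auto
  have q_ge: "z - 1 - \<Lambda> * \<bar>s\<bar> - c \<le> q r s" for r s
    using q_upper[of r r s] c(2)[of r "\<tau> - s" "b r r s"] babs[of r r s] by linarith
  have q_abs: "\<bar>q r s\<bar> \<le> (\<bar>z\<bar> + 1 + c) + \<Lambda> * s" if "s \<ge> 0" for r s
    using q_le[of r s] q_ge[of s r] unfolding abs_of_nonneg[OF that] by linarith
  have q_dec: "decseq (\<lambda>r. q r s)" for s
  proof (rule decseq_SucI)
    show "q (Suc r) s \<le> q r s" for r
    proof -
      have "f k (\<tau> - s, b (Suc r) k s) \<le> q r s" if "k \<ge> Suc r" for k
      proof -
        have "f k (\<tau> - s, b (Suc r) k s) \<le> f k (\<tau> - s, b r k s)"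
          unfolding b_def by (intro tame_mono[OF f]) (auto simp: frac_le)
        then show ?thesis using q_upper[of r k s] that by simp
      qed
      then show ?thesis unfolding q_def[of "Suc r"] by (intro cSUP_least) auto
    qed
  qed
  define q' where "q' s = (INF r. q r s)" for s
  have q_lim: "(\<lambda>r. q r s) \<longlonglongrightarrow> q' s" for s
    unfolding q'_def by (intro LIMSEQ_decseq_INF q_dec bdd_belowI2[OF q_ge])
  have q'_meas [measurable]: "q' \<in> borel_measurable borel"
    by (rule borel_measurable_LIMSEQ_real[OF q_lim q_meas])
  \<comment> \<open>For each fixed \<open>s\<close> the mismatch \<open>(lam - lams k) * s\<close>
    of the characteristics tends to 0 and fits into the gap between two right shifts. The index
    where this happens depends on \<open>s\<close>, so the limit in \<open>r\<close> is taken inside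
    the integral.\<close>
  have q'_le: "q' s \<le> upper_limit f (\<tau> - s, z - lam * s)" for s
  proof -
    have lim: "(\<lambda>k. (lam - lams k) * s) \<longlonglongrightarrow> 0"
      using tendsto_mult_right[OF tendsto_diff[OF tendsto_const[of lam] lam], of s] by simp
    have "q' s \<le> tail_sup f r (\<tau> - s, z - lam * s)" for r
    proof -
      obtain r' where r': "r' \<ge> r" "\<And>k. k \<ge> r' \<Longrightarrow> 1 / (Suc r') + (lam - lams k) * s \<le> 1 / (Suc r)"
        using eventually_gap[OF lim] by blast
      have "f k (\<tau> - s, b r' k s) \<le> tail_sup f r (\<tau> - s, z - lam * s)" if "k \<ge> r'" for k
      proof -
        have "f k (\<tau> - s, b r' k s) \<le> f k (\<tau> - s, z - lam * s + 1 / (Suc r))"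
          using r'(2)[OF that] unfolding b_def by (intro tame_mono[OF f]) (simp add: algebra_simps)
        also have "\<dots> \<le> tail_sup f r (\<tau> - s, z - lam * s)"
          using that r'(1) by (intro tail_sup_upper[OF f]) auto
        finally show ?thesis .
      qed
      then have "q r' s \<le> tail_sup f r (\<tau> - s, z - lam * s)"
        unfolding q_def by (intro cSUP_least) auto
      moreover have "q' s \<le> q r' s"
        unfolding q'_def by (intro cINF_lower bdd_belowI2[OF q_ge]) auto
      ultimately show ?thesis by simp
    qed
    then show ?thesis unfolding upper_limit_def by (intro cINF_greatest) auto
  qed
  have q'_abs: "\<bar>q' s\<bar> \<le> (\<bar>z\<bar> + 1 + c) + \<Lambda> * s" if "s \<ge> 0" for s
    by (rule tendsto_upperbound[OF tendsto_rabs[OF q_lim]]) (use q_abs[OF that] in auto)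
  have int_q: "integrable (expo \<alpha>) (q r)" for r
    by (rule integrable_expo[OF \<alpha>_pos q_meas q_abs])
  have "upper_limit (\<lambda>k. advect (lams k) (f k)) (\<tau>, z) \<le> (\<integral>s. q r s \<partial>expo \<alpha>)" for r
  proof -
    have "advect (lams k) (f k) (\<tau>, z + 1 / (Suc r)) \<le> (\<integral>s. q r s \<partial>expo \<alpha>)" if "k \<ge> r" for k
      unfolding advect_def fst_conv snd_conv
    proof (rule integral_expo_mono[OF _ int_q])
      show "integrable (expo \<alpha>) (\<lambda>s. f k (\<tau> - s, z + 1 / (Suc r) - lams k * s))"
      proof (rule integrable_expo[OF \<alpha>_pos, where a="\<bar>z\<bar> + 1 + c" and b=\<Lambda>])
        fix s :: real assume "s \<ge> 0"
        then show "\<bar>f k (\<tau> - s, z + 1 / (Suc r) - lams k * s)\<bar> \<le> \<bar>z\<bar> + 1 + c + \<Lambda> * s"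
          using c(2)[of k "\<tau> - s" "b r k s"] babs[of r k s] unfolding b_def by (simp add: abs_le_iff) smt
      qed measurable
      show "f k (\<tau> - s, z + 1 / (Suc r) - lams k * s) \<le> q r s" for s
        using q_upper[OF that, of s] unfolding b_def by simp
    qed
    then have "tail_sup (\<lambda>k. advect (lams k) (f k)) r (\<tau>, z) \<le> (\<integral>s. q r s \<partial>expo \<alpha>)"
      by (rule tail_sup_least)
    then show ?thesis using upper_limit_le_tail_sup[OF af] order_trans by blast
  qed
  moreover have "(\<lambda>r. \<integral>s. q r s \<partial>expo \<alpha>) \<longlonglongrightarrow> (\<integral>s. q' s \<partial>expo \<alpha>)"
  proof (rule integral_dominated_convergence)
    show "integrable (expo \<alpha>) (\<lambda>s. (\<bar>z\<bar> + 1 + c) + \<Lambda> * s)" by (rule integrable_expo_affine[OF \<alpha>_pos])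
    show "AE s in expo \<alpha>. norm (q r s) \<le> (\<bar>z\<bar> + 1 + c) + \<Lambda> * s" for r
      using AE_expo_nonneg by eventually_elim (use q_abs in auto)
  qed (auto intro: q_lim)
  ultimately have "upper_limit (\<lambda>k. advect (lams k) (f k)) (\<tau>, z) \<le> (\<integral>s. q' s \<partial>expo \<alpha>)"
    by (intro LIMSEQ_le_const) auto
  also have "\<dots> \<le> advect lam (upper_limit f) (\<tau>, z)"
    unfolding advect_def fst_conv snd_conv
  proof (rule integral_expo_mono)
    show "integrable (expo \<alpha>) q'" by (rule integrable_expo[OF \<alpha>_pos q'_meas q'_abs])
    show "integrable (expo \<alpha>) (\<lambda>s. upper_limit f (\<tau> - s, z - lam * s))"
    proof (rule integrable_expo[OF \<alpha>_pos, where a="\<bar>z\<bar> + 1 + c" and b="\<bar>lam\<bar>"])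
      fix s :: real assume "s \<ge> 0"
      then have "\<bar>lam * s\<bar> = \<bar>lam\<bar> * s" by (simp add: abs_mult)
      then show "\<bar>upper_limit f (\<tau> - s, z - lam * s)\<bar> \<le> \<bar>z\<bar> + 1 + c + \<bar>lam\<bar> * s"
        using upper_limit_bounds[OF f c(2), of "\<tau> - s" "z - lam * s"] by linarith
    qed measurable
  qed (rule q'_le)
  finally show ?thesis unfolding Pair .
qed

text \<open>Monotonicity of \<open>G\<close> brings the suprema over the tail inside; then
  \<open>r\<close> tends to infinity by \<open>react_tendsto\<close>. The \<open>\<epsilon>\<close>
  covers the variation of \<open>ls\<close>.\<close>

lemma upper_limit_react:
  assumes e: "\<And>j. tame (\<lambda>k. e k j)" and l: "ls \<longlonglongrightarrow> l" and re: "tame (\<lambda>k. react (ls k) (e k) j)"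
  shows "upper_limit (\<lambda>k. react (ls k) (e k) j) x \<le> react l (\<lambda>j. upper_limit (\<lambda>k. e k j)) j x"
proof (cases x)
  case (Pair \<tau> z)
  show ?thesis unfolding Pair
  proof (rule field_le_epsilon)
    fix \<epsilon> :: real assume "\<epsilon> > 0"
    then have "\<forall>\<^sub>F k in sequentially. ls k < l + \<epsilon>" using order_tendstoD(2)[OF l, of "l + \<epsilon>"] by simp
    then obtain N where N: "\<And>k. k \<ge> N \<Longrightarrow> ls k < l + \<epsilon>" by (auto simp: eventually_sequentially)
    have "upper_limit (\<lambda>k. react (ls k) (e k) j) (\<tau>, z) \<le> react l (\<lambda>j. tail_sup (\<lambda>k. e k j) r) j (\<tau>, z) + \<epsilon>"
      if "r \<ge> N" for r
    proof -
      have "tail_sup (\<lambda>k. react (ls k) (e k) j) r (\<tau>, z) \<le> react l (\<lambda>j. tail_sup (\<lambda>k. e k j) r) j (\<tau>, z) + \<epsilon>"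
      proof (rule tail_sup_least)
        fix k assume "k \<ge> r"
        then have "G j \<tau> (\<lambda>i. e k (j + i) (\<tau>, z + 1 / (Suc r))) \<le> G j \<tau> (\<lambda>i. tail_sup (\<lambda>k. e k (j + i)) r (\<tau>, z))"
          by (intro G_mono tail_sup_upper[OF e])
        moreover have "ls k < l + \<epsilon>" using N that \<open>k \<ge> r\<close> by simp
        ultimately show "react (ls k) (e k) j (\<tau>, z + 1 / (Suc r)) \<le> react l (\<lambda>j. tail_sup (\<lambda>k. e k j) r) j (\<tau>, z) + \<epsilon>"
          unfolding react_def by simp
      qed
      then show ?thesis using upper_limit_le_tail_sup[OF re] order_trans by blast
    qed
    moreover have "(\<lambda>r. react l (\<lambda>j. tail_sup (\<lambda>k. e k j) r) j (\<tau>, z) + \<epsilon>)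
        \<longlonglongrightarrow> react l (\<lambda>j. upper_limit (\<lambda>k. e k j)) j (\<tau>, z) + \<epsilon>"
      by (intro tendsto_add tendsto_const react_tendsto tail_sup_tendsto e)
    ultimately show "upper_limit (\<lambda>k. react (ls k) (e k) j) (\<tau>, z)
        \<le> react l (\<lambda>j. upper_limit (\<lambda>k. e k j)) j (\<tau>, z) + \<epsilon>"
      by (intro LIMSEQ_le_const) blast+
  qed
qed

lemma tame_profiles:
  assumes "\<And>k. profile (ps k) (cs k) (e k)" "\<And>k. ps k \<ge> 0" "\<And>k. ps k \<le> p" "\<And>k. cs k \<le> c"
  shows "tame (\<lambda>k. e k j)"
  unfolding tame_def
proof (intro conjI allI impI exI)
  fix k \<tau> z
  have "\<bar>ps k / n * j\<bar> \<le> p / n * \<bar>j\<bar>"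
    using assms(2,3)[of k] by (simp add: abs_mult mult_right_mono divide_right_mono)
  then show "\<bar>e k j (\<tau>, z) - z\<bar> \<le> c + 2 * p + p / n * \<bar>j\<bar>"
    using profile_bound[OF assms(1,2), of k j \<tau> z] assms(3)[of k] assms(4)[of k] by linarith
qed (use profileD[OF assms(1)] in auto)

text \<open>The constants of \<open>sub_profile_normalized\<close> depend continuously on
  \<open>(p, l, lam)\<close>, so the normalized sub-profiles are bounded uniformly in
  \<open>k\<close>. Their relaxed upper limit is compared through \<open>react\<close> and the two
  averages in turn, each comparison being an inequality in the direction required of a
  sub-profile.\<close>

lemma sub_profile_limit:
  assumes sub: "\<And>k. \<exists>e. sub_profile (ps k) (ls k) (lams k) e" and ps_pos: "\<And>k. ps k \<ge> 0"
    and ps: "ps \<longlonglongrightarrow> p" and ls: "ls \<longlonglongrightarrow> l" and lams: "lams \<longlonglongrightarrow> lam"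
  shows "\<exists>e. sub_profile p l lam e"
proof -
  have bounded: "\<exists>c. \<forall>k. a k \<le> c" if "a \<longlonglongrightarrow> b" for a :: "nat \<Rightarrow> real" and b
  proof -
    have "Bseq a" using that by (intro convergent_imp_Bseq) (auto simp: convergent_def)
    then show ?thesis by (auto simp: Bseq_def abs_le_iff)
  qed
  define h where "h k = harnack_const (ps k) (lams k) (ls k) + 1" for k
  define s where "s k = step_bound (ps k) (lams k) (ls k)" for k
  have s_lim: "s \<longlonglongrightarrow> step_bound p lam l"
    unfolding s_def step_bound_def window_width_def by (intro tendsto_intros ps ls lams) (use \<alpha>_pos in simp)
  have h_lim: "h \<longlonglongrightarrow> harnack_const p lam l + 1"
    unfolding h_def harnack_const_def s_def[symmetric] by (intro tendsto_intros ps s_lim)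
  obtain \<pi> where \<pi>: "\<And>k. ps k \<le> \<pi>" using bounded[OF ps] by blast
  obtain c where c: "\<And>k. h k \<le> c" using bounded[OF h_lim] by blast
  obtain d where d: "\<And>k. s k \<le> d" using bounded[OF s_lim] by blast
  have "\<forall>k. \<exists>e. profile (ps k) (h k) e \<and> (\<forall>j x. e j x \<le> step (lams k) (ls k) e j x)"
    using sub sub_profile_normalized[OF _ ps_pos] unfolding h_def by blast
  then obtain e where e: "\<And>k. profile (ps k) (h k) (e k)"
    and sub: "\<And>k j x. e k j x \<le> step (lams k) (ls k) (e k) j x" by metis
  have step_parts: "B + K * window_width (ps k) + \<bar>ls k\<bar> \<le> s k"
    "B + K * window_width (ps k) + \<bar>ls k\<bar> + \<bar>lams k\<bar> / \<alpha> \<le> s k" for k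
  proof -
    have "\<bar>lams k\<bar> / \<alpha> \<ge> 0" using \<alpha>_pos by simp
    then show "B + K * window_width (ps k) + \<bar>ls k\<bar> \<le> s k"
      "B + K * window_width (ps k) + \<bar>ls k\<bar> + \<bar>lams k\<bar> / \<alpha> \<le> s k"
      unfolding s_def step_bound_def by linarith+
  qed
  have e_tame: "tame (\<lambda>k. e k j)" for j
    by (rule tame_profiles[OF e ps_pos \<pi> c])
  have r: "profile (ps k) (h k + s k) (react (ls k) (e k))" for k
    by (rule profile_weaken[OF profile_react[OF e ps_pos]]) (use step_parts in auto)
  have r_tame: "tame (\<lambda>k. react (ls k) (e k) j)" for j
    by (rule tame_profiles[OF r ps_pos \<pi>, where c="c + d"]) (use c d in \<open>auto intro: add_mono\<close>)
  have a: "profile (ps k) (h k + s k) (\<lambda>j. advect (lams k) (react (ls k) (e k) j))" for k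
    by (rule profile_weaken[OF profile_advect[OF profile_react[OF e ps_pos] ps_pos]]) (use step_parts(2) in \<open>simp add: add.assoc\<close>)
  have a_tame: "tame (\<lambda>k. advect (lams k) (react (ls k) (e k) j))" for j
    by (rule tame_profiles[OF a ps_pos \<pi>, where c="c + d"]) (use c d in \<open>auto intro: add_mono\<close>)
  have st: "profile (ps k) (h k + s k) (step (lams k) (ls k) (e k))" for k
    unfolding s_def by (rule profile_step[OF e ps_pos])
  have st_tame: "tame (\<lambda>k. step (lams k) (ls k) (e k) j)" for j
    by (rule tame_profiles[OF st ps_pos \<pi>, where c="c + d"]) (use c d in \<open>auto intro: add_mono\<close>)
  have p0: "p \<ge> 0" by (rule tendsto_lowerbound[OF ps]) (use ps_pos in auto)
  define H where "H j = upper_limit (\<lambda>k. e k j)" for j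
  have gap0: "(\<lambda>k. 0 :: real) \<longlonglongrightarrow> 0" by simp
  \<comment> \<open>\<open>y\<close> and \<open>y'\<close> stand for the right shifts inside
    \<open>tail_sup\<close>. A relation between the \<open>e k\<close> that is violated in
    \<open>z\<close> by at most a null sequence \<open>a k\<close> becomes exact for
    \<open>H\<close>.\<close>
  have H_le: "H i (\<tau>, z) \<le> H j (\<tau>, z') + b"
    if a: "a \<longlonglongrightarrow> 0" and le: "\<And>k y y'. y + a k \<le> y' \<Longrightarrow> e k i (\<tau>, z + y) \<le> e k j (\<tau>, z' + y') + b" for i j \<tau> z z' a b
    unfolding H_def
  proof (rule upper_limit_le[OF e_tame e_tame])
    fix r
    obtain r' where "r' \<ge> r" "\<And>k. k \<ge> r' \<Longrightarrow> 1 / (Suc r') + a k \<le> 1 / (Suc r)"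
      using eventually_gap[OF a] by blast
    then show "\<exists>r'\<ge>r. \<forall>k\<ge>r'. e k i (\<tau>, z + 1 / (Suc r')) \<le> e k j (\<tau>, z' + 1 / (Suc r)) + b"
      using le by blast
  qed
  note D = profileD[OF e]
  obtain c0 where c0: "\<And>k \<tau> z. \<bar>e k 0 (\<tau>, z) - z\<bar> \<le> c0"
    using tameE[OF e_tame[of 0]] by metis
  have H: "profile p (c0 + 1) H"
    unfolding profile_def
  proof (intro conjI allI ballI impI)
    show "H j \<in> borel_measurable borel" for j unfolding H_def by (rule upper_limit_measurable[OF e_tame])
    show "H j (\<tau> + s, z) = H j (\<tau>, z)" if "s \<in> P" for j \<tau> s z
      unfolding H_def upper_limit_def tail_sup_def by (simp add: D(2)[OF that])
    show "H j (\<tau>, z + 1) = H j (\<tau>, z) + 1" for j \<tau> z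
    proof (rule antisym)
      have "e k j (\<tau>, z + 1 + y) \<le> e k j (\<tau>, z + y') + 1" if "y + 0 \<le> y'" for k y y'
        using D(3)[of k j \<tau> "z + y"] D(6)[of "z + y" "z + y'" k j \<tau>] that by (simp add: algebra_simps)
      from H_le[OF gap0 this] show "H j (\<tau>, z + 1) \<le> H j (\<tau>, z) + 1" .
      have "e k j (\<tau>, z + y) \<le> e k j (\<tau>, z + 1 + y') + - 1" if "y + 0 \<le> y'" for k y y'
        using D(3)[of k j \<tau> "z + y'"] D(6)[of "z + y" "z + y'" k j \<tau>] that by (simp add: algebra_simps)
      from H_le[OF gap0 this] show "H j (\<tau>, z) + 1 \<le> H j (\<tau>, z + 1)" by simp
    qed
    \<comment> \<open>The translation length itself varies with \<open>k\<close>; the null sequences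
      \<open>ps k - p\<close> and \<open>p - ps k\<close> are absorbed by \<open>H_le\<close>, once
      for each inequality.\<close>
    show "H (j + int n) (\<tau>, z) = H j (\<tau>, z + p)" for j \<tau> z
    proof (rule antisym)
      have lim: "(\<lambda>k. ps k - p) \<longlonglongrightarrow> 0" "(\<lambda>k. p - ps k) \<longlonglongrightarrow> 0"
        using tendsto_diff[OF ps tendsto_const[of p]] tendsto_diff[OF tendsto_const[of p] ps] by auto
      have "e k (j + int n) (\<tau>, z + y) \<le> e k j (\<tau>, z + p + y') + 0" if "y + (ps k - p) \<le> y'" for k y y'
        unfolding D(4) using D(6)[of "z + y + ps k" "z + p + y'" k j \<tau>] that by simp
      from H_le[OF lim(1) this] show "H (j + int n) (\<tau>, z) \<le> H j (\<tau>, z + p)" by simp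
      have "e k j (\<tau>, z + p + y) \<le> e k (j + int n) (\<tau>, z + y') + 0" if "y + (p - ps k) \<le> y'" for k y y'
        unfolding D(4) using D(6)[of "z + p + y" "z + y' + ps k" k j \<tau>] that by simp
      from H_le[OF lim(2) this] show "H j (\<tau>, z + p) \<le> H (j + int n) (\<tau>, z)" by simp
    qed
    show "H j (\<tau>, z) \<le> H (j + 1) (\<tau>, z)" for j \<tau> z
      unfolding H_def by (rule upper_limit_mono[OF e_tame e_tame]) (auto intro: profile_mono_index[OF e])
    show "H j (\<tau>, z) \<le> H j (\<tau>, z')" if "z \<le> z'" for j \<tau> z z'
    proof -
      have "e k j (\<tau>, z + y) \<le> e k j (\<tau>, z' + y') + 0" if "y + 0 \<le> y'" for k y y'
        using D(6)[of "z + y" "z' + y'" k j \<tau>] that \<open>z \<le> z'\<close> by simp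
      from H_le[OF gap0 this] show ?thesis by simp
    qed
    show "\<bar>H 0 (\<tau>, z) - z\<bar> \<le> c0 + 1" for \<tau> z
      unfolding H_def by (rule upper_limit_bounds[OF e_tame c0])
  qed
  have "H j x \<le> step lam l H j x" for j x
  proof -
    define R where "R j = upper_limit (\<lambda>k. react (ls k) (e k) j)" for j
    define A where "A j = upper_limit (\<lambda>k. advect (lams k) (react (ls k) (e k) j))" for j
    have meas: "R j \<in> borel_measurable borel" "A j \<in> borel_measurable borel" for j
      unfolding R_def A_def by (intro upper_limit_measurable r_tame a_tame)+
    obtain cR where cR: "\<And>\<tau> z. \<bar>R j (\<tau>, z) - z\<bar> \<le> cR"
      using upper_limit_bounded[OF r_tame] unfolding R_def by blast
    obtain cA where cA: "\<And>\<tau> z. \<bar>A j (\<tau>, z) - z\<bar> \<le> cA"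
      using upper_limit_bounded[OF a_tame] unfolding A_def by blast
    note rH = profile_react[OF H p0, of l] and aH = profile_advect[OF profile_react[OF H p0, of l] p0, of lam]
    have bound: "\<exists>c. \<forall>\<tau> z. \<bar>f j (\<tau>, z) - z\<bar> \<le> c" if "profile p C f" for f C
    proof (intro exI allI)
      show "\<bar>f j (\<tau>, z) - z\<bar> \<le> C + 2 * p + \<bar>p / n * j\<bar>" for \<tau> z
        using profile_bound[OF that p0, of j \<tau> z] by linarith
    qed
    obtain crH where crH: "\<And>\<tau> z. \<bar>react l H j (\<tau>, z) - z\<bar> \<le> crH" using bound[OF rH] by blast
    obtain caH where caH: "\<And>\<tau> z. \<bar>advect lam (react l H j) (\<tau>, z) - z\<bar> \<le> caH" using bound[OF aH] by blast
    have "H j x \<le> upper_limit (\<lambda>k. step (lams k) (ls k) (e k) j) x"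
      unfolding H_def by (rule upper_limit_mono[OF e_tame st_tame sub])
    also have "\<dots> \<le> advect lam (A j) x"
      unfolding A_def step_def by (rule upper_limit_advect[OF a_tame lams st_tame[unfolded step_def]])
    also have "\<dots> \<le> advect lam (advect lam (react l H j)) x"
    proof (rule advect_mono_bounded[OF meas(2) profileD(1)[OF aH] cA caH])
      fix x
      have "A j x \<le> advect lam (R j) x"
        unfolding A_def R_def by (rule upper_limit_advect[OF r_tame lams a_tame])
      also have "\<dots> \<le> advect lam (react l H j) x"
      proof (rule advect_mono_bounded[OF meas(1) profileD(1)[OF rH] cR crH])
        show "R j x \<le> react l H j x" for x
          unfolding R_def H_def by (rule upper_limit_react[OF e_tame ls r_tame])
      qed
      finally show "A j x \<le> advect lam (react l H j) x" .
    qed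
    finally show ?thesis unfolding step_def .
  qed
  then show ?thesis using H unfolding sub_profile_def by blast
qed

lemma super_profile_limit:
  assumes sup: "\<And>k. \<exists>e. super_profile (ps k) (ls k) (lams k) e" and ps_pos: "\<And>k. ps k \<ge> 0"
    and ps: "ps \<longlonglongrightarrow> p" and ls: "ls \<longlonglongrightarrow> l" and lams: "lams \<longlonglongrightarrow> lam"
  shows "\<exists>e. super_profile p l lam e"
proof -
  interpret R: cooperative n m \<alpha> K B P "reflect_G G" by (rule cooperative_reflect)
  have "\<exists>e. R.sub_profile p (- l) (- lam) e"
  proof (rule R.sub_profile_limit[OF _ ps_pos ps tendsto_minus[OF ls] tendsto_minus[OF lams]])
    show "\<exists>e. R.sub_profile (ps k) (- ls k) (- lams k) e" for k
      using sup[of k] super_profile_iff_reflect by blast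
  qed
  then obtain e where "R.sub_profile p (- l) (- lam) e" by blast
  then have "super_profile p l lam (reflect e)" unfolding super_profile_iff_reflect by simp
  then show ?thesis by blast
qed

lemma super_profile_linear:
  assumes "p \<ge> 0"
  shows "super_profile p l (\<alpha> / 2 * (l + (B + K * window_width p))) (linear_profile p)"
proof -
  interpret R: cooperative n m \<alpha> K B P "reflect_G G" by (rule cooperative_reflect)
  have eq1: "reflect (linear_profile p) = linear_profile p"
    by (simp add: reflect_def linear_profile_def fun_eq_iff)
  have eq2: "- (\<alpha> / 2 * (l + (B + K * window_width p))) = \<alpha> / 2 * (- l - (B + K * window_width p))"
    by (simp add: algebra_simps)
  show ?thesis
    using R.sub_profile_linear[OF assms, of "- l"] unfolding super_profile_iff_reflect eq1 eq2 .
qed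

lemma speed_exists:
  assumes "p \<ge> 0"
  shows "\<exists>lam. (\<exists>e. sub_profile p l lam e) \<and> (\<exists>e. super_profile p l lam e)"
proof -
  define S where "S = {lam. \<exists>e. sub_profile p l lam e}"
  have ne: "S \<noteq> {}" unfolding S_def using sub_profile_linear[OF assms, of l] by auto
  have bdd: "bdd_above S"
  proof (rule bdd_aboveI)
    fix lam assume "lam \<in> S"
    then obtain e where "sub_profile p l lam e" unfolding S_def by auto
    then show "lam \<le> \<alpha> / 2 * (l + (B + K * window_width p))"
      by (rule speed_le[OF _ super_profile_linear[OF assms] order_refl assms])
  qed
  have "closed S"
    unfolding closed_sequential_limits
  proof (intro allI impI)
    fix lams lam assume "(\<forall>k. lams k \<in> S) \<and> lams \<longlonglongrightarrow> lam"
    then show "lam \<in> S"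
      unfolding S_def using sub_profile_limit[of "\<lambda>_. p" "\<lambda>_. l" lams p l lam] assms by auto
  qed
  then have sub: "Sup S \<in> S" by (rule closed_contains_Sup[OF ne bdd])
  \<comment> \<open>A speed above \<open>Sup S\<close> has no sub-profile, so
    \<open>sub_or_super\<close> yields a super-profile. These exist at speeds decreasing to
    \<open>Sup S\<close> and survive in the limit.\<close>
  have "\<exists>e. super_profile p l (Sup S + 1 / (Suc k)) e" for k
  proof -
    have "Sup S + 1 / (Suc k) \<notin> S"
    proof
      assume "Sup S + 1 / (Suc k) \<in> S"
      then have "Sup S + 1 / (Suc k) \<le> Sup S" by (rule cSup_upper[OF _ bdd])
      then show False by simp
    qed
    then show ?thesis using sub_or_super[OF assms] unfolding S_def by blast
  qed
  moreover have "(\<lambda>k. Sup S + 1 / (Suc k)) \<longlonglongrightarrow> Sup S"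
    using LIMSEQ_inverse_real_of_nat_add[of "Sup S"] by (simp add: inverse_eq_divide)
  ultimately have "\<exists>e. super_profile p l (Sup S) e"
    using super_profile_limit[of "\<lambda>_. p" "\<lambda>_. l" "\<lambda>k. Sup S + 1 / (Suc k)" p l "Sup S"] assms by simp
  then show ?thesis using sub unfolding S_def by blast
qed

lemma fixed_profile_exists:
  assumes "sub_profile p l lam e" "super_profile p l lam f" "p \<ge> 0"
  obtains C h where "profile p C h" "step lam l h = h"
proof -
  from assms(1) obtain C where e: "profile p C e" and sub: "\<And>j x. e j x \<le> step lam l e j x"
    by (auto simp: sub_profile_def)
  from assms(2) obtain C' where f: "profile p C' f" and sup: "\<And>j x. step lam l f j x \<le> f j x"
    by (auto simp: super_profile_def)
  \<comment> \<open>Each of the two profiles deviates from the line by its own bound plus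
    \<open>2 * p\<close>, so raising \<open>f\<close> by this amount puts it above \<open>e\<close>.
    Rounding to an integer keeps it a super-profile.\<close>
  define N where "N = \<lceil>C + C' + 4 * p\<rceil>"
  define f' where "f' j x = f j x + of_int N" for j x
  have f': "profile p (C' + \<bar>of_int N\<bar>) f'" unfolding f'_def by (rule profile_add_const[OF f])
  have sup': "step lam l f' j x \<le> f' j x" for j x
    unfolding f'_def step_add_int[OF f assms(3)] using sup by simp
  have ef': "e j x \<le> f' j x" for j x
  proof (cases x)
    case (Pair \<tau> z)
    have "C + C' + 4 * p \<le> of_int N" unfolding N_def by linarith
    then show ?thesis
      using profile_bound[OF e assms(3), of j \<tau> z] profile_bound[OF f assms(3), of j \<tau> z]
      unfolding f'_def Pair by linarith
  qed
  define u where "u k = (step lam l ^^ k) e" for k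
  have u0: "u 0 = e" and uS: "u (Suc k) = step lam l (u k)" for k by (auto simp: u_def)
  have pu: "(\<exists>C. profile p C (u k)) \<and> (\<forall>j x. u k j x \<le> u (Suc k) j x) \<and> (\<forall>j x. u k j x \<le> f' j x)" for k
  proof (induction k)
    case 0 then show ?case using e sub ef' by (auto simp: u0 uS)
  next
    case (Suc k)
    then obtain Ck where Ck: "profile p Ck (u k)" by blast
    have P: "profile p (Ck + step_bound p lam l) (u (Suc k))"
      unfolding uS by (rule profile_step[OF Ck assms(3)])
    have "u (Suc k) j x \<le> u (Suc (Suc k)) j x" for j x
      unfolding uS[of "Suc k"] uS[of k] 
      using step_mono[OF Ck P assms(3,3)] Suc unfolding uS[of k] by blast
    moreover have "u (Suc k) j x \<le> f' j x" for j x
      unfolding uS[of k] using step_mono[OF Ck f' assms(3,3)] Suc sup' order_trans by blast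
    ultimately show ?case using P by blast
  qed
  have inc: "u k j x \<le> u (Suc k) j x" for k j x using pu by blast
  define C'' where "C'' = max C (C' + \<bar>of_int N\<bar>)"
  have pC: "profile p C'' (u k)" for k
  proof -
    obtain Ck where "profile p Ck (u k)" using pu by blast
    then show ?thesis
    proof (rule profile_rebound)
      fix \<tau> z
      have "e j x \<le> u k j x" for j x
      proof (induction k)
        case (Suc k) then show ?case using inc[of k j x] by simp
      qed (simp add: u0)
      moreover have "u k 0 (\<tau>, z) \<le> f' 0 (\<tau>, z)" using pu by blast
      ultimately show "\<bar>u k 0 (\<tau>, z) - z\<bar> \<le> C''"
        using profileD(7)[OF e, of \<tau> z] profileD(7)[OF f', of \<tau> z] unfolding C''_def
        by (smt (verit) max_def)
    qed
  qed
  from profile_mono_limit[where e=u, OF pC assms(3) inc] obtain h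
    where h: "profile p C'' h" and lim: "\<And>j x. (\<lambda>k. u k j x) \<longlonglongrightarrow> h j x" by blast
  have "step lam l h j x = h j x" for j x
  proof (rule LIMSEQ_unique)
    show "(\<lambda>k. u (Suc k) j x) \<longlonglongrightarrow> step lam l h j x"
      unfolding uS by (rule step_tendsto[where e=u, OF pC h assms(3) lim])
    show "(\<lambda>k. u (Suc k) j x) \<longlonglongrightarrow> h j x" using lim by (rule LIMSEQ_Suc)
  qed
  then show ?thesis using that[OF h] by (simp add: fun_eq_iff)
qed

end

subsection \<open>Semicontinuous envelopes and viscosity inequalities\<close>

lemma locally_bounded_eventually:
  assumes "locally_bounded f"
  obtains M where "\<forall>\<^sub>F y in nhds x. \<bar>f y\<bar> \<le> M"
proof -
  obtain U where U: "open U" "x \<in> U" "bounded (f ` U)"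
    using assms by (auto simp: locally_bounded_def)
  then obtain M where "\<forall>y\<in>U. \<bar>f y\<bar> \<le> M" by (auto simp: bounded_iff)
  then have "\<forall>\<^sub>F y in nhds x. \<bar>f y\<bar> \<le> M" using U by (auto simp: eventually_nhds)
  then show ?thesis by (rule that)
qed

lemma locally_bounded_near_continuous:
  fixes f g :: "'a::metric_space \<Rightarrow> real"
  assumes "\<And>x. isCont g x" "\<And>x. \<bar>f x - g x\<bar> \<le> C"
  shows "locally_bounded f"
  unfolding locally_bounded_def
proof
  fix x
  have "\<forall>\<^sub>F y in nhds x. dist (g y) (g x) < 1"
    using assms(1)[of x] unfolding continuous_within tendsto_iff eventually_nhds_conv_at by simp
  then obtain U where U: "open U" "x \<in> U" "\<And>y. y \<in> U \<Longrightarrow> dist (g y) (g x) < 1"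
    by (auto simp: eventually_nhds)
  have "norm (f y) \<le> \<bar>g x\<bar> + 1 + C" if "y \<in> U" for y
    using U(3)[OF that] assms(2)[of y] by (simp add: dist_real_def abs_le_iff abs_less_iff) linarith
  then show "\<exists>U. open U \<and> x \<in> U \<and> bounded (f ` U)"
    using U(1,2) by (auto simp: bounded_iff)
qed

text \<open>Local boundedness keeps the upper limit finite, so \<open>real_of_ereal\<close> does not
  fall back on its default value at infinity.\<close>

lemma ereal_usc_envelope:
  assumes "locally_bounded f"
  shows "ereal (usc_envelope f x) = Limsup (nhds x) (\<lambda>y. ereal (f y))"
proof -
  obtain M where M: "\<forall>\<^sub>F y in nhds x. \<bar>f y\<bar> \<le> M" using locally_bounded_eventually[OF assms] .
  have "Limsup (nhds x) (\<lambda>y. ereal (f y)) \<le> ereal M"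
    by (rule Limsup_bounded) (use M in eventually_elim, auto)
  moreover have "ereal (- M) \<le> Limsup (nhds x) (\<lambda>y. ereal (f y))"
    by (rule le_Limsup) (simp, use M in eventually_elim, auto)
  ultimately show ?thesis
    unfolding usc_envelope_def by (cases "Limsup (nhds x) (\<lambda>y. ereal (f y))") auto
qed

lemma usc_envelope_leI:
  assumes "locally_bounded f" "\<forall>\<^sub>F y in nhds x. f y \<le> c"
  shows "usc_envelope f x \<le> c"
proof -
  have "Limsup (nhds x) (\<lambda>y. ereal (f y)) \<le> ereal c"
    by (rule Limsup_bounded) (use assms(2) in eventually_elim, auto)
  then show ?thesis using ereal_usc_envelope[OF assms(1), of x] by (metis ereal_less_eq(3))
qed

lemma usc_envelope_lessD:
  assumes "locally_bounded f" "usc_envelope f x < c"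
  shows "\<forall>\<^sub>F y in nhds x. f y < c"
proof -
  have "Limsup (nhds x) (\<lambda>y. ereal (f y)) < ereal c"
    using assms by (simp flip: ereal_usc_envelope)
  from Limsup_lessD[OF this] show ?thesis by simp
qed

lemma usc_envelope_ge: "locally_bounded f \<Longrightarrow> f x \<le> usc_envelope f x"
  using usc_envelope_lessD[of f x "f x"] eventually_nhds_x_imp_x by fastforce

lemma upper_semicontinuous_usc_envelope:
  assumes "locally_bounded f"
  shows "upper_semicontinuous (usc_envelope f)"
  unfolding upper_semicontinuous_def
proof (intro allI impI)
  fix x c assume "c > usc_envelope f x"
  then obtain c' where c': "usc_envelope f x < c'" "c' < c" using dense by blast
  from usc_envelope_lessD[OF assms c'(1)]
  have "\<forall>\<^sub>F y in nhds x. \<forall>\<^sub>F z in nhds y. f z < c'" by (simp add: eventually_eventually)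
  then show "\<forall>\<^sub>F y in nhds x. usc_envelope f y < c"
  proof eventually_elim
    fix y assume "\<forall>\<^sub>F z in nhds y. f z < c'"
    then have "\<forall>\<^sub>F z in nhds y. f z \<le> c'" by eventually_elim simp
    from usc_envelope_leI[OF assms this] show "usc_envelope f y < c" using c'(2) by simp
  qed
qed

lemma usc_envelope_near:
  assumes "locally_bounded f" "isCont g x" "\<And>y. \<bar>f y - g y\<bar> \<le> C"
  shows "\<bar>usc_envelope f x - g x\<bar> \<le> C"
proof -
  have "usc_envelope f x \<le> g x + C + \<epsilon>" if "\<epsilon> > 0" for \<epsilon>
  proof (rule usc_envelope_leI[OF assms(1)])
    have "\<forall>\<^sub>F y in nhds x. dist (g y) (g x) < \<epsilon>"
      using assms(2) that unfolding continuous_within tendsto_iff eventually_nhds_conv_at by simp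
    then show "\<forall>\<^sub>F y in nhds x. f y \<le> g x + C + \<epsilon>"
    proof eventually_elim
      fix y assume "dist (g y) (g x) < \<epsilon>"
      then show "f y \<le> g x + C + \<epsilon>"
        using assms(3)[of y] by (simp add: dist_real_def abs_less_iff abs_le_iff)
    qed
  qed
  then have "usc_envelope f x \<le> g x + C" by (rule field_le_epsilon)
  moreover have "g x - C \<le> usc_envelope f x"
    using usc_envelope_ge[OF assms(1), of x] assms(3)[of x] by simp
  ultimately show ?thesis by (simp add: abs_le_iff)
qed

lemma usc_envelope_eqI:
  assumes f: "locally_bounded f" and xs: "xs \<longlonglongrightarrow> x" "(\<lambda>r. f (xs r)) \<longlonglongrightarrow> a"
    and le: "\<And>\<epsilon>. \<epsilon> > 0 \<Longrightarrow> \<forall>\<^sub>F y in nhds x. f y \<le> a + \<epsilon>"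
  shows "usc_envelope f x = a"
proof (rule antisym)
  show "usc_envelope f x \<le> a"
    by (rule field_le_epsilon) (rule usc_envelope_leI[OF f le])
  show "a \<le> usc_envelope f x"
  proof (rule ccontr)
    assume "\<not> ?thesis"
    then obtain c where c: "usc_envelope f x < c" "c < a" using dense[of "usc_envelope f x" a] by auto
    from usc_envelope_lessD[OF f c(1)] have "\<forall>\<^sub>F r in sequentially. f (xs r) < c"
      using xs(1) by (auto simp: filterlim_iff)
    then have "\<forall>\<^sub>F r in sequentially. f (xs r) \<le> c" by eventually_elim simp
    with xs(2) have "a \<le> c" by (intro tendsto_upperbound) auto
    then show False using c(2) by simp
  qed
qed

lemma lsc_envelope_uminus: "lsc_envelope f x = - usc_envelope (\<lambda>y. - f y) x"
proof -
  have "Limsup (nhds x) (\<lambda>y. ereal (- f y)) = - Liminf (nhds x) (\<lambda>y. ereal (f y))"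
    using ereal_Limsup_uminus[of "nhds x" "\<lambda>y. ereal (f y)"] by simp
  then show ?thesis by (simp add: lsc_envelope_def usc_envelope_def)
qed

lemma lower_semicontinuous_uminus: "lower_semicontinuous f \<longleftrightarrow> upper_semicontinuous (\<lambda>x. - f x)"
proof
  assume L: "lower_semicontinuous f"
  show "upper_semicontinuous (\<lambda>x. - f x)"
    unfolding upper_semicontinuous_def
  proof (intro allI impI)
    fix x c assume "- f x < c"
    then have "- c < f x" by simp
    with L have "\<forall>\<^sub>F y in nhds x. - c < f y" unfolding lower_semicontinuous_def by blast
    then show "\<forall>\<^sub>F y in nhds x. - f y < c" by eventually_elim simp
  qed
next
  assume R: "upper_semicontinuous (\<lambda>x. - f x)"
  show "lower_semicontinuous f"
    unfolding lower_semicontinuous_def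
  proof (intro allI impI)
    fix x c assume "c < f x"
    then have "- f x < - c" by simp
    with R have "\<forall>\<^sub>F y in nhds x. - f y < - c" unfolding upper_semicontinuous_def by blast
    then show "\<forall>\<^sub>F y in nhds x. c < f y" by eventually_elim simp
  qed
qed

lemma locally_bounded_uminus: "locally_bounded f \<Longrightarrow> locally_bounded (\<lambda>x. - f x)"
proof -
  have "(\<lambda>x. - f x) ` U = uminus ` (f ` U)" for U by auto
  then show "locally_bounded f \<Longrightarrow> locally_bounded (\<lambda>x. - f x)"
    unfolding locally_bounded_def by (auto simp: bounded_iff) 
qed

lemma open_usc_less: "upper_semicontinuous f \<Longrightarrow> open {x. f x < c}"
  unfolding upper_semicontinuous_def
  by (subst open_subopen) (auto simp: eventually_nhds subset_iff, metis)

lemma usc_measurable: "upper_semicontinuous f \<Longrightarrow> f \<in> borel_measurable borel"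
  by (rule borel_measurableI_less) (simp add: open_usc_less)

text \<open>Without a maximum, the open sets \<open>{x. f x < f y}\<close> with \<open>y\<close> in
  \<open>S\<close> would cover \<open>S\<close>. The largest of the finitely many values in a
  subcover contradicts this.\<close>

lemma usc_attains_max:
  assumes "upper_semicontinuous f" "compact S" "S \<noteq> {}"
  shows "\<exists>x\<in>S. \<forall>y\<in>S. f y \<le> f x"
proof (rule ccontr)
  assume no: "\<not> ?thesis"
  have "S \<subseteq> (\<Union>y\<in>S. {x. f x < f y})" using no by (auto simp: not_le)
  then obtain T where T: "T \<subseteq> S" "finite T" "S \<subseteq> (\<Union>y\<in>T. {x. f x < f y})"
    by (rule compactE_image[OF assms(2) open_usc_less[OF assms(1)]]) auto
  have "T \<noteq> {}" using T(3) assms(3) by auto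
  then have "Max (f ` T) \<in> f ` T" using T(2) by (intro Max_in) auto
  then obtain y where y: "y \<in> T" "f y = Max (f ` T)" by auto
  obtain y' where "y' \<in> T" "f y < f y'" using T(1,3) y(1) by auto
  then show False using y(2) T(2) Max_ge[of "f ` T" "f y'"] by fastforce
qed

lemma upper_semicontinuous_diff:
  assumes "upper_semicontinuous f" "\<And>x. isCont g x"
  shows "upper_semicontinuous (\<lambda>x. f x - g x :: real)"
  unfolding upper_semicontinuous_def
proof (intro allI impI)
  fix x c assume "c > f x - g x"
  define \<epsilon> where "\<epsilon> = (c - (f x - g x)) / 2"
  have e: "\<epsilon> > 0" "f x < f x + \<epsilon>" "c = (f x + \<epsilon>) - (g x - \<epsilon>)"
    using \<open>c > f x - g x\<close> by (auto simp: \<epsilon>_def field_simps)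
  have "\<forall>\<^sub>F y in nhds x. f y < f x + \<epsilon>"
    using assms(1) e(2) unfolding upper_semicontinuous_def by blast
  moreover have "\<forall>\<^sub>F y in nhds x. dist (g y) (g x) < \<epsilon>"
    using assms(2)[of x] e(1) unfolding continuous_within tendsto_iff eventually_nhds_conv_at by simp
  ultimately show "\<forall>\<^sub>F y in nhds x. f y - g y < c"
    by eventually_elim (use e(3) in \<open>auto simp: dist_real_def abs_less_iff\<close>)
qed

section \<open>From viscosity inequalities to integral inequalities on a line\<close>

lemma linear_minus_quadratic_le:
  fixes c k r :: real
  assumes "k > 0"
  shows "c * r - k * r\<^sup>2 \<le> c\<^sup>2 / (4 * k)"
proof -
  have "0 \<le> k * (r - c / (2 * k))\<^sup>2" using assms by simp
  also have "\<dots> = k * r\<^sup>2 - c * r + c\<^sup>2 / (4 * k)"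
    using assms by (simp add: power2_eq_square field_simps)
  finally show ?thesis by simp
qed

definition linearly_bounded :: "real \<Rightarrow> (real \<times> real \<Rightarrow> real) \<Rightarrow> bool" where
  "linearly_bounded c f \<longleftrightarrow> (\<forall>t y. \<bar>f (t, y)\<bar> \<le> c * (1 + \<bar>t\<bar> + \<bar>y\<bar>))"

lemma usc_slice_measurable:
  assumes "upper_semicontinuous f"
  shows "(\<lambda>t :: real. f (t, y :: real)) \<in> borel_measurable borel"
proof -
  have [measurable]: "f \<in> borel_measurable (borel \<Otimes>\<^sub>M borel)"
    using usc_measurable[OF assms] by (simp add: borel_prod)
  show ?thesis by measurable
qed

lemma linear_growth_slice:
  assumes "upper_semicontinuous f" "linearly_bounded c f"
  shows "linear_growth (\<lambda>t. f (t, y))"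
  by (rule linear_growthI[OF usc_slice_measurable[OF assms(1)], where a="c * (1 + \<bar>y\<bar>)" and b=c])
     (use assms(2) in \<open>auto simp: linearly_bounded_def algebra_simps\<close>)

text \<open>A continuous function of time that decreases to \<open>f (\<cdot>, y0)\<close> as \<open>k\<close> grows and still controls
  \<open>f\<close> away from the line: \<open>f (s, y) \<le> sup_convolution k y0 f s + k (y - y0)\<^sup>2\<close>.\<close>

definition sup_convolution :: "real \<Rightarrow> real \<Rightarrow> (real \<times> real \<Rightarrow> real) \<Rightarrow> real \<Rightarrow> real" where
  "sup_convolution k y0 f t = (SUP x. f x - k * \<bar>fst x - t\<bar> - k * (snd x - y0)\<^sup>2)"

context
  fixes f :: "real \<times> real \<Rightarrow> real" and c k y0 :: real
  assumes f: "linearly_bounded c f" and c: "c > 0" and k: "k \<ge> c"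
begin

text \<open>The growth of \<open>f\<close> is charged to the penalties: in time the linear penalty
  absorbs it because \<open>k \<ge> c\<close>, in \<open>y\<close> the quadratic one dominates any
  linear term.\<close>

lemma sup_convolution_term:
  "f (s, y) - k * \<bar>s - t\<bar> - k * (y - y0)\<^sup>2
    \<le> c * (1 + \<bar>t\<bar> + \<bar>y0\<bar>) - (k - c) * \<bar>s - t\<bar> + (c * \<bar>y - y0\<bar> - k * \<bar>y - y0\<bar>\<^sup>2)"
proof -
  have "f (s, y) \<le> c * (1 + \<bar>s\<bar> + \<bar>y\<bar>)" using f by (simp add: linearly_bounded_def abs_le_iff)
  also have "\<dots> \<le> c * (1 + (\<bar>t\<bar> + \<bar>s - t\<bar>) + (\<bar>y0\<bar> + \<bar>y - y0\<bar>))"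
    using c by (intro mult_left_mono add_mono) auto
  finally show ?thesis by (simp add: algebra_simps)
qed

lemma sup_convolution_bdd: "bdd_above (range (\<lambda>x :: real \<times> real. f x - k * \<bar>fst x - t\<bar> - k * (snd x - y0)\<^sup>2))"
  and sup_convolution_le: "sup_convolution k y0 f t \<le> c * (2 + \<bar>t\<bar> + \<bar>y0\<bar>)"
proof -
  have le: "f x - k * \<bar>fst x - t\<bar> - k * (snd x - y0)\<^sup>2 \<le> c * (2 + \<bar>t\<bar> + \<bar>y0\<bar>)" for x t
  proof -
    have "c\<^sup>2 / (4 * k) \<le> c"
      using c k by (simp add: field_simps power2_eq_square)
    then have "c * \<bar>snd x - y0\<bar> - k * \<bar>snd x - y0\<bar>\<^sup>2 \<le> c"
      using linear_minus_quadratic_le[of k c "\<bar>snd x - y0\<bar>"] c k by linarith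
    moreover have "(k - c) * \<bar>fst x - t\<bar> \<ge> 0" using k by simp
    ultimately show ?thesis
      using sup_convolution_term[of "fst x" "snd x" t] by (simp add: algebra_simps)
  qed
  show "bdd_above (range (\<lambda>x :: real \<times> real. f x - k * \<bar>fst x - t\<bar> - k * (snd x - y0)\<^sup>2))"
    by (rule bdd_aboveI2[OF le])
  show "sup_convolution k y0 f t \<le> c * (2 + \<bar>t\<bar> + \<bar>y0\<bar>)"
    unfolding sup_convolution_def by (rule cSUP_least[OF _ le]) simp
qed

lemma sup_convolution_upper: "f (s, y) - k * \<bar>s - t\<bar> - k * (y - y0)\<^sup>2 \<le> sup_convolution k y0 f t"
  unfolding sup_convolution_def using cSUP_upper[OF UNIV_I sup_convolution_bdd, of "(s, y)"] by simp

lemma sup_convolution_lipschitz: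
  "sup_convolution k y0 f t \<le> sup_convolution k y0 f t' + k * \<bar>t - t'\<bar>"
  unfolding sup_convolution_def[of k y0 f t]
proof (rule cSUP_least)
  fix x :: "real \<times> real"
  have "k * \<bar>fst x - t'\<bar> \<le> k * (\<bar>fst x - t\<bar> + \<bar>t - t'\<bar>)" using c k by (intro mult_left_mono) auto
  then show "f x - k * \<bar>fst x - t\<bar> - k * (snd x - y0)\<^sup>2 \<le> sup_convolution k y0 f t' + k * \<bar>t - t'\<bar>"
    using sup_convolution_upper[of "fst x" "snd x" t'] by (simp add: algebra_simps)
qed simp

lemma sup_convolution_continuous: "continuous_on UNIV (sup_convolution k y0 f)"
proof (rule lipschitz_on_continuous_on)
  show "k-lipschitz_on UNIV (sup_convolution k y0 f)"
  proof (rule lipschitz_onI)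
    show "dist (sup_convolution k y0 f t) (sup_convolution k y0 f t') \<le> k * dist t t'" for t t'
      using sup_convolution_lipschitz[of t t'] sup_convolution_lipschitz[of t' t]
      by (simp add: dist_real_def abs_le_iff abs_minus_commute)
  qed (use c k in simp)
qed

lemma sup_convolution_abs: "\<bar>sup_convolution k y0 f t\<bar> \<le> c * (2 + \<bar>y0\<bar>) + c * \<bar>t\<bar>"
proof -
  have "- (c * (1 + \<bar>t\<bar> + \<bar>y0\<bar>)) \<le> f (t, y0)"
    using f unfolding linearly_bounded_def by (metis abs_le_D2 minus_le_iff)
  then have "- (c * (1 + \<bar>t\<bar> + \<bar>y0\<bar>)) \<le> sup_convolution k y0 f t"
    using sup_convolution_upper[of t y0 t] by simp
  moreover have "- (c * (2 + \<bar>t\<bar> + \<bar>y0\<bar>)) \<le> - (c * (1 + \<bar>t\<bar> + \<bar>y0\<bar>))" using c by (simp add: algebra_simps)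
  ultimately show ?thesis
    using sup_convolution_le[of t] by (simp add: algebra_simps abs_le_iff)
qed

lemma linear_growth_sup_convolution: "linear_growth (sup_convolution k y0 f)"
  by (rule linear_growthI[OF borel_measurable_continuous_onI[OF sup_convolution_continuous] sup_convolution_abs])

end

text \<open>The point \<open>(t, y0)\<close> itself competes in the supremum, which gives the lower
  bound. For the upper bound, semicontinuity controls competitors near the point, and the growing
  penalty eliminates those at distance at least \<open>\<eta>\<close> in time or space.\<close>

lemma sup_convolution_tendsto:
  assumes "upper_semicontinuous f" "linearly_bounded c f" "c > 0"
  shows "(\<lambda>i. sup_convolution (c + real i) y0 f t) \<longlonglongrightarrow> f (t, y0)"
proof (rule order_tendstoI)
  fix a assume a: "a < f (t, y0)"
  have "a < sup_convolution (c + real i) y0 f t" for i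
    using sup_convolution_upper[OF assms(2,3), of "c + real i" t y0 t y0] a by simp
  then show "\<forall>\<^sub>F i in sequentially. a < sup_convolution (c + real i) y0 f t" by simp
next
  fix a' assume "a' > f (t, y0)"
  then obtain a where a: "f (t, y0) < a" "a < a'" using dense by blast
  have "\<forall>\<^sub>F x in nhds (t, y0). f x < a"
    using assms(1) a(1) unfolding upper_semicontinuous_def by blast
  then obtain \<delta> where \<delta>: "\<delta> > 0" "\<And>x. dist x (t, y0) < \<delta> \<Longrightarrow> f x < a"
    by (auto simp: eventually_nhds_metric)
  define \<eta> where "\<eta> = \<delta> / 2"
  have \<eta>: "\<eta> > 0" using \<delta>(1) by (simp add: \<eta>_def)
  define A where "A = c * (1 + \<bar>t\<bar> + \<bar>y0\<bar>)"
  \<comment> \<open>The first threshold defeats competitors with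
    \<open>\<bar>s - t\<bar> \<ge> \<eta>\<close>, the second those with
    \<open>\<bar>y - y0\<bar> \<ge> \<eta>\<close>.\<close>
  obtain N :: nat where "real N > max ((A + c - a) / \<eta>) (c / \<eta> + \<bar>A - a\<bar> / \<eta>\<^sup>2)"
    using reals_Archimedean2 by blast
  then have N: "real N > (A + c - a) / \<eta>" "real N > c / \<eta> + \<bar>A - a\<bar> / \<eta>\<^sup>2" by simp_all
  have "sup_convolution (c + real i) y0 f t \<le> a" if i: "i \<ge> N" for i
    unfolding sup_convolution_def
  proof (rule cSUP_least)
    fix x :: "real \<times> real"
    define k where "k = c + real i"
    obtain s y where x: "x = (s, y)" by (cases x)
    define r1 r2 where "r1 = \<bar>s - t\<bar>" and "r2 = \<bar>y - y0\<bar>"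
    have k0: "k \<ge> c" "k > 0" using assms(3) by (auto simp: k_def)
    have r: "r1 \<ge> 0" "r2 \<ge> 0" by (auto simp: r1_def r2_def)
    have le: "f (s, y) - k * r1 - k * (y - y0)\<^sup>2 \<le> A - real i * r1 + (c * r2 - k * r2\<^sup>2)"
      using sup_convolution_term[OF assms(2,3) k0(1), of s y t y0] unfolding r1_def r2_def A_def k_def
      by simp
    have "f x - k * r1 - k * (y - y0)\<^sup>2 \<le> a"
    proof (cases "r1 < \<eta> \<and> r2 < \<eta>")
      case True
      have "dist x (t, y0) \<le> dist s t + dist y y0"
        unfolding x dist_Pair_Pair using sqrt_sum_squares_le_sum[of "dist s t" "dist y y0"] by simp
      also have "\<dots> < \<delta>" using True by (simp add: dist_real_def r1_def r2_def \<eta>_def)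
      finally have "f x < a" by (rule \<delta>(2))
      moreover have "k * r1 \<ge> 0" "k * (y - y0)\<^sup>2 \<ge> 0" using k0 r by auto
      ultimately show ?thesis by linarith
    next
      case False
      show ?thesis
      proof (cases "r1 \<ge> \<eta>")
        case True
        have "c\<^sup>2 / (4 * k) \<le> c" using assms(3) k0 by (simp add: field_simps power2_eq_square)
        then have "c * r2 - k * r2\<^sup>2 \<le> c" using linear_minus_quadratic_le[OF k0(2), of c r2] by linarith
        moreover have "A + c - a < real i * r1"
        proof -
          have "A + c - a < real N * \<eta>" using N(1) \<eta> by (simp add: field_simps)
          also have "\<dots> \<le> real i * r1" using i True \<eta> by (intro mult_mono) auto
          finally show ?thesis .
        qed
        ultimately show ?thesis using le x by simp
      next
        case False
        then have r2: "r2 \<ge> \<eta>" using \<open>\<not> (r1 < \<eta> \<and> r2 < \<eta>)\<close> by simp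
        have "c * r2 \<le> c / \<eta> * r2\<^sup>2"
        proof -
          have "c * r2 * 1 \<le> c * r2 * (r2 / \<eta>)" using r2 \<eta> assms(3) r by (intro mult_left_mono) auto
          then show ?thesis by (simp add: power2_eq_square field_simps)
        qed
        moreover have "A - a \<le> (real i - c / \<eta>) * r2\<^sup>2"
        proof -
          have q: "\<bar>A - a\<bar> / \<eta>\<^sup>2 \<le> real i - c / \<eta>" using N(2) i by linarith
          moreover have "0 \<le> real i - c / \<eta>" by (rule order_trans[OF _ q]) simp
          moreover have "\<eta>\<^sup>2 \<le> r2\<^sup>2" using r2 \<eta> by (intro power_mono) auto
          ultimately have "\<bar>A - a\<bar> / \<eta>\<^sup>2 * \<eta>\<^sup>2 \<le> (real i - c / \<eta>) * r2\<^sup>2"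
            by (intro mult_mono) auto
          then show ?thesis using \<eta> by simp
        qed
        moreover have "k * r2\<^sup>2 \<ge> real i * r2\<^sup>2" using assms(3) by (intro mult_right_mono) (auto simp: k_def)
        moreover have "real i * r1 \<ge> 0" using r by simp
        ultimately show ?thesis using le x by (simp add: algebra_simps)
      qed
    qed
    then show "f x - (c + real i) * \<bar>fst x - t\<bar> - (c + real i) * (snd x - y0)\<^sup>2 \<le> a"
      unfolding x r1_def k_def by simp
  qed simp
  then show "\<forall>\<^sub>F i in sequentially. sup_convolution (c + real i) y0 f t < a'"
    unfolding eventually_sequentially using a(2) by (meson le_less_trans)
qed

text \<open>With \<open>R = relax \<alpha> (sup_convolution k y0 f)\<close>, the function
  \<open>R \<tau> + k (y - y0)\<^sup>2 + \<epsilon> (\<tau>\<^sup>2 + 1 / \<alpha>\<^sup>2)\<close> is a supersolution that dominates \<open>w\<close> at infinity, hence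
  everywhere.\<close>

lemma viscosity_sub_le_relax:
  assumes \<alpha>: "\<alpha> > 0" and w: "upper_semicontinuous w" "linearly_bounded c w"
    and f: "upper_semicontinuous f" "linearly_bounded c f" and c: "c > 0"
    and visc: "\<And>\<phi> D \<tau> y. C1_with_derivative \<phi> D \<Longrightarrow> local_max_at (\<lambda>x. w x - \<phi> x) (\<tau>, y) \<Longrightarrow>
      blinfun_apply (D (\<tau>, y)) (1, 0) \<le> \<alpha> * (f (\<tau>, y) - w (\<tau>, y))"
  shows "w (t0, y0) \<le> relax \<alpha> (\<lambda>t. f (t, y0)) t0"
proof -
  have conv: "w (t0, y0) \<le> relax \<alpha> (sup_convolution k y0 f) t0" if k: "k \<ge> c" for k
  proof -
    define g where "g = sup_convolution k y0 f"
    have g: "linear_growth g" "continuous_on UNIV g"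
      unfolding g_def
      by (rule linear_growth_sup_convolution[OF f(2) c k], rule sup_convolution_continuous[OF f(2) c k])
    define R where "R = relax \<alpha> g"
    have R': "(R has_real_derivative \<alpha> * (g t - R t)) (at t)" for t
      unfolding R_def by (rule relax_has_derivative[OF \<alpha> g])
    have R_cont: "continuous_on UNIV R"
      using R' DERIV_isCont by (auto simp: continuous_on_eq_continuous_at)
    obtain a b where ab: "a \<ge> 0" "b \<ge> 0" "\<And>t. \<bar>R t\<bar> \<le> a + b * \<bar>t\<bar>"
      using linear_growthE[OF linear_growth_relax[OF \<alpha> g(1)]] unfolding R_def by metis
    have main: "w (t0, y0) \<le> R t0 + \<epsilon> * (t0\<^sup>2 + 1 / \<alpha>\<^sup>2)" if \<epsilon>: "\<epsilon> > 0" for \<epsilon>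
    proof -
      define \<psi> where "\<psi> x = R (fst x) + k * (snd x - y0)\<^sup>2 + \<epsilon> * ((fst x)\<^sup>2 + 1 / \<alpha>\<^sup>2)" for x
      define \<psi>t where "\<psi>t x = \<alpha> * (g (fst x) - R (fst x)) + 2 * \<epsilon> * fst x" for x :: "real \<times> real"
      define \<psi>y where "\<psi>y x = 2 * k * (snd x - y0)" for x :: "real \<times> real"
      define D where "D x = \<psi>t x *\<^sub>R fst_blinfun + \<psi>y x *\<^sub>R (snd_blinfun :: (real \<times> real) \<Rightarrow>\<^sub>L real)" for x
      have D: "C1_with_derivative \<psi> D"
        unfolding C1_with_derivative_def
      proof (intro conjI allI)
        fix x :: "real \<times> real"
        have "((\<lambda>x :: real \<times> real. R (fst x)) has_derivative (\<lambda>h. fst h * (\<alpha> * (g (fst x) - R (fst x))))) (at x)"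
          using has_derivative_compose[OF has_derivative_fst[OF has_derivative_ident]
              R'[unfolded has_field_derivative_def], where x=x]
          by (simp add: mult.commute)
        then have "(\<psi> has_derivative (\<lambda>h. fst h * (\<alpha> * (g (fst x) - R (fst x))) + k * (2 * (snd x - y0) * snd h)
            + \<epsilon> * (2 * fst x * fst h))) (at x)"
          unfolding \<psi>_def by (auto intro!: derivative_eq_intros)
        also have "(\<lambda>h. fst h * (\<alpha> * (g (fst x) - R (fst x))) + k * (2 * (snd x - y0) * snd h)
            + \<epsilon> * (2 * fst x * fst h)) = blinfun_apply (D x)"
          by (simp add: fun_eq_iff D_def \<psi>t_def \<psi>y_def blinfun.bilinear_simps algebra_simps)
        finally show "(\<psi> has_derivative blinfun_apply (D x)) (at x)" .
      next
        have "continuous_on UNIV (\<lambda>x :: real \<times> real. g (fst x))" "continuous_on UNIV (\<lambda>x :: real \<times> real. R (fst x))"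
          by (intro continuous_on_compose2[OF g(2)] continuous_on_compose2[OF R_cont] continuous_intros; simp)+
        then show "continuous_on UNIV D"
          unfolding D_def \<psi>t_def \<psi>y_def by (intro continuous_intros)
      qed
      have \<psi>_cont: "isCont \<psi> x" for x
        using D unfolding C1_with_derivative_def by (blast intro: has_derivative_continuous)
      define \<Phi> where "\<Phi> x = w x - \<psi> x" for x
      have \<Phi>_usc: "upper_semicontinuous \<Phi>"
        unfolding \<Phi>_def by (rule upper_semicontinuous_diff[OF w(1) \<psi>_cont])
      have \<Phi>_le: "\<Phi> (t, y) \<le> (a + c * (1 + \<bar>y0\<bar>)) + ((b + c) * \<bar>t\<bar> - \<epsilon> * \<bar>t\<bar>\<^sup>2) + (c * \<bar>y - y0\<bar> - k * \<bar>y - y0\<bar>\<^sup>2)" for t y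
      proof -
        have "w (t, y) \<le> c * (1 + \<bar>t\<bar> + \<bar>y\<bar>)" using w(2) by (simp add: linearly_bounded_def abs_le_iff)
        also have "\<dots> \<le> c * (1 + \<bar>t\<bar> + (\<bar>y0\<bar> + \<bar>y - y0\<bar>))" using c by (intro mult_left_mono) auto
        finally have "w (t, y) \<le> c * (1 + \<bar>t\<bar> + (\<bar>y0\<bar> + \<bar>y - y0\<bar>))" .
        moreover have "- R t \<le> a + b * \<bar>t\<bar>" using ab(3)[of t] by simp
        moreover have "\<epsilon> * (1 / \<alpha>\<^sup>2) \<ge> 0" using \<epsilon> by simp
        ultimately show ?thesis unfolding \<Phi>_def \<psi>_def by (simp add: algebra_simps)
      qed
      define A where "A = a + c * (1 + \<bar>y0\<bar>) + (b + c)\<^sup>2 / (4 * (\<epsilon> / 2)) + c\<^sup>2 / (4 * (k / 2))"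
      have k0: "k > 0" using c k by simp
      have \<Phi>_le': "\<Phi> (t, y) \<le> A - \<epsilon> / 2 * t\<^sup>2 - k / 2 * (y - y0)\<^sup>2" for t y
      proof -
        have "\<epsilon> * \<bar>t\<bar>\<^sup>2 = \<epsilon> / 2 * \<bar>t\<bar>\<^sup>2 + \<epsilon> / 2 * t\<^sup>2" "k * \<bar>y - y0\<bar>\<^sup>2 = k / 2 * \<bar>y - y0\<bar>\<^sup>2 + k / 2 * (y - y0)\<^sup>2"
          by simp_all
        moreover have "(b + c) * \<bar>t\<bar> - \<epsilon> / 2 * \<bar>t\<bar>\<^sup>2 \<le> (b + c)\<^sup>2 / (4 * (\<epsilon> / 2))"
          by (rule linear_minus_quadratic_le) (use \<epsilon> in simp)
        moreover have "c * \<bar>y - y0\<bar> - k / 2 * \<bar>y - y0\<bar>\<^sup>2 \<le> c\<^sup>2 / (4 * (k / 2))"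
          by (rule linear_minus_quadratic_le) (use k0 in simp)
        ultimately show ?thesis using \<Phi>_le[of t y] unfolding A_def by linarith
      qed
      \<comment> \<open>Outside the box \<open>S\<close> one quadratic term of
        \<open>\<Phi>_le'\<close> exceeds \<open>A - \<Phi> (t0, y0)\<close>, so a maximum on
        \<open>S\<close> is global. \<open>T\<close> and \<open>Y\<close> are at least 1, so that
        \<open>r \<le> r\<^sup>2\<close> converts distances into squares.\<close>
      define T where "T = 2 * (\<bar>A - \<Phi> (t0, y0)\<bar> + 1) / \<epsilon> + 1 + \<bar>t0\<bar>"
      define Y where "Y = 2 * (\<bar>A - \<Phi> (t0, y0)\<bar> + 1) / k + 1"
      define S where "S = {- T..T} \<times> {y0 - Y..y0 + Y}"
      have T: "T \<ge> 1" "\<bar>t0\<bar> \<le> T" using \<epsilon> by (auto simp: T_def)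
      have Y: "Y \<ge> 1" using k0 by (simp add: Y_def)
      have in_S: "(t0, y0) \<in> S" using T Y unfolding S_def mem_Times_iff fst_conv snd_conv atLeastAtMost_iff by linarith
      have "compact S" "S \<noteq> {}" using in_S unfolding S_def by (blast intro: compact_Times compact_Icc)+
      then obtain x1 where x1: "x1 \<in> S" "\<forall>y\<in>S. \<Phi> y \<le> \<Phi> x1"
        using usc_attains_max[OF \<Phi>_usc] by metis
      have sq: "r \<le> r\<^sup>2" if "r \<ge> 1" for r :: real
        using that mult_left_mono[of 1 r r] by (simp add: power2_eq_square)
      have glob: "\<Phi> x \<le> \<Phi> x1" for x
      proof (cases "x \<in> S")
        case False
        obtain t y where x: "x = (t, y)" by (cases x)
        have "\<Phi> (t, y) \<le> \<Phi> (t0, y0)"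
        proof (cases "\<bar>t\<bar> \<le> T")
          case True
          have "\<bar>y - y0\<bar> > Y"
          proof (rule ccontr)
            assume "\<not> \<bar>y - y0\<bar> > Y"
            then have "x \<in> S"
              using True unfolding S_def x mem_Times_iff fst_conv snd_conv atLeastAtMost_iff by linarith
            then show False using False by simp
          qed
          then have "Y \<le> (y - y0)\<^sup>2" using sq[of "\<bar>y - y0\<bar>"] Y by simp
          then have "k / 2 * Y \<le> k / 2 * (y - y0)\<^sup>2" using k0 by (intro mult_left_mono) auto
          moreover have "k / 2 * Y = \<bar>A - \<Phi> (t0, y0)\<bar> + 1 + k / 2"
            using k0 by (simp add: Y_def field_simps)
          moreover have "\<epsilon> / 2 * t\<^sup>2 \<ge> 0" using \<epsilon> by simp
          ultimately show ?thesis using \<Phi>_le'[of t y] k0 by linarith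
        next
          case False
          then have "T \<le> t\<^sup>2" using sq[of "\<bar>t\<bar>"] T by simp
          then have "\<epsilon> / 2 * T \<le> \<epsilon> / 2 * t\<^sup>2" using \<epsilon> by (intro mult_left_mono) auto
          moreover have "\<epsilon> / 2 * T \<ge> \<bar>A - \<Phi> (t0, y0)\<bar>" 
          proof -
            have "\<epsilon> / 2 * T = \<bar>A - \<Phi> (t0, y0)\<bar> + 1 + \<epsilon> / 2 * (1 + \<bar>t0\<bar>)"
              using \<epsilon> by (simp add: T_def field_simps)
            moreover have "\<epsilon> / 2 * (1 + \<bar>t0\<bar>) \<ge> 0" using \<epsilon> by simp
            ultimately show ?thesis by linarith
          qed
          moreover have "k / 2 * (y - y0)\<^sup>2 \<ge> 0" using k0 by simp
          ultimately show ?thesis using \<Phi>_le'[of t y] by linarith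
        qed
        then show ?thesis using bspec[OF x1(2) in_S] x by simp
      qed (use x1 in blast)
      obtain t y where x1_eq: "x1 = (t, y)" by (cases x1)
      have "local_max_at (\<lambda>x. w x - \<psi> x) (t, y)"
        unfolding local_max_at_def using glob unfolding \<Phi>_def x1_eq by simp
      from visc[OF D this] have "\<psi>t (t, y) \<le> \<alpha> * (f (t, y) - w (t, y))"
        by (simp add: D_def blinfun.bilinear_simps)
      \<comment> \<open>The term \<open>1 / \<alpha>\<^sup>2\<close> in \<open>\<psi>\<close>
        completes the square here, so the penalty in time contributes a nonnegative amount and
        \<open>\<psi>\<close> stays a supersolution.\<close>
      moreover have "\<psi>t (t, y) + \<alpha> * \<psi> (t, y) = \<alpha> * (g t + k * (y - y0)\<^sup>2) + \<alpha> * \<epsilon> * (t + 1 / \<alpha>)\<^sup>2"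
        using \<alpha> by (simp add: \<psi>t_def \<psi>_def field_simps power2_eq_square)
      moreover have "\<alpha> * f (t, y) \<le> \<alpha> * (g t + k * (y - y0)\<^sup>2)"
        using sup_convolution_upper[OF f(2) c k, of t y t y0] \<alpha> unfolding g_def
        by (intro mult_left_mono) auto
      moreover have "\<alpha> * \<epsilon> * (t + 1 / \<alpha>)\<^sup>2 \<ge> 0" using \<alpha> \<epsilon> by simp
      ultimately have "\<alpha> * w (t, y) \<le> \<alpha> * \<psi> (t, y)" by (simp add: algebra_simps)
      then have "\<Phi> (t, y) \<le> 0" using \<alpha> by (simp add: \<Phi>_def)
      then have "\<Phi> (t0, y0) \<le> 0" using bspec[OF x1(2) in_S] x1_eq by simp
      then show ?thesis by (simp add: \<Phi>_def \<psi>_def)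
    qed
    have "w (t0, y0) \<le> R t0"
    proof (rule field_le_epsilon)
      fix e :: real assume e: "e > 0"
      define q where "q = t0\<^sup>2 + 1 / \<alpha>\<^sup>2"
      have q: "q > 0" using \<alpha> by (simp add: q_def add_nonneg_pos)
      show "w (t0, y0) \<le> R t0 + e"
        using main[of "e / q"] e q unfolding q_def[symmetric] by simp
    qed
    then show ?thesis unfolding R_def g_def .
  qed
  \<comment> \<open>The bound in \<open>sup_convolution_abs\<close> does not involve
    \<open>k\<close>, so it dominates as \<open>k = c + i\<close> tends to infinity.\<close>
  have "(\<lambda>i. relax \<alpha> (sup_convolution (c + real i) y0 f) t0) \<longlonglongrightarrow> relax \<alpha> (\<lambda>t. f (t, y0)) t0"
    unfolding relax_def
  proof (rule integral_dominated_convergence)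
    have [measurable]: "(\<lambda>t. f (t, y0)) \<in> borel_measurable borel" by (rule usc_slice_measurable[OF f(1)])
    have [measurable]: "sup_convolution (c + real i) y0 f \<in> borel_measurable borel" for i
      by (rule linear_growth_measurable[OF linear_growth_sup_convolution[OF f(2) c]]) simp
    show "(\<lambda>s. f (t0 - s, y0)) \<in> borel_measurable (expo \<alpha>)"
      "(\<lambda>s. sup_convolution (c + real i) y0 f (t0 - s)) \<in> borel_measurable (expo \<alpha>)" for i
      by measurable
    show "integrable (expo \<alpha>) (\<lambda>s. (c * (2 + \<bar>y0\<bar>) + c * \<bar>t0\<bar>) + c * s)" by (rule integrable_expo_affine[OF \<alpha>])
    show "AE s in expo \<alpha>. norm (sup_convolution (c + real i) y0 f (t0 - s)) \<le> (c * (2 + \<bar>y0\<bar>) + c * \<bar>t0\<bar>) + c * s" for i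
      using AE_expo_nonneg
    proof eventually_elim
      fix s :: real assume "s \<ge> 0"
      then have "c * \<bar>t0 - s\<bar> \<le> c * (\<bar>t0\<bar> + s)" using c by (intro mult_left_mono) auto
      then show "norm (sup_convolution (c + real i) y0 f (t0 - s)) \<le> (c * (2 + \<bar>y0\<bar>) + c * \<bar>t0\<bar>) + c * s"
        using sup_convolution_abs[OF f(2) c, of "c + real i" y0 "t0 - s"] by (simp add: algebra_simps)
    qed
    show "AE s in expo \<alpha>. (\<lambda>i. sup_convolution (c + real i) y0 f (t0 - s)) \<longlonglongrightarrow> f (t0 - s, y0)"
      by (intro AE_I2 sup_convolution_tendsto f c)
  qed
  then show ?thesis by (rule LIMSEQ_le_const) (auto intro!: conv exI[of _ 0])
qed

subsection \<open>Hull functions and fixed profiles\<close>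

lemma viscosity_super_ge_relax:
  assumes \<alpha>: "\<alpha> > 0" and w: "lower_semicontinuous w" "linearly_bounded c w"
    and f: "lower_semicontinuous f" "linearly_bounded c f" and c: "c > 0"
    and visc: "\<And>\<phi> D \<tau> y. C1_with_derivative \<phi> D \<Longrightarrow> local_min_at (\<lambda>x. w x - \<phi> x) (\<tau>, y) \<Longrightarrow>
      blinfun_apply (D (\<tau>, y)) (1, 0) \<ge> \<alpha> * (f (\<tau>, y) - w (\<tau>, y))"
  shows "relax \<alpha> (\<lambda>t. f (t, y0)) t0 \<le> w (t0, y0)"
proof -
  have "- w (t0, y0) \<le> relax \<alpha> (\<lambda>t. - f (t, y0)) t0"
  proof (rule viscosity_sub_le_relax[OF \<alpha> _ _ _ _ c])
    fix \<phi> D \<tau> y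
    assume \<phi>: "C1_with_derivative \<phi> D" and max: "local_max_at (\<lambda>x. - w x - \<phi> x) (\<tau>, y)"
    have "C1_with_derivative (\<lambda>x. - \<phi> x) (\<lambda>x. - D x)"
      using \<phi> unfolding C1_with_derivative_def
      by (auto intro: has_derivative_minus continuous_on_minus simp: uminus_blinfun.rep_eq)
    moreover have "local_min_at (\<lambda>x. w x - - \<phi> x) (\<tau>, y)"
      using max unfolding local_max_at_def local_min_at_def
      by (rule eventually_mono) simp
    ultimately show "blinfun_apply (D (\<tau>, y)) (1, 0) \<le> \<alpha> * (- f (\<tau>, y) - - w (\<tau>, y))"
      using visc[of "\<lambda>x. - \<phi> x" "\<lambda>x. - D x" \<tau> y] by (simp add: uminus_blinfun.rep_eq algebra_simps)
  next
    show "upper_semicontinuous (\<lambda>x. - w x)" "upper_semicontinuous (\<lambda>x. - f x)"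
      using w(1) f(1) unfolding lower_semicontinuous_uminus .
    show "linearly_bounded c (\<lambda>x. - w x)" "linearly_bounded c (\<lambda>x. - f x)"
      using w(2) f(2) unfolding linearly_bounded_def by simp_all
  qed
  then show ?thesis unfolding relax_def by simp
qed

lemma linearly_boundedI:
  assumes "\<And>t y. \<bar>f (t, y) - (a * t + b * y + d)\<bar> \<le> C"
  shows "linearly_bounded (C + \<bar>a\<bar> + \<bar>b\<bar> + \<bar>d\<bar>) f"
  unfolding linearly_bounded_def
proof (intro allI)
  fix t y
  have C: "C \<ge> 0" using assms[of 0 0] abs_ge_zero order_trans by blast
  have "\<bar>a * t\<bar> = \<bar>a\<bar> * \<bar>t\<bar>" "\<bar>b * y\<bar> = \<bar>b\<bar> * \<bar>y\<bar>" by (simp_all add: abs_mult)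
  then have "\<bar>f (t, y)\<bar> \<le> C + \<bar>a\<bar> * \<bar>t\<bar> + \<bar>b\<bar> * \<bar>y\<bar> + \<bar>d\<bar>" using assms[of t y] by linarith
  also have "\<dots> \<le> (C + \<bar>a\<bar> + \<bar>b\<bar> + \<bar>d\<bar>) * (1 + \<bar>t\<bar> + \<bar>y\<bar>)"
    using C by (simp add: algebra_simps add_nonneg_nonneg)
  finally show "\<bar>f (t, y)\<bar> \<le> (C + \<bar>a\<bar> + \<bar>b\<bar> + \<bar>d\<bar>) * (1 + \<bar>t\<bar> + \<bar>y\<bar>)" .
qed

lemma linearly_bounded_mono: "linearly_bounded c f \<Longrightarrow> c \<le> c' \<Longrightarrow> linearly_bounded c' f"
  unfolding linearly_bounded_def by (meson abs_ge_zero add_nonneg_nonneg mult_right_mono order_trans zero_le_one)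

section \<open>Touching test functions and envelopes along characteristics\<close>

lemma C1_time_derivative:
  assumes "C1_with_derivative \<phi> D" "((\<lambda>t. w (t, y)) has_real_derivative d) (at \<tau>)"
  shows "((\<lambda>t. w (t, y) - \<phi> (t, y)) has_real_derivative d - blinfun_apply (D (\<tau>, y)) (1, 0)) (at \<tau>)"
proof -
  have slice: "((\<lambda>t. (t, y)) has_derivative (\<lambda>h. (h, 0))) (at \<tau>)"
    by (intro has_derivative_Pair has_derivative_ident has_derivative_const)
  have "(\<phi> has_derivative blinfun_apply (D (\<tau>, y))) (at (\<tau>, y))"
    using assms(1) by (simp add: C1_with_derivative_def)
  from has_derivative_compose[OF slice this]
  have "((\<lambda>t. \<phi> (t, y)) has_derivative (\<lambda>h. blinfun_apply (D (\<tau>, y)) (h, 0))) (at \<tau>)" .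
  also have "(\<lambda>h. blinfun_apply (D (\<tau>, y)) (h, 0)) = (\<lambda>h. blinfun_apply (D (\<tau>, y)) (1, 0) * h)"
  proof
    fix h
    have "blinfun_apply (D (\<tau>, y)) (h *\<^sub>R (1, 0)) = h *\<^sub>R blinfun_apply (D (\<tau>, y)) (1, 0)"
      by (rule blinfun.scaleR_right)
    then show "blinfun_apply (D (\<tau>, y)) (h, 0) = blinfun_apply (D (\<tau>, y)) (1, 0) * h" by simp
  qed
  finally have "((\<lambda>t. \<phi> (t, y)) has_real_derivative blinfun_apply (D (\<tau>, y)) (1, 0)) (at \<tau>)"
    by (simp add: has_field_derivative_def)
  from DERIV_diff[OF assms(2) this] show ?thesis .
qed

lemma eventually_slice:
  assumes "\<forall>\<^sub>F x in nhds (\<tau> :: real, y :: real). Q x"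
  shows "\<exists>d>0. \<forall>t. \<bar>\<tau> - t\<bar> < d \<longrightarrow> Q (t, y)"
proof -
  obtain d where d: "d > 0" "\<And>x. dist x (\<tau>, y) < d \<Longrightarrow> Q x"
    using assms by (auto simp: eventually_nhds_metric)
  show ?thesis
  proof (intro exI conjI allI impI)
    show "d > 0" by (rule d(1))
    show "Q (t, y)" if "\<bar>\<tau> - t\<bar> < d" for t
      by (rule d(2)) (use that in \<open>simp add: dist_Pair_Pair dist_real_def abs_minus_commute\<close>)
  qed
qed

text \<open>Only the time derivative occurs in the equations. A function differentiable in time on
  each vertical line therefore meets every touching test function with equality, even if it jumps in
  \<open>y\<close>.\<close>

lemma local_max_time_derivative:
  assumes "C1_with_derivative \<phi> D" "((\<lambda>t. w (t, y)) has_real_derivative d) (at \<tau>)"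
    and "local_max_at (\<lambda>x. w x - \<phi> x) (\<tau>, y)"
  shows "blinfun_apply (D (\<tau>, y)) (1, 0) = d"
proof -
  from eventually_slice[OF assms(3)[unfolded local_max_at_def]] obtain e
    where "e > 0" "\<forall>t. \<bar>\<tau> - t\<bar> < e \<longrightarrow> w (t, y) - \<phi> (t, y) \<le> w (\<tau>, y) - \<phi> (\<tau>, y)" by (elim exE conjE)
  from DERIV_local_max[OF C1_time_derivative[OF assms(1,2)] this] show ?thesis by simp
qed

lemma local_min_time_derivative:
  assumes "C1_with_derivative \<phi> D" "((\<lambda>t. w (t, y)) has_real_derivative d) (at \<tau>)"
    and "local_min_at (\<lambda>x. w x - \<phi> x) (\<tau>, y)"
  shows "blinfun_apply (D (\<tau>, y)) (1, 0) = d"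
proof -
  from eventually_slice[OF assms(3)[unfolded local_min_at_def]] obtain e
    where "e > 0" "\<forall>t. \<bar>\<tau> - t\<bar> < e \<longrightarrow> w (\<tau>, y) - \<phi> (\<tau>, y) \<le> w (t, y) - \<phi> (t, y)" by (elim exE conjE)
  from DERIV_local_min[OF C1_time_derivative[OF assms(1,2)] this] show ?thesis by simp
qed

lemma isCont_tendsto_nhds: "isCont f x \<Longrightarrow> (f \<longlongrightarrow> f x) (nhds x)"
  by (simp add: isCont_def tendsto_at_iff_tendsto_nhds)

text \<open>In these coordinates the characteristics of speed \<open>lam\<close> are the lines of
  constant \<open>y\<close>.\<close>

definition along :: "real \<Rightarrow> real \<Rightarrow> (real \<times> real \<Rightarrow> real) \<Rightarrow> real \<times> real \<Rightarrow> real" where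
  "along lam p f = (\<lambda>(\<tau>, y). f (\<tau>, lam * \<tau> + p * y))"

lemma along_apply [simp]: "along lam p f (\<tau>, y) = f (\<tau>, lam * \<tau> + p * y)"
  by (simp add: along_def)

lemma isCont_affine: "isCont (\<lambda>x. a * fst x + b * snd x + d) (x :: real \<times> real)"
  by (intro continuous_intros)

lemma locally_bounded_along:
  assumes "\<And>\<tau> z. \<bar>f (\<tau>, z) - z\<bar> \<le> C"
  shows "locally_bounded (along lam p f)"
  by (rule locally_bounded_near_continuous[where g="\<lambda>x. lam * fst x + p * snd x + 0" and C=C, OF isCont_affine])
     (use assms in \<open>auto simp: along_def\<close>)

lemma eventually_along:
  fixes \<tau> y :: real
  assumes "\<forall>\<^sub>F t in nhds \<tau>. Q t" "\<forall>\<^sub>F y' in nhds y. R y'"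
  shows "\<forall>\<^sub>F x in nhds (\<tau>, y). Q (fst x) \<and> R (snd x)"
  unfolding nhds_prod using eventually_prodI[OF assms] by (simp add: case_prod_beta')

text \<open>The envelope is the right limit in \<open>z\<close>: continuity along a characteristic
  slightly to the right of the point gives an upper bound for nearby times, and monotonicity
  transfers it to all points further left, hence to a neighbourhood.\<close>

lemma usc_envelope_along:
  assumes "p > 0" and bound: "\<And>\<tau> z. \<bar>f (\<tau>, z) - z\<bar> \<le> C"
    and mono: "\<And>\<tau> z z'. z \<le> z' \<Longrightarrow> f (\<tau>, z) \<le> f (\<tau>, z')"
    and cont: "\<And>c \<tau>. isCont (\<lambda>t. f (t, lam * t + c)) \<tau>"
    and lim: "\<And>\<tau> z. (\<lambda>r. f (\<tau>, z + 1 / (Suc r))) \<longlonglongrightarrow> f' (\<tau>, z)"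
  shows "usc_envelope (along lam p f) = along lam p f'"
proof
  fix x :: "real \<times> real"
  obtain \<tau> y where x: "x = (\<tau>, y)" by (cases x)
  define z where "z = lam * \<tau> + p * y"
  define d where "d r = 1 / (Suc r) / p" for r
  have pd: "p * d r = 1 / (Suc r)" for r using assms(1) by (simp add: d_def)
  have d: "d \<longlonglongrightarrow> 0"
    unfolding d_def using tendsto_divide[OF LIMSEQ_inverse_real_of_nat tendsto_const[of p]] assms(1)
    by (simp add: inverse_eq_divide)
  have "usc_envelope (along lam p f) (\<tau>, y) = f' (\<tau>, z)"
  proof (rule usc_envelope_eqI[OF locally_bounded_along[OF bound]])
    show "(\<lambda>r. (\<tau>, y + d r)) \<longlonglongrightarrow> (\<tau>, y)"
      using tendsto_Pair[OF tendsto_const tendsto_add[OF tendsto_const d]] by simp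
    have "along lam p f (\<tau>, y + d r) = f (\<tau>, z + 1 / (Suc r))" for r
      using pd[of r] by (simp add: z_def algebra_simps)
    then show "(\<lambda>r. along lam p f (\<tau>, y + d r)) \<longlonglongrightarrow> f' (\<tau>, z)" using lim by simp
    fix \<epsilon> :: real assume "\<epsilon> > 0"
    then have "\<forall>\<^sub>F r in sequentially. f (\<tau>, z + 1 / (Suc r)) < f' (\<tau>, z) + \<epsilon>"
      using order_tendstoD(2)[OF lim] by simp
    then obtain r where r: "f (\<tau>, z + 1 / (Suc r)) < f' (\<tau>, z) + \<epsilon>"
      by (auto simp: eventually_sequentially)
    have "\<forall>\<^sub>F t in nhds \<tau>. f (t, lam * t + (p * y + 1 / (Suc r))) < f' (\<tau>, z) + \<epsilon>"
    proof (rule order_tendstoD(2))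
      show "((\<lambda>t. f (t, lam * t + (p * y + 1 / (Suc r)))) \<longlongrightarrow> f (\<tau>, lam * \<tau> + (p * y + 1 / (Suc r)))) (nhds \<tau>)"
        by (rule isCont_tendsto_nhds[OF cont])
    qed (use r in \<open>simp add: z_def algebra_simps\<close>)
    moreover have "\<forall>\<^sub>F y' in nhds y. y' < y + d r"
      using assms(1) by (intro eventually_nhds_in_open[THEN eventually_mono, of "{..<y + d r}"]) (auto simp: d_def)
    ultimately have "\<forall>\<^sub>F x in nhds (\<tau>, y). f (fst x, lam * fst x + (p * y + 1 / (Suc r))) < f' (\<tau>, z) + \<epsilon> \<and> snd x < y + d r"
      by (rule eventually_along)
    then show "\<forall>\<^sub>F x in nhds (\<tau>, y). along lam p f x \<le> f' (\<tau>, z) + \<epsilon>"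
    proof eventually_elim
      case (elim x)
      have "p * snd x \<le> p * (y + d r)" using elim assms(1) by (intro mult_left_mono) auto
      then have "p * snd x \<le> p * y + 1 / (Suc r)" using pd[of r] by (simp add: algebra_simps)
      then have "f (fst x, lam * fst x + p * snd x) \<le> f (fst x, lam * fst x + (p * y + 1 / (Suc r)))"
        by (intro mono) simp
      then show ?case using elim by (cases x) auto
    qed
  qed
  then show "usc_envelope (along lam p f) x = along lam p f' x" by (simp add: x z_def)
qed

text \<open>Changing the signs of \<open>f\<close> and of \<open>z\<close> reduces this to
  \<open>usc_envelope_along\<close> at speed \<open>- lam\<close>; in the plane it is the reflection
  of \<open>y\<close>.\<close>

lemma lsc_envelope_along:
  assumes "p > 0" and bound: "\<And>\<tau> z. \<bar>f (\<tau>, z) - z\<bar> \<le> C"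
    and mono: "\<And>\<tau> z z'. z \<le> z' \<Longrightarrow> f (\<tau>, z) \<le> f (\<tau>, z')"
    and cont: "\<And>c \<tau>. isCont (\<lambda>t. f (t, lam * t + c)) \<tau>"
    and lim: "\<And>\<tau> z. (\<lambda>r. f (\<tau>, z - 1 / (Suc r))) \<longlonglongrightarrow> f' (\<tau>, z)"
  shows "lsc_envelope (along lam p f) = along lam p f'"
proof
  fix x :: "real \<times> real"
  obtain \<tau> y where x: "x = (\<tau>, y)" by (cases x)
  define h where "h x = - f (fst x, - snd x)" for x
  define h' where "h' x = - f' (fst x, - snd x)" for x
  have env: "usc_envelope (along (- lam) p h) = along (- lam) p h'"
  proof (rule usc_envelope_along[OF assms(1), where C=C])
    show "\<bar>h (\<tau>, z) - z\<bar> \<le> C" for \<tau> z using bound[of \<tau> "- z"] by (simp add: h_def abs_le_iff)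
    show "h (\<tau>, z) \<le> h (\<tau>, z')" if "z \<le> z'" for \<tau> z z' using mono[of "- z'" "- z" \<tau>] that by (simp add: h_def)
    show "isCont (\<lambda>t. h (t, - lam * t + c)) \<tau>" for c \<tau>
      using isCont_minus[OF cont[where c="- c" and \<tau>=\<tau>]] by (simp add: h_def)
    show "(\<lambda>r. h (\<tau>, z + 1 / (Suc r))) \<longlonglongrightarrow> h' (\<tau>, z)" for \<tau> z
      using tendsto_minus[OF lim[of \<tau> "- z"]] by (simp add: h_def h'_def)
  qed
  have flip: "along (- lam) p h x = - along lam p f (fst x, - snd x)" for x
    by (cases x) (simp add: h_def)
  have lim_flip: "Limsup (nhds (\<tau>, - y)) (\<lambda>x. ereal (- along lam p f (fst x, - snd x))) = Limsup (nhds (\<tau>, y)) (\<lambda>x. ereal (- along lam p f x))"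
  proof -
    have "nhds (\<tau>, - y) = filtermap (\<lambda>x. (fst x, - snd x)) (nhds (\<tau>, y))"
    proof -
      have "nhds (\<tau>, - y) = nhds \<tau> \<times>\<^sub>F filtermap uminus (nhds y)"
        unfolding nhds_prod filtermap_nhds_minus ..
      also have "\<dots> = filtermap (\<lambda>x. (fst x, - snd x)) (nhds \<tau> \<times>\<^sub>F nhds y)"
        using prod_filtermap2[of "nhds \<tau>" uminus "nhds y"] by (simp add: apsnd_def map_prod_def case_prod_beta')
      finally show ?thesis unfolding nhds_prod .
    qed
    moreover have "inj (\<lambda>x :: real \<times> real. (fst x, - snd x))"
      by (rule injI) (simp add: prod_eq_iff)
    note Limsup_filtermap_eq[OF this, of "nhds (\<tau>, y)" "\<lambda>x. ereal (- along lam p f (fst x, - snd x))"]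
    ultimately show ?thesis unfolding fst_conv snd_conv minus_minus prod.collapse by (rule subst[OF sym])
  qed
  have "lsc_envelope (along lam p f) (\<tau>, y) = - usc_envelope (along (- lam) p h) (\<tau>, - y)"
    unfolding lsc_envelope_uminus usc_envelope_def flip lim_flip ..
  then show "lsc_envelope (along lam p f) x = along lam p f' x"
    unfolding x env by (simp add: h'_def add.commute)
qed

context cooperative
begin

section \<open>Fixed profiles yield hull functions\<close>

lemma profile_translate:
  assumes "profile p C h" "\<bar>d\<bar> \<le> 1"
  shows "profile p (C + 1) (\<lambda>j x. h j (fst x, snd x + d))"
proof -
  note D = profileD[OF assms(1)]
  have "(\<lambda>x. h j (fst x, snd x + d)) \<in> borel_measurable borel" for j
  proof -
    have [measurable]: "h j \<in> borel_measurable (borel \<Otimes>\<^sub>M borel)" using D(1) by (simp add: borel_prod)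
    have "(\<lambda>x. h j (fst x, snd x + d)) \<in> borel_measurable (borel \<Otimes>\<^sub>M borel)" by measurable
    then show ?thesis by (simp add: borel_prod)
  qed
  moreover have "\<bar>h 0 (\<tau>, z + d) - z\<bar> \<le> C + 1" for \<tau> z
    using D(7)[of \<tau> "z + d"] assms(2) by linarith
  moreover have "h j (\<tau>, z + 1 + d) = h j (\<tau>, z + d) + 1" for j \<tau> z
    using D(3)[of j \<tau> "z + d"] by (simp add: algebra_simps)
  moreover have "h (j + int n) (\<tau>, z + d) = h j (\<tau>, z + p + d)" for j \<tau> z
    using D(4)[of j \<tau> "z + d"] by (simp add: algebra_simps)
  ultimately show ?thesis unfolding profile_def using D(2,5,6) by auto
qed

text \<open>\<open>G\<close> depends on time but not on \<open>z\<close>, so translates in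
  \<open>z\<close> of a fixed profile are fixed. Along a monotone \<open>\<delta>\<close> they
  converge, and the limit is fixed by \<open>step_tendsto\<close>. Sequences decreasing and
  increasing to 0 produce the two semicontinuous envelopes, which are therefore fixed profiles
  too.\<close>

lemma translated_limit:
  assumes h: "profile p C h" and fixed: "step lam l h = h" and "p \<ge> 0"
    and \<delta>: "\<delta> \<longlonglongrightarrow> 0" "monoseq \<delta>" "\<And>r. \<bar>\<delta> r\<bar> \<le> 1"
  obtains h' where "profile p (C + 1) h'" "step lam l h' = h'"
    "\<And>j \<tau> z. (\<lambda>r. h j (\<tau>, z + \<delta> r)) \<longlonglongrightarrow> h' j (\<tau>, z)"
    "\<And>j \<tau> z. (\<lambda>r. advect lam (react l h j) (\<tau>, z + \<delta> r)) \<longlonglongrightarrow> advect lam (react l h' j) (\<tau>, z)"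
proof -
  define e where "e r j x = h j (fst x, snd x + \<delta> r)" for r j x
  have e: "profile p (C + 1) (e r)" for r
    unfolding e_def by (rule profile_translate[OF h \<delta>(3)])
  have react_e: "react l (e r) j x = react l h j (fst x, snd x + \<delta> r)" for r j x
    unfolding react_def e_def by simp
  have advect_e: "advect lam (\<lambda>x. f (fst x, snd x + d)) x = advect lam f (fst x, snd x + d)" for f d x
    unfolding advect_def by (simp add: algebra_simps)
  have react_e': "react l (e r) j = (\<lambda>x. react l h j (fst x, snd x + \<delta> r))" for r j
    by (rule ext) (rule react_e)
  have step_e: "step lam l (e r) = e r" for r
  proof (intro ext)
    fix j x
    have "advect lam (react l (e r) j) = (\<lambda>x. advect lam (react l h j) (fst x, snd x + \<delta> r))" 
      unfolding react_e' by (rule ext) (rule advect_e)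
    then have "step lam l (e r) j x = advect lam (\<lambda>x. advect lam (react l h j) (fst x, snd x + \<delta> r)) x"
      unfolding step_def by simp
    also have "\<dots> = step lam l h j (fst x, snd x + \<delta> r)"
      unfolding step_def by (rule advect_e)
    finally show "step lam l (e r) j x = e r j x" unfolding fixed e_def .
  qed
  have conv: "convergent (\<lambda>r. e r j x)" for j x
  proof (rule Bseq_monoseq_convergent)
    obtain \<tau> z where x: "x = (\<tau>, z)" by (cases x)
    have "\<bar>e r j x\<bar> \<le> \<bar>z\<bar> + \<bar>p / n * j\<bar> + (C + 1 + 2 * p)" for r
      using profile_bound[OF e assms(3), of r j \<tau> z] unfolding x by linarith
    then show "Bseq (\<lambda>r. e r j x)" by (intro BseqI') auto
    show "monoseq (\<lambda>r. e r j x)"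
      using \<delta>(2) profileD(6)[OF h] unfolding monoseq_def e_def by (meson add_left_mono)
  qed
  define h' where "h' j x = lim (\<lambda>r. e r j x)" for j x
  have lim: "(\<lambda>r. e r j x) \<longlonglongrightarrow> h' j x" for j x
    unfolding h'_def using conv by (simp add: convergent_LIMSEQ_iff)
  have h': "profile p (C + 1) h'" by (rule profile_limit[OF e lim])
  have "step lam l h' j x = h' j x" for j x
  proof (rule LIMSEQ_unique)
    show "(\<lambda>r. step lam l (e r) j x) \<longlonglongrightarrow> step lam l h' j x"
      by (rule step_tendsto[where e=e, OF e h' assms(3) lim])
    show "(\<lambda>r. step lam l (e r) j x) \<longlonglongrightarrow> h' j x" unfolding step_e by (rule lim)
  qed
  then have fixed': "step lam l h' = h'" by (simp add: fun_eq_iff)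
  have "(\<lambda>r. advect lam (react l (e r) j) x) \<longlonglongrightarrow> advect lam (react l h' j) x" for j x
  proof (rule advect_tendsto)
    note R = profile_react[OF e assms(3), of l] profile_react[OF h' assms(3), of l]
    show "react l (e r) j \<in> borel_measurable borel" "react l h' j \<in> borel_measurable borel" for r
      by (rule profileD(1)[OF R(1)], rule profileD(1)[OF R(2)])
    show "\<bar>react l (e r) j (\<tau>, z) - z\<bar> \<le> C + 1 + (B + K * window_width p + \<bar>l\<bar>) + 2 * p + \<bar>p / n * j\<bar>" for r \<tau> z
      using profile_bound[OF R(1) assms(3), of r j \<tau> z] by linarith
  qed (rule react_tendsto, rule lim)
  then have "(\<lambda>r. advect lam (react l h j) (\<tau>, z + \<delta> r)) \<longlonglongrightarrow> advect lam (react l h' j) (\<tau>, z)" for j \<tau> z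
    unfolding react_e' advect_e by fastforce
  then show ?thesis using that[OF h' fixed'] lim unfolding e_def by fastforce
qed

text \<open>A bootstrap: \<open>g\<close> and \<open>h\<close> are relaxations on each
  characteristic, hence continuous there; so is \<open>react l h\<close>, by continuity of
  \<open>G\<close>; relaxations of continuous functions are differentiable.\<close>

lemma line_derivatives:
  assumes h: "profile p C h" and fixed: "step lam l h = h" and "p \<ge> 0"
  defines "g \<equiv> \<lambda>j. advect lam (react l h j)"
  shows "((\<lambda>t. h j (t, lam * t + c)) has_real_derivative
      \<alpha> * (g j (\<tau>, lam * \<tau> + c) - h j (\<tau>, lam * \<tau> + c))) (at \<tau>)" (is ?A)
    and "((\<lambda>t. g j (t, lam * t + c)) has_real_derivative
      \<alpha> * (react l h j (\<tau>, lam * \<tau> + c) - g j (\<tau>, lam * \<tau> + c))) (at \<tau>)" (is ?B)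
proof -
  note r = profile_react[OF h assms(3), of l] and a = profile_advect[OF profile_react[OF h assms(3), of l] assms(3), of lam]
  have hg: "h j (t, lam * t + c) = relax \<alpha> (\<lambda>t. g j (t, lam * t + c)) t" for j t
    using fun_cong[OF fun_cong[OF fixed, of j], of "(t, lam * t + c)"] unfolding step_def advect_line g_def by simp
  have gr: "g j (t, lam * t + c) = relax \<alpha> (\<lambda>t. react l h j (t, lam * t + c)) t" for j t
    unfolding g_def advect_line ..
  have lg: "linear_growth (\<lambda>t. g j (t, lam * t + c))" for j
    unfolding g_def by (rule linear_growth_profile[OF a assms(3)])
  have lr: "linear_growth (\<lambda>t. react l h j (t, lam * t + c))" for j
    by (rule linear_growth_profile[OF r assms(3)])
  have cg: "continuous_on UNIV (\<lambda>t. g j (t, lam * t + c))" for j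
    unfolding gr using relax_continuous[OF \<alpha>_pos lr] by (auto simp: continuous_on_eq_continuous_at)
  have ch: "continuous_on UNIV (\<lambda>t. h j (t, lam * t + c))" for j
    unfolding hg using relax_continuous[OF \<alpha>_pos lg] by (auto simp: continuous_on_eq_continuous_at)
  have "continuous_on UNIV (\<lambda>t. (t, \<lambda>i. h (j + i) (t, lam * t + c)))"
    by (intro continuous_on_Pair continuous_on_id continuous_on_coordinatewise_then_product ch)
  from continuous_on_compose2[OF G_continuous this, of j]
  have cr: "continuous_on UNIV (\<lambda>t. react l h j (t, lam * t + c))"
    unfolding react_def by (intro continuous_intros) simp
  show ?A unfolding hg by (rule relax_has_derivative[OF \<alpha>_pos lg cg])
  show ?B unfolding gr by (rule relax_has_derivative[OF \<alpha>_pos lr cr])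
qed

text \<open>A smaller speed reads a non-decreasing profile further to the right at every backward
  time, so the averages can only increase.\<close>

lemma sub_profile_slower:
  assumes e: "sub_profile p l lam e" and "lam' \<le> lam" "p \<ge> 0"
  shows "sub_profile p l lam' e"
proof -
  from e obtain C where C: "profile p C e" and sub: "\<And>j x. e j x \<le> step lam l e j x"
    by (auto simp: sub_profile_def)
  have adv: "advect lam (f j) x \<le> advect lam' (f j) x" if f: "profile p C' f" for f C' j x
  proof (cases x)
    case (Pair \<tau> z)
    have int: "integrable (expo \<alpha>) (\<lambda>s. f j (\<tau> - s, z - a * s))" for a
      using linear_growth_integrable[OF \<alpha>_pos linear_growth_profile'[OF f assms(3), of j z a \<tau>], of \<tau>] by simp
    show ?thesis unfolding Pair advect_def fst_conv snd_conv
      by (intro integral_expo_mono int profileD(6)[OF f]) (use assms(2) in \<open>simp add: mult_right_mono\<close>)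
  qed
  note r = profile_react[OF C assms(3), of l]
  have "step lam l e j x \<le> step lam' l e j x" for j x
  proof -
    have "step lam l e j x \<le> advect lam (advect lam' (react l e j)) x"
      unfolding step_def
      by (rule advect_mono[OF profile_advect[OF r assms(3)] profile_advect[OF r assms(3)] assms(3,3) adv[OF r]])
    also have "\<dots> \<le> step lam' l e j x"
      unfolding step_def by (rule adv[OF profile_advect[OF r assms(3)]])
    finally show ?thesis .
  qed
  then show ?thesis using C sub unfolding sub_profile_def by (meson order_trans)
qed

lemma super_profile_faster:
  assumes "super_profile p l lam e" "lam \<le> lam'" "p \<ge> 0"
  shows "super_profile p l lam' e"
proof -
  interpret R: cooperative n m \<alpha> K B P "reflect_G G" by (rule cooperative_reflect)
  show ?thesis
    using assms R.sub_profile_slower[of p "- l" "- lam" "reflect e" "- lam'"]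
    unfolding super_profile_iff_reflect by simp
qed

text \<open>A monotone \<open>G\<close> lets upper bounds on the coordinates near \<open>x\<close>
  pass through it, and continuity handles the change of time.\<close>

lemma usc_G:
  assumes "\<And>i. upper_semicontinuous (v i)"
  shows "upper_semicontinuous (\<lambda>x :: real \<times> real. G j (fst x) (\<lambda>i. v i x) + l)"
  unfolding upper_semicontinuous_def
proof (intro allI impI)
  fix x a assume a: "a > G j (fst x) (\<lambda>i. v i x) + l"
  \<comment> \<open>Raising all coordinates by \<open>\<epsilon>\<close> costs at most
    \<open>K * \<epsilon>\<close>; dividing by \<open>K + 1\<close> leaves a margin
    \<open>\<epsilon>\<close> and hence a strict inequality.\<close>
  define \<epsilon> where "\<epsilon> = (a - (G j (fst x) (\<lambda>i. v i x) + l)) / (K + 1)"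
  define V where "V i = v i x + \<epsilon>" for i
  have \<epsilon>: "\<epsilon> > 0" "(K + 1) * \<epsilon> = a - (G j (fst x) (\<lambda>i. v i x) + l)"
    using a K_nonneg by (auto simp: \<epsilon>_def)
  have GV: "G j (fst x) V + l < a"
    using G_lipschitz[of \<epsilon> j "fst x" "\<lambda>i. v i x"] \<epsilon> unfolding V_def by (simp add: algebra_simps)
  have "continuous_on UNIV (\<lambda>x :: real \<times> real. (fst x, V))" by (intro continuous_intros)
  from continuous_on_compose2[OF G_continuous this, of j]
  have "continuous_on UNIV (\<lambda>x :: real \<times> real. G j (fst x) V + l)"
    by (intro continuous_intros) simp
  from isCont_tendsto_nhds[OF continuous_on_interior[OF this]]
  have "((\<lambda>x. G j (fst x) V + l) \<longlongrightarrow> G j (fst x) V + l) (nhds x)" by simp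
  from order_tendstoD(2)[OF this GV] have "\<forall>\<^sub>F y in nhds x. G j (fst y) V + l < a" .
  moreover have "\<forall>\<^sub>F y in nhds x. \<forall>i\<in>{- int m..int m}. v i y < V i"
  proof (intro eventually_ball_finite ballI finite_atLeastAtMost_int)
    fix i
    have "v i x < V i" using \<epsilon>(1) by (simp add: V_def)
    then show "\<forall>\<^sub>F y in nhds x. v i y < V i"
      using assms[of i] unfolding upper_semicontinuous_def by blast
  qed
  ultimately show "\<forall>\<^sub>F y in nhds x. G j (fst y) (\<lambda>i. v i y) + l < a"
  proof eventually_elim
    case (elim y)
    have "G j (fst y) (\<lambda>i. v i y) \<le> G j (fst y) V" by (rule G_mono) (use elim in \<open>auto intro: less_imp_le\<close>)
    then show ?case using elim by simp
  qed
qed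

lemma lsc_G:
  assumes "\<And>i. lower_semicontinuous (v i)"
  shows "lower_semicontinuous (\<lambda>x :: real \<times> real. G j (fst x) (\<lambda>i. v i x) + l)"
proof -
  interpret R: cooperative n m \<alpha> K B P "reflect_G G" by (rule cooperative_reflect)
  have "upper_semicontinuous (\<lambda>x. - v (- i) x)" for i
    using assms[of "- i"] unfolding lower_semicontinuous_uminus .
  from R.usc_G[of "\<lambda>i x. - v (- i) x", OF this, of "- j" "- l"] show ?thesis
    unfolding lower_semicontinuous_uminus reflect_G_def minus_minus minus_add_distrib .
qed


text \<open>Both envelopes are again fixed profiles, by \<open>translated_limit\<close>, and these
  satisfy the equations classically on each line of constant \<open>y\<close>. The viscosity
  inequalities then hold with equality.\<close>

lemma viscosity_solution_along:
  fixes F :: "int \<Rightarrow> real \<Rightarrow> (int \<Rightarrow> real) \<Rightarrow> real"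
  assumes F: "\<And>j \<tau> V. 2 * F j \<tau> V = \<alpha> * (G j \<tau> V + l - V 0)"
    and h: "profile p C h" and fixed: "step lam l h = h" and p: "p > 0"
  shows "viscosity_solution n \<alpha> F (\<lambda>j. along lam p (h j)) (\<lambda>j. along lam p (advect lam (react l h j)))"
proof -
  define g where "g h' j = advect lam (react l h' j)" for h' j
  have p0: "p \<ge> 0" using p by simp
  have prof_g: "profile p (C' + (B + K * window_width p + \<bar>l\<bar>) + \<bar>lam\<bar> / \<alpha>) (g h')" if "profile p C' h'" for C' h'
    unfolding g_def by (rule profile_advect[OF profile_react[OF that p0] p0])
  have bound: "\<bar>f j (\<tau>, z) - z\<bar> \<le> C' + 2 * p + \<bar>p / n * j\<bar>" if "profile p C' f" for f C' j \<tau> z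
    using profile_bound[OF that p0, of j \<tau> z] by linarith
  have loc: "locally_bounded (along lam p (f j))" if "profile p C' f" for f C' j
    by (rule locally_bounded_along[OF bound[OF that]])
  have shift: "along lam p (f (j + int n)) (\<tau>, y) = along lam p (f j) (\<tau>, y + 1)" if "profile p C' f" for f C' j \<tau> y
    using profileD(4)[OF that, of j \<tau> "lam * \<tau> + p * y"] by (simp add: algebra_simps)
  have deriv_h: "((\<lambda>t. along lam p (h' j) (t, y)) has_real_derivative
      \<alpha> * (along lam p (g h' j) (\<tau>, y) - along lam p (h' j) (\<tau>, y))) (at \<tau>)"
    if "profile p C' h'" "step lam l h' = h'" for C' h' j y \<tau>
    using line_derivatives(1)[OF that p0, of j "p * y" \<tau>] unfolding g_def along_apply .
  have deriv_g: "((\<lambda>t. along lam p (g h' j) (t, y)) has_real_derivative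
      2 * F j \<tau> (window (\<lambda>i. along lam p (h' i)) j (\<tau>, y)) + \<alpha> * (along lam p (h' j) (\<tau>, y) - along lam p (g h' j) (\<tau>, y))) (at \<tau>)"
    if "profile p C' h'" "step lam l h' = h'" for C' h' j y \<tau>
  proof -
    have "\<alpha> * (react l h' j (\<tau>, lam * \<tau> + p * y) - g h' j (\<tau>, lam * \<tau> + p * y))
        = 2 * F j \<tau> (window (\<lambda>i. along lam p (h' i)) j (\<tau>, y)) + \<alpha> * (along lam p (h' j) (\<tau>, y) - along lam p (g h' j) (\<tau>, y))"
      unfolding F window_def react_def along_apply fst_conv add_0_right by (simp only: algebra_simps)
    then show ?thesis
      using line_derivatives(2)[OF that p0, of j "p * y" \<tau>] unfolding g_def along_apply by (simp only:)
  qed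
  have cont: "isCont (\<lambda>t. h j (t, lam * t + c)) \<tau>" "isCont (\<lambda>t. g h j (t, lam * t + c)) \<tau>" for j c \<tau>
    using line_derivatives[OF h fixed p0, of j c \<tau>] unfolding g_def by (auto intro: DERIV_isCont)
  have dec: "(\<lambda>r. 1 / real (Suc r)) \<longlonglongrightarrow> 0" "monoseq (\<lambda>r. 1 / real (Suc r))" "\<And>r. \<bar>1 / real (Suc r)\<bar> \<le> 1"
  proof -
    show "(\<lambda>r. 1 / real (Suc r)) \<longlonglongrightarrow> 0" using LIMSEQ_inverse_real_of_nat by (simp add: inverse_eq_divide)
    show "monoseq (\<lambda>r. 1 / real (Suc r))" by (intro decseq_imp_monoseq decseq_SucI) (simp add: frac_le)
  qed auto
  have inc: "(\<lambda>r. - (1 / real (Suc r))) \<longlonglongrightarrow> 0" "monoseq (\<lambda>r. - (1 / real (Suc r)))" "\<And>r. \<bar>- (1 / real (Suc r))\<bar> \<le> 1"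
    using tendsto_minus[OF dec(1)] dec(2) by (auto simp: monoseq_def)
  from translated_limit[OF h fixed p0 dec]
  obtain hR where hR: "profile p (C + 1) hR" "step lam l hR = hR"
    and limR: "\<And>j \<tau> z. (\<lambda>r. h j (\<tau>, z + 1 / real (Suc r))) \<longlonglongrightarrow> hR j (\<tau>, z)"
      "\<And>j \<tau> z. (\<lambda>r. g h j (\<tau>, z + 1 / real (Suc r))) \<longlonglongrightarrow> g hR j (\<tau>, z)"
    unfolding g_def by blast
  from translated_limit[OF h fixed p0 inc]
  obtain hL where hL: "profile p (C + 1) hL" "step lam l hL = hL"
    and limL: "\<And>j \<tau> z. (\<lambda>r. h j (\<tau>, z + - (1 / real (Suc r)))) \<longlonglongrightarrow> hL j (\<tau>, z)"
      "\<And>j \<tau> z. (\<lambda>r. g h j (\<tau>, z + - (1 / real (Suc r)))) \<longlonglongrightarrow> g hL j (\<tau>, z)"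
    unfolding g_def by blast
  note G = prof_g[OF h]
  have usc: "usc_envelope (along lam p (h j)) = along lam p (hR j)" "usc_envelope (along lam p (g h j)) = along lam p (g hR j)" for j
    using usc_envelope_along[OF p bound[OF h] profileD(6)[OF h] cont(1) limR(1)]
      usc_envelope_along[OF p bound[OF G] profileD(6)[OF G] cont(2) limR(2)] by blast+
  have lsc: "lsc_envelope (along lam p (h j)) = along lam p (hL j)" "lsc_envelope (along lam p (g h j)) = along lam p (g hL j)" for j
    using lsc_envelope_along[OF p bound[OF h] profileD(6)[OF h] cont(1) limL(1)[unfolded add_uminus_conv_diff]]
      lsc_envelope_along[OF p bound[OF G] profileD(6)[OF G] cont(2) limL(2)[unfolded add_uminus_conv_diff]] by blast+
  have uscR: "upper_semicontinuous (along lam p (hR j))" "upper_semicontinuous (along lam p (g hR j))" for j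
    using upper_semicontinuous_usc_envelope[OF loc[OF h]] upper_semicontinuous_usc_envelope[OF loc[OF G]] 
    unfolding usc by blast+
  have lscL: "lower_semicontinuous (along lam p (hL j))" "lower_semicontinuous (along lam p (g hL j))" for j
  proof -
    have "lower_semicontinuous (lsc_envelope f)" if "locally_bounded f" for f :: "real \<times> real \<Rightarrow> real"
      unfolding lower_semicontinuous_uminus lsc_envelope_uminus minus_minus
      by (rule upper_semicontinuous_usc_envelope[OF locally_bounded_uminus[OF that]])
    from this[OF loc[OF h]] this[OF loc[OF G]]
    show "lower_semicontinuous (along lam p (hL j))" "lower_semicontinuous (along lam p (g hL j))"
      unfolding lsc by blast+
  qed
  have "viscosity_subsolution n \<alpha> F (\<lambda>j. along lam p (hR j)) (\<lambda>j. along lam p (g hR j))"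
    unfolding viscosity_subsolution_def
  proof (intro conjI allI impI)
    fix \<phi> D j \<tau> y
    assume \<phi>: "C1_with_derivative \<phi> D"
    show "blinfun_apply (D (\<tau>, y)) (1, 0) \<le> \<alpha> * (along lam p (g hR j) (\<tau>, y) - along lam p (hR j) (\<tau>, y))"
      if max: "local_max_at (\<lambda>x. along lam p (hR j) x - \<phi> x) (\<tau>, y)"
      using local_max_time_derivative[OF \<phi> deriv_h[OF hR] max] by (rule eq_refl)
    show "blinfun_apply (D (\<tau>, y)) (1, 0) \<le> 2 * F j \<tau> (window (\<lambda>j. along lam p (hR j)) j (\<tau>, y))
        + \<alpha> * (along lam p (hR j) (\<tau>, y) - along lam p (g hR j) (\<tau>, y))"
      if max: "local_max_at (\<lambda>x. along lam p (g hR j) x - \<phi> x) (\<tau>, y)"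
      using local_max_time_derivative[OF \<phi> deriv_g[OF hR] max] by (rule eq_refl)
  qed (rule loc[OF hR(1)] uscR loc[OF prof_g[OF hR(1)]] shift[OF hR(1)] shift[OF prof_g[OF hR(1)]])+
  moreover have "viscosity_supersolution n \<alpha> F (\<lambda>j. along lam p (hL j)) (\<lambda>j. along lam p (g hL j))"
    unfolding viscosity_supersolution_def
  proof (intro conjI allI impI)
    fix \<phi> D j \<tau> y
    assume \<phi>: "C1_with_derivative \<phi> D"
    show "\<alpha> * (along lam p (g hL j) (\<tau>, y) - along lam p (hL j) (\<tau>, y)) \<le> blinfun_apply (D (\<tau>, y)) (1, 0)"
      if min: "local_min_at (\<lambda>x. along lam p (hL j) x - \<phi> x) (\<tau>, y)"
      using local_min_time_derivative[OF \<phi> deriv_h[OF hL] min] by (rule eq_refl[OF sym])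
    show "2 * F j \<tau> (window (\<lambda>j. along lam p (hL j)) j (\<tau>, y))
        + \<alpha> * (along lam p (hL j) (\<tau>, y) - along lam p (g hL j) (\<tau>, y)) \<le> blinfun_apply (D (\<tau>, y)) (1, 0)"
      if min: "local_min_at (\<lambda>x. along lam p (g hL j) x - \<phi> x) (\<tau>, y)"
      using local_min_time_derivative[OF \<phi> deriv_g[OF hL] min] by (rule eq_refl[OF sym])
  qed (rule loc[OF hL(1)] lscL loc[OF prof_g[OF hL(1)]] shift[OF hL(1)] shift[OF prof_g[OF hL(1)]])+
  ultimately have "viscosity_solution n \<alpha> F (\<lambda>j. along lam p (h j)) (\<lambda>j. along lam p (g h j))"
    unfolding viscosity_solution_def usc lsc using loc[OF h] loc[OF G] by blast
  then show ?thesis unfolding g_def .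
qed

lemma hull_profile_of_profile:
  assumes f: "profile p C f" and p: "p \<ge> 0"
  shows "hull_profile n p f"
  unfolding hull_profile_def
proof (intro conjI allI)
  note D = profileD[OF f]
  have bound: "\<bar>f j (\<tau>, z) - z\<bar> \<le> C + 2 * p + \<bar>p / n * j\<bar>" for j \<tau> z
    using profile_bound[OF f p, of j \<tau> z] by linarith
  show "\<exists>C. \<forall>\<tau> z. \<bar>f j (\<tau>, z) - z\<bar> \<le> C" for j using bound by blast
  have "\<bar>f j x - (0 * fst x + 1 * snd x + 0)\<bar> \<le> C + 2 * p + \<bar>p / n * j\<bar>" for j x
    using bound[of j "fst x" "snd x"] by simp
  then show "locally_bounded (f j)" for j
    by (rule locally_bounded_near_continuous[OF isCont_affine])
  show "mono (\<lambda>z. f j (\<tau>, z))" for j \<tau> by (rule monoI) (rule D(6))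
qed (rule profileD(2)[OF f period_1] profileD(3)[OF f] profileD(4)[OF f] profileD(5)[OF f])+

text \<open>The hypothesis \<open>periods\<close> serves the clause on families independent of time:
  then every real number is a period in \<open>P\<close>, and the profile conditions make both
  components independent of time.\<close>

lemma hull_function_of_profile:
  assumes F: "\<And>j \<tau> V. 2 * F j \<tau> V = \<alpha> * (G j \<tau> V + l - V 0)"
    and h: "profile p C h" and fixed: "step lam l h = h" and p: "p > 0"
    and periods: "(\<forall>j \<tau> \<tau>'. F j \<tau> = F j \<tau>') \<Longrightarrow> P = UNIV"
  shows "hull_function n \<alpha> F p lam h (\<lambda>j. advect lam (react l h j))"
  unfolding hull_function_def
proof (intro conjI impI)
  have p0: "p \<ge> 0" using p by simp
  note g = profile_advect[OF profile_react[OF h p0, of l] p0, of lam]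
  show "viscosity_solution n \<alpha> F (\<lambda>j (\<tau>, y). h j (\<tau>, lam * \<tau> + p * y))
     (\<lambda>j (\<tau>, y). advect lam (react l h j) (\<tau>, lam * \<tau> + p * y))"
    using viscosity_solution_along[OF F h fixed p] unfolding along_def .
  show "hull_profile n p h" by (rule hull_profile_of_profile[OF h p0])
  show "hull_profile n p (\<lambda>j. advect lam (react l h j))" by (rule hull_profile_of_profile[OF g p0])
  show "\<forall>j \<tau> \<tau>' z. h j (\<tau>, z) = h j (\<tau>', z) \<and> advect lam (react l h j) (\<tau>, z) = advect lam (react l h j) (\<tau>', z)"
    if "\<forall>j \<tau> \<tau>'. F j \<tau> = F j \<tau>'"
  proof (intro allI conjI)
    fix j \<tau> \<tau>' z
    have "\<tau> - \<tau>' \<in> P" using periods[OF that] by simp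
    from profileD(2)[OF h this, of j \<tau>' z] show "h j (\<tau>, z) = h j (\<tau>', z)" by simp
    from profileD(2)[OF g \<open>\<tau> - \<tau>' \<in> P\<close>, of j \<tau>' z]
    show "advect lam (react l h j) (\<tau>, z) = advect lam (react l h j) (\<tau>', z)" by simp
  qed
qed

section \<open>Trajectories of an arbitrary hull function and uniqueness of its speed\<close>

lemma hull_profile_bound:
  assumes "hull_profile n p f" "p \<ge> 0"
  obtains C where "C \<ge> 0" "\<And>j \<tau> z. \<bar>f j (\<tau>, z) - z - p / n * j\<bar> \<le> C"
proof -
  obtain C where C: "\<And>\<tau> z. \<bar>f 0 (\<tau>, z) - z\<bar> \<le> C"
    using assms(1) unfolding hull_profile_def by blast
  have "\<bar>f j (\<tau>, z) - z - p / n * j - 0\<bar> \<le> C + 2 * p" for j \<tau> z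
    by (rule index_bound) (use assms C in \<open>auto simp: hull_profile_def\<close>)
  moreover from C have "C \<ge> 0" using abs_ge_zero order_trans by blast
  ultimately show ?thesis using that[of "C + 2 * p"] assms(2) by simp
qed

lemma near_line_G:
  fixes p C :: real and u :: "int \<Rightarrow> real \<times> real \<Rightarrow> real"
  assumes "\<And>j t y. \<bar>u j (t, y) - (lam * t + p * y + p / n * j)\<bar> \<le> C" "p \<ge> 0"
  shows "\<bar>G j t (\<lambda>i. u (j + i) (t, y)) + l - (lam * t + p * y + p / n * j)\<bar>
    \<le> C + (B + K * (2 * C + p * m) + \<bar>l\<bar>)"
proof -
  have "\<bar>u (j + i) (t, y) - u (j + 0) (t, y)\<bar> \<le> 2 * C + p * m" if "i \<in> {- int m..int m}" for i
  proof -
    have "\<bar>of_int i :: real\<bar> \<le> real m" using that by (simp add: abs_le_iff)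
    then have "p / n * \<bar>of_int i\<bar> \<le> p / n * m" using assms(2) by (intro mult_left_mono) auto
    also have "\<dots> \<le> p / 1 * m"
      using assms(2) n_pos by (intro mult_right_mono divide_left_mono) auto
    finally have "\<bar>p / n * of_int i\<bar> \<le> p * m" using assms(2) by (simp add: abs_mult)
    moreover have "p / n * of_int (j + i) = p / n * of_int j + p / n * of_int i" by (simp add: algebra_simps)
    ultimately show ?thesis
      using assms(1)[of "j + i" t y] assms(1)[of j t y] unfolding add_0_right by linarith
  qed
  from G_bound[of "\<lambda>i. u (j + i) (t, y)", OF this, of j t]
  show ?thesis using assms(1)[of j t y] unfolding add_0_right by linarith
qed

text \<open>An arbitrary hull function enters through the viscosity inequalities of its upper
  envelopes. \<open>viscosity_sub_le_relax\<close>, once per component on the line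
  \<open>y = 0\<close>, gives two integral inequalities that compose to the input of
  \<open>speed_comparison\<close>. A window couples values at the same \<open>y\<close> only, so
  this line is closed under the system.\<close>

lemma hull_sub_trajectory:
  assumes F: "\<And>j \<tau> V. 2 * F j \<tau> V = \<alpha> * (G j \<tau> V + l - V 0)"
    and hull: "hull_function n \<alpha> F p lam h g" and p: "p > 0"
  obtains U :: "int \<Rightarrow> real \<Rightarrow> real" and C where "\<And>j. U j \<in> borel_measurable borel" "\<And>j \<tau>. \<bar>U j \<tau> - lam * \<tau> - p / n * j\<bar> \<le> C"
    "\<And>j \<tau>. U j \<tau> \<le> relax \<alpha> (relax \<alpha> (\<lambda>t. G j t (\<lambda>i. U (j + i) t) + l)) \<tau>"
proof -
  have p0: "p \<ge> 0" using p by simp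
  define u where "u j = usc_envelope (along lam p (h j))" for j
  define x where "x j = usc_envelope (along lam p (g j))" for j
  have prof: "hull_profile n p h" "hull_profile n p g" using hull unfolding hull_function_def by blast+
  have sub: "viscosity_subsolution n \<alpha> F u x"
    using hull unfolding hull_function_def viscosity_solution_def u_def x_def along_def by blast
  have near: "\<exists>C\<ge>0. \<forall>j t y. \<bar>usc_envelope (along lam p (f j)) (t, y) - (lam * t + p * y + p / n * j)\<bar> \<le> C"
    if f: "hull_profile n p f" for f
  proof -
    obtain C where C: "C \<ge> 0" "\<And>j \<tau> z. \<bar>f j (\<tau>, z) - z - p / n * j\<bar> \<le> C" using hull_profile_bound[OF f p0] by metis
    have near: "\<bar>along lam p (f j) x - (lam * fst x + p * snd x + p / n * j)\<bar> \<le> C" for j x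
      using C(2)[of j "fst x" "lam * fst x + p * snd x"] by (cases x) (simp add: algebra_simps)
    have "\<bar>usc_envelope (along lam p (f j)) (t, y) - (lam * t + p * y + p / n * j)\<bar> \<le> C" for j t y
      using usc_envelope_near[OF locally_bounded_near_continuous[OF isCont_affine near] isCont_affine near, of j "(t, y)"] by simp
    then show ?thesis using C(1) by blast
  qed
  obtain Cu where Cu: "Cu \<ge> 0" "\<And>j t y. \<bar>u j (t, y) - (lam * t + p * y + p / n * j)\<bar> \<le> Cu"
    using near[OF prof(1)] unfolding u_def by blast
  obtain Cx where Cx: "Cx \<ge> 0" "\<And>j t y. \<bar>x j (t, y) - (lam * t + p * y + p / n * j)\<bar> \<le> Cx"
    using near[OF prof(2)] unfolding x_def by blast
  define f where "f j = (\<lambda>x. G j (fst x) (\<lambda>i. u (j + i) x) + l)" for j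
  have usc: "upper_semicontinuous (u j)" "upper_semicontinuous (x j)" for j
    using sub unfolding viscosity_subsolution_def by blast+
  have usc_f: "upper_semicontinuous (f j)" for j unfolding f_def by (rule usc_G) (rule usc)
  define Cf where "Cf = Cu + (B + K * (2 * Cu + p * m) + \<bar>l\<bar>)"
  have Cf: "\<bar>f j (t, y) - (lam * t + p * y + p / n * j)\<bar> \<le> Cf" for j t y
    unfolding f_def Cf_def fst_conv by (rule near_line_G[OF Cu(2) p0])
  \<comment> \<open>One growth constant for all three functions of index \<open>j\<close>: their
    distance from the affine function plus its coefficients.\<close>
  define c where "c j = max Cu (max Cx Cf) + \<bar>lam\<bar> + \<bar>p\<bar> + \<bar>p / n * of_int j\<bar>" for j :: int
  have c: "c j > 0" for j using Cu(1) p unfolding c_def by (simp add: add_nonneg_pos add_pos_nonneg max_def)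
  have lin: "linearly_bounded (c j) (u j)" "linearly_bounded (c j) (x j)" "linearly_bounded (c j) (f j)" for j
    by (rule linearly_bounded_mono[OF linearly_boundedI[OF Cu(2)]], simp add: c_def,
        rule linearly_bounded_mono[OF linearly_boundedI[OF Cx(2)]], simp add: c_def,
        rule linearly_bounded_mono[OF linearly_boundedI[OF Cf]], simp add: c_def)
  have ux: "u j (\<tau>, 0) \<le> relax \<alpha> (\<lambda>t. x j (t, 0)) \<tau>" for j \<tau>
    by (rule viscosity_sub_le_relax[OF \<alpha>_pos usc(1) lin(1) usc(2) lin(2) c])
       (use sub in \<open>unfold viscosity_subsolution_def, blast\<close>)
  have xf: "x j (\<tau>, 0) \<le> relax \<alpha> (\<lambda>t. f j (t, 0)) \<tau>" for j \<tau>
  proof (rule viscosity_sub_le_relax[OF \<alpha>_pos usc(2) lin(2) usc_f lin(3) c])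
    fix \<phi> D \<tau> y
    assume "C1_with_derivative \<phi> D" "local_max_at (\<lambda>z. x j z - \<phi> z) (\<tau>, y)"
    then have "blinfun_apply (D (\<tau>, y)) (1, 0) \<le> 2 * F j \<tau> (window u j (\<tau>, y)) + \<alpha> * (u j (\<tau>, y) - x j (\<tau>, y))"
      using sub unfolding viscosity_subsolution_def by blast
    also have "\<dots> = \<alpha> * (f j (\<tau>, y) - x j (\<tau>, y))"
      unfolding F window_def f_def fst_conv add_0_right by (simp only: algebra_simps)
    finally show "blinfun_apply (D (\<tau>, y)) (1, 0) \<le> \<alpha> * (f j (\<tau>, y) - x j (\<tau>, y))" .
  qed
  have lg: "linear_growth (\<lambda>t. x j (t, 0))" "linear_growth (\<lambda>t. f j (t, 0))" for j
    by (rule linear_growth_slice[OF usc(2) lin(2)], rule linear_growth_slice[OF usc_f lin(3)])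
  show ?thesis
  proof (rule that[of "\<lambda>j t. u j (t, 0)" Cu])
    show "(\<lambda>t. u j (t, 0)) \<in> borel_measurable borel" for j by (rule usc_slice_measurable[OF usc(1)])
    show "\<bar>u j (\<tau>, 0) - lam * \<tau> - p / n * j\<bar> \<le> Cu" for j \<tau> using Cu(2)[of j \<tau> 0] by (simp add: algebra_simps)
    show "u j (\<tau>, 0) \<le> relax \<alpha> (relax \<alpha> (\<lambda>t. G j t (\<lambda>i. u (j + i) (t, 0)) + l)) \<tau>" for j \<tau>
    proof -
      have "u j (\<tau>, 0) \<le> relax \<alpha> (\<lambda>t. x j (t, 0)) \<tau>" by (rule ux)
      also have "\<dots> \<le> relax \<alpha> (relax \<alpha> (\<lambda>t. f j (t, 0))) \<tau>"
        by (rule relax_mono[OF \<alpha>_pos lg(1) linear_growth_relax[OF \<alpha>_pos lg(2)] xf])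
      finally show ?thesis unfolding f_def fst_conv .
    qed
  qed
qed

lemma hull_super_trajectory:
  assumes F: "\<And>j \<tau> V. 2 * F j \<tau> V = \<alpha> * (G j \<tau> V + l - V 0)"
    and hull: "hull_function n \<alpha> F p lam h g" and p: "p > 0"
  obtains U :: "int \<Rightarrow> real \<Rightarrow> real" and C where "\<And>j. U j \<in> borel_measurable borel" "\<And>j \<tau>. \<bar>U j \<tau> - lam * \<tau> - p / n * j\<bar> \<le> C"
    "\<And>j \<tau>. relax \<alpha> (relax \<alpha> (\<lambda>t. G j t (\<lambda>i. U (j + i) t) + l)) \<tau> \<le> U j \<tau>"
proof -
  have p0: "p \<ge> 0" using p by simp
  define u where "u j = lsc_envelope (along lam p (h j))" for j
  define x where "x j = lsc_envelope (along lam p (g j))" for j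
  have prof: "hull_profile n p h" "hull_profile n p g" using hull unfolding hull_function_def by blast+
  have super: "viscosity_supersolution n \<alpha> F u x"
    using hull unfolding hull_function_def viscosity_solution_def u_def x_def along_def by blast
  have near: "\<exists>C\<ge>0. \<forall>j t y. \<bar>lsc_envelope (along lam p (f j)) (t, y) - (lam * t + p * y + p / n * j)\<bar> \<le> C"
    if f: "hull_profile n p f" for f
  proof -
    obtain C where C: "C \<ge> 0" "\<And>j \<tau> z. \<bar>f j (\<tau>, z) - z - p / n * j\<bar> \<le> C" using hull_profile_bound[OF f p0] by metis
    have near: "\<bar>- along lam p (f j) x - (- lam * fst x + - p * snd x + - p / n * j)\<bar> \<le> C" for j x
      using C(2)[of j "fst x" "lam * fst x + p * snd x"] by (cases x) (simp add: abs_le_iff algebra_simps)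
    have "\<bar>lsc_envelope (along lam p (f j)) (t, y) - (lam * t + p * y + p / n * j)\<bar> \<le> C" for j t y
      using usc_envelope_near[OF locally_bounded_near_continuous[OF isCont_affine near] isCont_affine near, of j "(t, y)"]
      unfolding lsc_envelope_uminus by (simp add: abs_le_iff algebra_simps)
    then show ?thesis using C(1) by blast
  qed
  obtain Cu where Cu: "Cu \<ge> 0" "\<And>j t y. \<bar>u j (t, y) - (lam * t + p * y + p / n * j)\<bar> \<le> Cu"
    using near[OF prof(1)] unfolding u_def by blast
  obtain Cx where Cx: "Cx \<ge> 0" "\<And>j t y. \<bar>x j (t, y) - (lam * t + p * y + p / n * j)\<bar> \<le> Cx"
    using near[OF prof(2)] unfolding x_def by blast
  define f where "f j = (\<lambda>x. G j (fst x) (\<lambda>i. u (j + i) x) + l)" for j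
  have lsc: "lower_semicontinuous (u j)" "lower_semicontinuous (x j)" for j
    using super unfolding viscosity_supersolution_def by blast+
  have lsc_f: "lower_semicontinuous (f j)" for j unfolding f_def by (rule lsc_G) (rule lsc)
  define Cf where "Cf = Cu + (B + K * (2 * Cu + p * m) + \<bar>l\<bar>)"
  have Cf: "\<bar>f j (t, y) - (lam * t + p * y + p / n * j)\<bar> \<le> Cf" for j t y
    unfolding f_def Cf_def fst_conv by (rule near_line_G[OF Cu(2) p0])
  define c where "c j = max Cu (max Cx Cf) + \<bar>lam\<bar> + \<bar>p\<bar> + \<bar>p / n * of_int j\<bar>" for j :: int
  have c: "c j > 0" for j using Cu(1) p unfolding c_def by (simp add: add_nonneg_pos add_pos_nonneg max_def)
  have lin: "linearly_bounded (c j) (u j)" "linearly_bounded (c j) (x j)" "linearly_bounded (c j) (f j)" for j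
    by (rule linearly_bounded_mono[OF linearly_boundedI[OF Cu(2)]], simp add: c_def,
        rule linearly_bounded_mono[OF linearly_boundedI[OF Cx(2)]], simp add: c_def,
        rule linearly_bounded_mono[OF linearly_boundedI[OF Cf]], simp add: c_def)
  have ux: "relax \<alpha> (\<lambda>t. x j (t, 0)) \<tau> \<le> u j (\<tau>, 0)" for j \<tau>
    by (rule viscosity_super_ge_relax[OF \<alpha>_pos lsc(1) lin(1) lsc(2) lin(2) c])
       (use super in \<open>unfold viscosity_supersolution_def, blast\<close>)
  have xf: "relax \<alpha> (\<lambda>t. f j (t, 0)) \<tau> \<le> x j (\<tau>, 0)" for j \<tau>
  proof (rule viscosity_super_ge_relax[OF \<alpha>_pos lsc(2) lin(2) lsc_f lin(3) c])
    fix \<phi> D \<tau> y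
    assume "C1_with_derivative \<phi> D" "local_min_at (\<lambda>z. x j z - \<phi> z) (\<tau>, y)"
    then have "2 * F j \<tau> (window u j (\<tau>, y)) + \<alpha> * (u j (\<tau>, y) - x j (\<tau>, y)) \<le> blinfun_apply (D (\<tau>, y)) (1, 0)"
      using super unfolding viscosity_supersolution_def by blast
    moreover have "2 * F j \<tau> (window u j (\<tau>, y)) + \<alpha> * (u j (\<tau>, y) - x j (\<tau>, y)) = \<alpha> * (f j (\<tau>, y) - x j (\<tau>, y))"
      unfolding F window_def f_def fst_conv add_0_right by (simp only: algebra_simps)
    ultimately show "\<alpha> * (f j (\<tau>, y) - x j (\<tau>, y)) \<le> blinfun_apply (D (\<tau>, y)) (1, 0)" by simp
  qed
  have slice: "linear_growth (\<lambda>t. w (t, 0))" if "lower_semicontinuous w" "linearly_bounded c w" for w :: "real \<times> real \<Rightarrow> real" and c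
    using linear_growth_cmult[OF linear_growth_slice[of "\<lambda>x. - w x" c 0], of "-1"] that
    by (simp add: lower_semicontinuous_uminus linearly_bounded_def)
  have lg: "linear_growth (\<lambda>t. u j (t, 0))" "linear_growth (\<lambda>t. x j (t, 0))" "linear_growth (\<lambda>t. f j (t, 0))" for j
    by (rule slice[OF lsc(1) lin(1)], rule slice[OF lsc(2) lin(2)], rule slice[OF lsc_f lin(3)])
  show ?thesis
  proof (rule that[of "\<lambda>j t. u j (t, 0)" Cu])
    show "(\<lambda>t. u j (t, 0)) \<in> borel_measurable borel" for j by (rule linear_growth_measurable[OF lg(1)])
    show "\<bar>u j (\<tau>, 0) - lam * \<tau> - p / n * j\<bar> \<le> Cu" for j \<tau> using Cu(2)[of j \<tau> 0] by (simp add: algebra_simps)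
    show "relax \<alpha> (relax \<alpha> (\<lambda>t. G j t (\<lambda>i. u (j + i) (t, 0)) + l)) \<tau> \<le> u j (\<tau>, 0)" for j \<tau>
    proof -
      have "relax \<alpha> (relax \<alpha> (\<lambda>t. f j (t, 0))) \<tau> \<le> relax \<alpha> (\<lambda>t. x j (t, 0)) \<tau>"
        by (rule relax_mono[OF \<alpha>_pos linear_growth_relax[OF \<alpha>_pos lg(3)] lg(2) xf])
      also have "\<dots> \<le> u j (\<tau>, 0)" by (rule ux)
      finally show ?thesis unfolding f_def fst_conv .
    qed
  qed
qed

lemma hull_function_speed_le:
  assumes F: "\<And>j \<tau> V. 2 * F j \<tau> V = \<alpha> * (G j \<tau> V + l - V 0)" and p: "p > 0"
    and hull: "hull_function n \<alpha> F p lam h g" "hull_function n \<alpha> F p lam' h' g'"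
  shows "lam \<le> lam'"
proof (rule hull_sub_trajectory[OF F hull(1) p])
  fix U :: "int \<Rightarrow> real \<Rightarrow> real" and C
  assume U: "\<And>j. U j \<in> borel_measurable borel" "\<And>j \<tau>. \<bar>U j \<tau> - lam * \<tau> - p / n * j\<bar> \<le> C"
    "\<And>j \<tau>. U j \<tau> \<le> relax \<alpha> (relax \<alpha> (\<lambda>t. G j t (\<lambda>i. U (j + i) t) + l)) \<tau>"
  show ?thesis
  proof (rule hull_super_trajectory[OF F hull(2) p])
    fix V :: "int \<Rightarrow> real \<Rightarrow> real" and C'
    assume V: "\<And>j. V j \<in> borel_measurable borel" "\<And>j \<tau>. \<bar>V j \<tau> - lam' * \<tau> - p / n * j\<bar> \<le> C'"
      "\<And>j \<tau>. relax \<alpha> (relax \<alpha> (\<lambda>t. G j t (\<lambda>i. V (j + i) t) + l)) \<tau> \<le> V j \<tau>"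
    show ?thesis by (rule speed_comparison[OF U(1) V(1) U(2) V(2) U(3) V(3) order_refl])
  qed
qed

text \<open>Existence and uniqueness give the definite description its meaning. From here on hull
  functions can be forgotten: by \<open>speed_le\<close>, the two profiles bound the value from both
  sides.\<close>

lemma effective_hamiltonian_speed:
  assumes F: "\<And>j \<tau> V. 2 * F j \<tau> V = \<alpha> * (G j \<tau> V + l - V 0)" and p: "p > 0"
    and periods: "(\<forall>j \<tau> \<tau>'. F j \<tau> = F j \<tau>') \<Longrightarrow> P = UNIV"
  shows "(\<exists>e. sub_profile p l (effective_hamiltonian n \<alpha> F p) e) \<and>
    (\<exists>e. super_profile p l (effective_hamiltonian n \<alpha> F p) e)"
proof -
  obtain lam e f where ef: "sub_profile p l lam e" "super_profile p l lam f"
    using speed_exists[of p l] p by auto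
  obtain C h where h: "profile p C h" "step lam l h = h"
    using fixed_profile_exists[OF ef] p by auto
  note hull = hull_function_of_profile[OF F h p periods]
  have "effective_hamiltonian n \<alpha> F p = lam"
    unfolding effective_hamiltonian_def
  proof (rule the_equality)
    show "\<exists>h g. hull_function n \<alpha> F p lam h g" using hull by blast
    show "lam' = lam" if "\<exists>h g. hull_function n \<alpha> F p lam' h g" for lam'
    proof -
      from that obtain h' g' where hull': "hull_function n \<alpha> F p lam' h' g'" by blast
      show ?thesis
        by (rule antisym[OF hull_function_speed_le[OF F p hull' hull] hull_function_speed_le[OF F p hull hull']])
    qed
  qed
  then show ?thesis using ef by blast
qed

end

text \<open>If convergence to \<open>a\<close> fails, infinitely many terms lie beyond some level
  \<open>b\<close> different from \<open>a\<close>. Constant levels in the hypotheses avoid any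
  extraction of convergent subsequences; \<open>r\<close> tends to infinity but need not be
  increasing.\<close>

lemma tendsto_of_semicontinuous:
  fixes a :: real and x :: "nat \<Rightarrow> real"
  assumes upper: "\<And>r b. filterlim r at_top sequentially \<Longrightarrow> (\<And>k. b \<le> x (r k)) \<Longrightarrow> b \<le> a"
    and lower: "\<And>r b. filterlim r at_top sequentially \<Longrightarrow> (\<And>k. x (r k) \<le> b) \<Longrightarrow> a \<le> b"
  shows "x \<longlonglongrightarrow> a"
proof -
  have sel: "\<exists>r. filterlim r at_top sequentially \<and> (\<forall>k. Q (r k))" if "\<not> (\<forall>\<^sub>F k in sequentially. \<not> Q k)" for Q :: "nat \<Rightarrow> bool"
  proof -
    have "\<forall>N. \<exists>k\<ge>N. Q k" using that by (auto simp: eventually_sequentially)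
    then obtain r where r: "\<And>N. r N \<ge> N" "\<And>N. Q (r N)" by metis
    then have "filterlim r at_top sequentially"
      by (intro filterlim_at_top_mono[OF filterlim_ident]) auto
    then show ?thesis using r(2) by blast
  qed
  show ?thesis
  proof (rule order_tendstoI)
    fix b assume "b < a"
    show "\<forall>\<^sub>F k in sequentially. b < x k"
    proof (rule ccontr)
      assume "\<not> ?thesis"
      then have "\<not> (\<forall>\<^sub>F k in sequentially. \<not> x k \<le> b)" by (simp add: not_le)
      from sel[OF this] lower \<open>b < a\<close> show False by (auto simp: not_le[symmetric])
    qed
  next
    fix b assume "a < b"
    show "\<forall>\<^sub>F k in sequentially. x k < b"
    proof (rule ccontr)
      assume "\<not> ?thesis"
      then have "\<not> (\<forall>\<^sub>F k in sequentially. \<not> b \<le> x k)" by (simp add: not_le)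
      from sel[OF this] upper \<open>a < b\<close> show False by (auto simp: not_le[symmetric])
    qed
  qed
qed

subsection \<open>Admissible families\<close>

text \<open>Adding \<open>V 0\<close> makes \<open>G\<close> monotone also in the central
  coordinate, by (A3), and turns the invariance (A4) into equivariance under integer shifts. The
  constants come from the Lipschitz condition and from compactness of one period in time and
  index.\<close>

lemma admissible_cooperative:
  assumes "n \<ge> 1" "\<alpha> > 0" and adm: "admissible n m \<alpha> F"
  obtains K B where "cooperative n m \<alpha> K B {s. \<forall>j \<tau>. F j (\<tau> + s) = F j \<tau>} (\<lambda>j \<tau> V. V 0 + 2 / \<alpha> * F j \<tau> V)"
proof -
  let ?W = "{- int m..int m}"
  define G where "G = (\<lambda>j \<tau> V. V 0 + 2 / \<alpha> * F j \<tau> V)"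
  note A1 = adm[unfolded admissible_def depends_on_window_def]
  note A2 = conjunct2[OF A1] note A3 = conjunct2[OF A2] note A4 = conjunct2[OF A3]
  note A5 = conjunct2[OF A4] note A6 = conjunct2[OF A5] note A7 = conjunct2[OF A6]
  note A8 = conjunct2[OF A7] note A9 = conjunct2[OF A8]
  note dep = conjunct1[OF A1, rule_format] and F_cont = conjunct1[OF A2, rule_format]
    and F_mono = conjunct1[OF A4, rule_format] and F_mono0 = conjunct1[OF A5, rule_format]
    and F_add1 = conjunct1[OF A6, rule_format] and F_per = conjunct1[OF A7, rule_format]
    and F_n = conjunct1[OF A8, rule_format] and F_next = A9[rule_format]
  from conjunct1[OF A3] obtain k
    where "\<forall>j \<tau> V W. \<bar>F j \<tau> V - F j \<tau> W\<bar> \<le> k * L2_set (\<lambda>i. V i - W i) ?W" ..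
  note k = this[rule_format]
  \<comment> \<open>A Lipschitz constant for the maximum norm: the Euclidean norm is at most the sum
    over the \<open>2 * m + 1\<close> coordinates of the window.\<close>
  define k' where "k' = \<bar>k\<bar> * (2 * real m + 1)"
  have k'0: "k' \<ge> 0" by (simp add: k'_def)
  have F_lip: "\<bar>F j \<tau> V - F j \<tau> W\<bar> \<le> k' * w" if w: "\<And>i. i \<in> ?W \<Longrightarrow> \<bar>V i - W i\<bar> \<le> w" for j \<tau> V W w
  proof -
    have "L2_set (\<lambda>i. V i - W i) ?W \<le> (\<Sum>i\<in>?W. \<bar>V i - W i\<bar>)" by (rule L2_set_le_sum_abs)
    also have "\<dots> \<le> (\<Sum>i\<in>?W. w)" by (intro sum_mono w)
    also have "\<dots> = (2 * real m + 1) * w" by simp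
    finally have L: "L2_set (\<lambda>i. V i - W i) ?W \<le> (2 * real m + 1) * w" .
    have "\<bar>F j \<tau> V - F j \<tau> W\<bar> \<le> \<bar>k\<bar> * L2_set (\<lambda>i. V i - W i) ?W"
      using k[of j \<tau> V W] mult_right_mono[OF abs_ge_self[of k] L2_set_nonneg[of "\<lambda>i. V i - W i" ?W]] by linarith
    also have "\<dots> \<le> \<bar>k\<bar> * ((2 * real m + 1) * w)" by (intro mult_left_mono L) simp
    finally show ?thesis by (simp add: k'_def mult.assoc)
  qed
  have F_add_int: "F j \<tau> (\<lambda>i. V i + of_int q) = F j \<tau> V" for j \<tau> V q
  proof -
    have nat: "F j \<tau> (\<lambda>i. V i + real q) = F j \<tau> V" for V q
    proof (induction q)
      case (Suc q)
      then show ?case using F_add1[of j \<tau> "\<lambda>i. V i + real q"] by (simp add: algebra_simps)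
    qed simp
    show ?thesis
    proof (cases "q \<ge> 0")
      case True then show ?thesis using nat[of V "nat q"] by simp
    next
      case False then show ?thesis using nat[of "\<lambda>i. V i + of_int q" "nat (- q)"] by simp
    qed
  qed
  have F_add_period: "F j (\<tau> + of_int q) V = F j \<tau> V" for j \<tau> V q
  proof -
    have nat: "F j (\<tau> + real q) V = F j \<tau> V" for \<tau> q
      using F_per[of j "\<tau> + real q" V for q] by (induction q) (auto simp: algebra_simps)
    show ?thesis
    proof (cases "q \<ge> 0")
      case True then show ?thesis using nat[of \<tau> "nat q"] by simp
    next
      case False then show ?thesis using nat[of "\<tau> + of_int q" "nat (- q)"] by simp
    qed
  qed
  have F_mod: "F j = F (j mod int n)" for j
  proof -
    have nat: "F (i + int q * int n) = F i" for i q
      using F_n[of "i + int q * int n" for q] by (induction q) (auto simp: algebra_simps)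
    have "F (i + q * int n) = F i" for i q
    proof (cases "q \<ge> 0")
      case True then show ?thesis using nat[of i "nat q"] by simp
    next
      case False then show ?thesis using nat[of "i + q * int n" "nat (- q)"] by simp
    qed
    from this[of "j mod int n" "j div int n"] show ?thesis by simp
  qed
  have "\<exists>b. \<forall>\<tau>\<in>{0..1}. \<bar>F j \<tau> (\<lambda>_. 0)\<bar> \<le> b" for j
  proof -
    have "continuous_on {0..1} (\<lambda>\<tau> :: real. (\<tau>, \<lambda>_ :: int. 0 :: real))" by (intro continuous_intros)
    from continuous_on_compose2[OF F_cont this, of j]
    have "compact ((\<lambda>\<tau>. F j \<tau> (\<lambda>_. 0)) ` {0..1})"
      by (intro compact_continuous_image) auto
    then show ?thesis using compact_imp_bounded by (fastforce simp: bounded_iff)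
  qed
  then obtain b where b: "\<And>j \<tau>. \<tau> \<in> {0..1} \<Longrightarrow> \<bar>F j \<tau> (\<lambda>_. 0)\<bar> \<le> b j" by metis
  \<comment> \<open>Time is reduced to the unit interval and the index to its residue modulo
    \<open>n\<close>; the sum dominates each of the finitely many bounds.\<close>
  define C where "C = (\<Sum>j\<in>{0..<int n}. \<bar>b j\<bar>)"
  have F0: "\<bar>F j \<tau> (\<lambda>_. 0)\<bar> \<le> C" for j \<tau>
  proof -
    define t where "t = \<tau> - of_int \<lfloor>\<tau>\<rfloor>"
    have t: "t \<in> {0..1}" by (simp add: t_def) linarith
    have "F j \<tau> (\<lambda>_. 0) = F (j mod int n) t (\<lambda>_. 0)"
      using F_add_period[of j t "\<lfloor>\<tau>\<rfloor>" "\<lambda>_. 0"] F_mod[of j] by (simp add: t_def)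
    also have "\<bar>\<dots>\<bar> \<le> \<bar>b (j mod int n)\<bar>" using b[OF t, of "j mod int n"] by simp
    also have "\<dots> \<le> C"
      unfolding C_def by (rule member_le_sum) (use assms(1) in auto)
    finally show ?thesis .
  qed
  have C0: "C \<ge> 0" unfolding C_def by (intro sum_nonneg) auto
  \<comment> \<open>In \<open>K\<close> the summand 1 belongs to \<open>V 0\<close>. In
    \<open>B\<close> the summand \<open>k'\<close> pays for the integer reduction, after which a
    window of spread \<open>w\<close> lies within \<open>w + 1\<close> of 0.\<close>
  define K where "K = 1 + 2 / \<alpha> * k'"
  define B where "B = 2 / \<alpha> * (C + k')"
  have G_single: "G j \<tau> V \<le> G j \<tau> (V(i := x))" if "i \<in> ?W" "V i \<le> x" for i x V j \<tau>
  proof (cases "i = 0")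
    case True
    have "2 * F j \<tau> (V(0 := V 0)) + \<alpha> * V 0 \<le> 2 * F j \<tau> (V(0 := x)) + \<alpha> * x"
      by (rule monoD[OF F_mono0]) (use that True in simp)
    then have "(2 * F j \<tau> V + \<alpha> * V 0) / \<alpha> \<le> (2 * F j \<tau> (V(0 := x)) + \<alpha> * x) / \<alpha>"
      using assms(2) by (intro divide_right_mono) auto
    then show ?thesis using assms(2) True by (simp add: G_def add_divide_distrib)
  next
    case False
    have "F j \<tau> (V(i := V i)) \<le> F j \<tau> (V(i := x))"
      by (rule monoD[OF F_mono]) (use that False in auto)
    then have "2 / \<alpha> * F j \<tau> V \<le> 2 / \<alpha> * F j \<tau> (V(i := x))"
      using assms(2) by (intro mult_left_mono) auto
    then show ?thesis using False by (simp add: G_def)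
  qed
  have "cooperative n m \<alpha> K B {s. \<forall>j \<tau>. F j (\<tau> + s) = F j \<tau>} G"
  proof
    fix j :: int and \<tau> :: real and V W :: "int \<Rightarrow> real" and q :: int and w s :: real
    show "G j \<tau> V \<le> G j \<tau> W" if le: "\<And>i. i \<in> ?W \<Longrightarrow> V i \<le> W i"
    proof -
      \<comment> \<open>Coordinates are raised one at a time, as the hypotheses give monotonicity in
        each separately. Values outside the window are adjusted at the end by
        \<open>dep\<close>.\<close>
      have "G j \<tau> V \<le> G j \<tau> (\<lambda>i. if i \<in> S then W i else V i)" if "S \<subseteq> ?W" for S
        using finite_subset[OF that finite_atLeastAtMost_int] that
      proof (induction S rule: finite_induct)
        case (insert a S)
        let ?V = "\<lambda>i. if i \<in> S then W i else V i"
        have "G j \<tau> ?V \<le> G j \<tau> (?V(a := W a))"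
          by (rule G_single) (use insert le in auto)
        also have "?V(a := W a) = (\<lambda>i. if i \<in> insert a S then W i else V i)" by auto
        finally show ?case using insert by auto
      qed simp
      from this[of ?W] have "G j \<tau> V \<le> G j \<tau> (\<lambda>i. if i \<in> ?W then W i else V i)" by simp
      also have "\<dots> = G j \<tau> W"
        unfolding G_def using dep[of "\<lambda>i. if i \<in> ?W then W i else V i" W j \<tau>] by auto
      finally show ?thesis .
    qed
    show "G j \<tau> (\<lambda>i. V i + of_int q) = G j \<tau> V + of_int q"
      unfolding G_def F_add_int by simp
    show "G j \<tau> (\<lambda>i. V i + w) \<le> G j \<tau> V + K * w" if "w \<ge> 0"
    proof -
      have "F j \<tau> (\<lambda>i. V i + w) \<le> F j \<tau> V + k' * w"
        using F_lip[of "\<lambda>i. V i + w" V w j \<tau>] that by (simp add: abs_le_iff)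
      then have "2 / \<alpha> * F j \<tau> (\<lambda>i. V i + w) \<le> 2 / \<alpha> * (F j \<tau> V + k' * w)"
        using assms(2) by (intro mult_left_mono) auto
      then show ?thesis unfolding G_def K_def by (simp add: algebra_simps)
    qed
    show "continuous_on UNIV (\<lambda>(\<tau>, V). G j \<tau> V)"
    proof -
      have "continuous_on UNIV (\<lambda>V :: int \<Rightarrow> real. V 0)" by (rule continuous_on_product_coordinates)
      from continuous_on_compose2[OF this continuous_on_snd[OF continuous_on_id]]
      have c: "continuous_on UNIV (\<lambda>x :: real \<times> (int \<Rightarrow> real). snd x 0)" by simp
      have "continuous_on UNIV (\<lambda>x. snd x 0 + 2 / \<alpha> * (\<lambda>(\<tau>, V). F j \<tau> V) x)"
        by (intro continuous_on_add continuous_on_mult continuous_on_const c F_cont)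
      then show ?thesis by (simp add: G_def case_prod_beta')
    qed
    show "G j (\<tau> + s) = G j \<tau>" if "s \<in> {s. \<forall>j \<tau>. F j (\<tau> + s) = F j \<tau>}"
      using that by (simp add: G_def)
    show "G (j + int n) = G j" by (simp add: G_def F_n)
    show "G j \<tau> V \<le> G (j + 1) \<tau> (\<lambda>i. V (i + 1))" if "\<And>i. V i \<le> V (i + 1)"
    proof -
      have "(2 * F j \<tau> V + \<alpha> * V 0) / \<alpha> \<le> (2 * F (j + 1) \<tau> (\<lambda>i. V (i + 1)) + \<alpha> * V 1) / \<alpha>"
        using assms(2) F_next[where V=V, OF that, of j \<tau>] by (intro divide_right_mono) auto
      then show ?thesis using assms(2) by (simp add: G_def add_divide_distrib)
    qed
    show "\<bar>G j \<tau> V - V 0\<bar> \<le> B + K * w" if w: "\<And>i. i \<in> ?W \<Longrightarrow> \<bar>V i - V 0\<bar> \<le> w"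
    proof -
      have w0: "w \<ge> 0" using w[of 0] by simp
      \<comment> \<open>An integer shift leaves \<open>F\<close> unchanged and brings the central
        coordinate into the unit interval, so \<open>V'\<close> can be compared with 0, where
        \<open>F\<close> is bounded by \<open>C\<close>.\<close>
      define V' where "V' i = V i + of_int (- \<lfloor>V 0\<rfloor>)" for i
      have "\<bar>V' i - 0\<bar> \<le> w + 1" if "i \<in> ?W" for i
        using w[OF that] unfolding V'_def by (simp add: abs_le_iff) linarith
      from F_lip[of V' "\<lambda>_. 0", OF this, of j \<tau>] have "\<bar>F j \<tau> V'\<bar> \<le> C + k' * (w + 1)"
        using F0[of j \<tau>] by linarith
      moreover have "F j \<tau> V' = F j \<tau> V" unfolding V'_def by (rule F_add_int)
      ultimately have "2 / \<alpha> * \<bar>F j \<tau> V\<bar> \<le> 2 / \<alpha> * (C + k' * (w + 1))"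
        using assms(2) by (intro mult_left_mono) auto
      moreover have "\<bar>G j \<tau> V - V 0\<bar> = 2 / \<alpha> * \<bar>F j \<tau> V\<bar>"
        using assms(2) by (simp add: G_def abs_mult)
      moreover have "B + K * w = 2 / \<alpha> * (C + k' * (w + 1)) + w"
        by (simp add: B_def K_def algebra_simps add_divide_distrib)
      ultimately show ?thesis using w0 by linarith
    qed
    show "0 \<le> K" "0 \<le> B" using assms(2) k'0 C0 by (simp_all add: K_def B_def)
    show "1 \<in> {s. \<forall>j \<tau>. F j (\<tau> + s) = F j \<tau>}" using F_per by (auto simp: fun_eq_iff)
  qed (use assms in auto)
  then show ?thesis using that unfolding G_def by blast
qed

theorem theorem1p11:
  fixes n m :: nat
    and \<alpha>\<^sub>0 :: real
    and F :: "int \<Rightarrow> real \<Rightarrow> (int \<Rightarrow> real) \<Rightarrow> real"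
  assumes "n \<ge> 1"
    and "\<alpha>\<^sub>0 > 0"
    and "admissible n m \<alpha>\<^sub>0 F"
  shows "continuous_on (UNIV \<times> {0<..}) (\<lambda>(L, p). Fbar n \<alpha>\<^sub>0 F L p) \<and>
    (\<forall>p>0. \<exists>C. \<forall>L. \<bar>Fbar n \<alpha>\<^sub>0 F L p - L\<bar> \<le> C) \<and>
    (\<forall>p>0. mono (\<lambda>L. Fbar n \<alpha>\<^sub>0 F L p))"
proof -
  define P where "P = {s. \<forall>j \<tau>. F j (\<tau> + s) = F j \<tau>}"
  define G where "G = (\<lambda>j \<tau> V. V 0 + 2 / \<alpha>\<^sub>0 * F j \<tau> V)"
  obtain K B where "cooperative n m \<alpha>\<^sub>0 K B P G"
    using admissible_cooperative[OF assms] unfolding P_def G_def by blast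
  then interpret cooperative n m \<alpha>\<^sub>0 K B P G .
  define l where "l L = 2 * L / \<alpha>\<^sub>0" for L :: real
  have speed: "(\<exists>e. sub_profile p (l L) (Fbar n \<alpha>\<^sub>0 F L p) e) \<and> (\<exists>e. super_profile p (l L) (Fbar n \<alpha>\<^sub>0 F L p) e)"
    if "p > 0" for L p
    unfolding Fbar_def
  proof (rule effective_hamiltonian_speed[OF _ that])
    show "2 * (L + F j \<tau> V) = \<alpha>\<^sub>0 * (G j \<tau> V + l L - V 0)" for j \<tau> V
      using assms(2) by (simp add: G_def l_def field_simps)
    show "P = UNIV" if "\<forall>j \<tau> \<tau>'. (\<lambda>V. L + F j \<tau> V) = (\<lambda>V. L + F j \<tau>' V)"
    proof -
      have "F j \<tau> V = F j \<tau>' V" for j \<tau> \<tau>' V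
        using fun_cong[of "\<lambda>V. L + F j \<tau> V" "\<lambda>V. L + F j \<tau>' V" V] that by simp
      then show ?thesis unfolding P_def by (auto simp: fun_eq_iff)
    qed
  qed
  have l_mono: "l L \<le> l L'" if "L \<le> L'" for L L'
    using assms(2) that by (simp add: l_def divide_right_mono)
  have "continuous_on (UNIV \<times> {0<..}) (\<lambda>(L, p). Fbar n \<alpha>\<^sub>0 F L p)"
    unfolding continuous_on_sequentially
  proof (intro allI impI ballI, elim conjE)
    fix xs and x :: "real \<times> real"
    assume x: "x \<in> UNIV \<times> {0<..}" and xs: "\<forall>k. xs k \<in> UNIV \<times> {0<..}" "xs \<longlonglongrightarrow> x"
    obtain L p where Lp: "x = (L, p)" "p > 0" using x by auto
    define Ls ps where "Ls k = fst (xs k)" and "ps k = snd (xs k)" for k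
    have ps: "ps k > 0" for k using xs(1) by (auto simp: ps_def mem_Times_iff)
    have lim: "Ls \<longlonglongrightarrow> L" "ps \<longlonglongrightarrow> p"
      using tendsto_fst[OF xs(2)] tendsto_snd[OF xs(2)] unfolding Ls_def ps_def Lp by simp_all
    have l_lim: "(\<lambda>k. l (Ls (r k))) \<longlonglongrightarrow> l L" "(\<lambda>k. ps (r k)) \<longlonglongrightarrow> p" if "filterlim r at_top sequentially" for r :: "nat \<Rightarrow> nat"
      unfolding l_def using assms(2) filterlim_compose[OF lim(1) that] filterlim_compose[OF lim(2) that]
      by (auto intro!: tendsto_intros)
    have "(\<lambda>k. Fbar n \<alpha>\<^sub>0 F (Ls k) (ps k)) \<longlonglongrightarrow> Fbar n \<alpha>\<^sub>0 F L p"
    proof (rule tendsto_of_semicontinuous)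
      fix r :: "nat \<Rightarrow> nat" and b assume r: "filterlim r at_top sequentially"
      show "b \<le> Fbar n \<alpha>\<^sub>0 F L p" if b: "\<And>k. b \<le> Fbar n \<alpha>\<^sub>0 F (Ls (r k)) (ps (r k))"
      proof -
        \<comment> \<open>The speeds along the sequence are only known to be at least
          \<open>b\<close>; slowing their sub-profiles down to the constant speed \<open>b\<close>
          makes \<open>sub_profile_limit\<close> applicable.\<close>
        have "\<exists>e. sub_profile (ps (r k)) (l (Ls (r k))) b e" for k
          using speed[OF ps[of "r k"], of "Ls (r k)"] sub_profile_slower[OF _ b less_imp_le[OF ps]] by blast
        from sub_profile_limit[OF this less_imp_le[OF ps] l_lim(2,1)[OF r] tendsto_const]
        obtain e where "sub_profile p (l L) b e" by blast
        then show ?thesis using speed[OF Lp(2), of L] speed_le[OF _ _ order_refl less_imp_le[OF Lp(2)]] by blast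
      qed
      show "Fbar n \<alpha>\<^sub>0 F L p \<le> b" if b: "\<And>k. Fbar n \<alpha>\<^sub>0 F (Ls (r k)) (ps (r k)) \<le> b"
      proof -
        have "\<exists>e. super_profile (ps (r k)) (l (Ls (r k))) b e" for k
          using speed[OF ps[of "r k"], of "Ls (r k)"] super_profile_faster[OF _ b less_imp_le[OF ps]] by blast
        from super_profile_limit[OF this less_imp_le[OF ps] l_lim(2,1)[OF r] tendsto_const]
        obtain e where "super_profile p (l L) b e" by blast
        then show ?thesis using speed[OF Lp(2), of L] speed_le[OF _ _ order_refl less_imp_le[OF Lp(2)]] by blast
      qed
    qed
    then show "((\<lambda>(L, p). Fbar n \<alpha>\<^sub>0 F L p) \<circ> xs) \<longlonglongrightarrow> (\<lambda>(L, p). Fbar n \<alpha>\<^sub>0 F L p) x"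
      unfolding Lp Ls_def ps_def comp_def by (simp add: case_prod_beta')
  qed
  moreover have "\<exists>C. \<forall>L. \<bar>Fbar n \<alpha>\<^sub>0 F L p - L\<bar> \<le> C" if p: "p > 0" for p
  proof (intro exI allI)
    fix L
    have p0: "p \<ge> 0" using p by simp
    \<comment> \<open>The linear profile is a sub- and a super-profile at two explicit speeds, and
      \<open>b\<close>, half their distance up to the factor \<open>\<alpha>\<^sub>0 / 2\<close>,
      does not involve \<open>L\<close>.\<close>
    define b where "b = B + K * window_width p"
    have "\<alpha>\<^sub>0 / 2 * (l L - b) \<le> Fbar n \<alpha>\<^sub>0 F L p" "Fbar n \<alpha>\<^sub>0 F L p \<le> \<alpha>\<^sub>0 / 2 * (l L + b)"
      using speed[OF p, of L] speed_le[OF sub_profile_linear[OF p0] _ order_refl p0]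
        speed_le[OF _ super_profile_linear[OF p0] order_refl p0] unfolding b_def by blast+
    moreover have "\<alpha>\<^sub>0 / 2 * (l L - b) = L - \<alpha>\<^sub>0 / 2 * b" "\<alpha>\<^sub>0 / 2 * (l L + b) = L + \<alpha>\<^sub>0 / 2 * b"
      using assms(2) by (simp_all add: l_def field_simps)
    ultimately show "\<bar>Fbar n \<alpha>\<^sub>0 F L p - L\<bar> \<le> \<alpha>\<^sub>0 / 2 * (B + K * window_width p)"
      unfolding b_def by linarith
  qed
  moreover have "mono (\<lambda>L. Fbar n \<alpha>\<^sub>0 F L p)" if p: "p > 0" for p
  proof (rule monoI)
    fix L L' :: real assume "L \<le> L'"
    then show "Fbar n \<alpha>\<^sub>0 F L p \<le> Fbar n \<alpha>\<^sub>0 F L' p"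
      using speed[OF p] speed_le[OF _ _ l_mono less_imp_le[OF p]] by blast
  qed
  ultimately show ?thesis by blast
qed

end
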